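(* Let $(\mathbf X_t)_{t\ge 0}$ be a multi-type CBI process with parameters $(d,\mathbf c,\boldsymbol\beta,\mathbf B,\nu,\boldsymbol\mu)$ such that $\int_{\mathcal U_d}\|\mathbf r\|\,\mathbf 1_{\{\|\mathbf r\|\ge 1\}}\,\nu(\mathrm d\mathbf r)<\infty$. (i) If $\big(\nu+\sum_{i=1}^d\mu_i\big)(A)=0$ with some $A\in\mathcal R_d$, then $\pi_{t,\mathbf x}(A)=0$ for all $t>0$ and $\mathbf x\in\mathbb R_+^d$. (ii) If $\pi_{t,\mathbf x}(A)=0$ for some $t>0$, $\mathbf x\in(0,\infty)^d$ and $A\in\mathcal R_d$, then $\big(\nu+\sum_{i=1}^d\mu_i\big)(A)=0$. Furthermore, in case of $\boldsymbol\beta\in(0,\infty)^d$, this extends to $\mathbf x\in\mathbb R_+^d$, i.e., if $\pi_{t,\mathbf x}(A)=0$ for some $t>0$, $\mathbf x\in\mathbb R_+^d$ and $A\in\mathcal R_d$, then $\big(\nu+\sum_{i=1}^d\mu_i\big)(A)=0$.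
   Context: Notation. $\mathbb R_+=[0,\infty)$, $\mathcal U_d=\mathbb R_+^d\setminus\{\mathbf 0\}$, $\|\cdot\|$ is the Euclidean norm, $\langle\cdot,\cdot\rangle$ the Euclidean inner product, $a\wedge b=\min\{a,b\}$, $\mathbf e^{(d)}_1,\dots,\mathbf e^{(d)}_d$ is the natural basis of $\mathbb R^d$. Admissible parameters. $(d,\mathbf c,\boldsymbol\beta,\mathbf B,\nu,\boldsymbol\mu)$ is a set of admissible parameters if $d\in\mathbb N$ is a positive integer; $\mathbf c=(c_i)_{i=1}^d\in\mathbb R_+^d$; $\boldsymbol\beta=(\beta_i)_{i=1}^d\in\mathbb R_+^d$; $\mathbf B=(b_{i,j})_{i,j=1}^d\in\mathbb R^{d\times d}$ with $b_{i,j}\ge 0$ for $i\ne j$; $\nu$ is a Borel measure on $\mathcal U_d$ with $\int_{\mathcal U_d}(1\wedge\|\mathbf r\|)\,\nu(\mathrm d\mathbf r)<\infty$; and $\boldsymbol\mu=(\mu_1,\dots,\mu_d)$, where each $\mu_i$ is a Borel measure on $\mathcal U_d$ with $\int_{\mathcal U_d}\big[\|\mathbf z\|\wedge\|\mathbf z\|^2+\sum_{j\ne i}(1\wedge z_j)\big]\mu_i(\mathrm d\mathbf z)<\infty$. CBI process. The branching mechanism $\boldsymbol\varphi=(\varphi_1,\dots,\varphi_d):\mathbb R_+^d\to\mathbb R^d$ and immigration mechanism $\psi:\mathbb R_+^d\to\mathbb R_+$ are $$\varphi_i(\boldsymbol\lambda)=c_i\lambda_i^2-\langle\mathbf B\mathbf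 e_i^{(d)},\boldsymbol\lambda\rangle+\int_{\mathcal U_d}\big(\mathrm e^{-\langle\boldsymbol\lambda,\mathbf z\rangle}-1+\lambda_i(1\wedge z_i)\big)\mu_i(\mathrm d\mathbf z),\qquad \psi(\boldsymbol\lambda)=\langle\boldsymbol\beta,\boldsymbol\lambda\rangle+\int_{\mathcal U_d}\big(1-\mathrm e^{-\langle\boldsymbol\lambda,\mathbf r\rangle}\big)\nu(\mathrm d\mathbf r).$$ A multi-type CBI process with parameters $(d,\mathbf c,\boldsymbol\beta,\mathbf B,\nu,\boldsymbol\mu)$ (admissible) is a conservative (time-homogeneous) Markov process with state space $\mathbb R_+^d$ whose transition semigroup $(P_t)_{t\ge0}$ is the unique one with $$\int_{\mathbb R_+^d}\mathrm e^{-\langle\boldsymbol\lambda,\mathbf y\rangle}P_t(\mathbf x,\mathrm d\mathbf y)=\exp\Big\{-\langle\mathbf x,\mathbf v(t,\boldsymbol\lambda)\rangle-\int_0^t\psi(\mathbf v(s,\boldsymbol\lambda))\,\mathrm ds\Big\},\qquad \mathbf x,\boldsymbol\lambda\in\mathbb R_+^d,\ t\ge0,$$ where $t\mapsto\mathbf v(t,\boldsymbol\lambda)\in\mathbb R_+^d$ is the unique locally bounded (continuously differentiable) solution of $\partial_t v_i(t,\boldsymbol\lambda)=-\varphi_i(\mathbf v(t,\boldsymbol\lambda))$, $v_i(0,\boldsymbol\lambda)=\lambda_i$, $i=1,\dots,d$. The process is taken to have càdlàg sample paths. $\mathbb P_{\mathbf x}$ denotes $\mathbb P(\,\cdot\mid\mathbf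 X_0=\mathbf x)$, i.e. the law of the process started from $\mathbf x$. Jumps. $\Delta\mathbf X_u=\mathbf X_u-\mathbf X_{u-}$ for $u>0$. The supremum of an $\mathbb R^d$-valued process is coordinate-wise: $\sup_{s\in(0,t]}\Delta\mathbf X_s=\big(\sup_{s\in(0,t]}\Delta X_{s,1},\dots,\sup_{s\in(0,t]}\Delta X_{s,d}\big)^\top$. For $t>0$, $\mathbf x\in\mathbb R_+^d$, $\pi_{t,\mathbf x}$ is the probability measure on $(\mathbb R_+^d,\mathcal B(\mathbb R_+^d))$ given by $\pi_{t,\mathbf x}(A)=\mathbb P_{\mathbf x}\big(\sup_{s\in(0,t]}\Delta\mathbf X_s\in A\big)$. Rectangles. $\mathcal R_d=\Big\{\big(\prod_{i=1}^d[0,w_i]\big)\setminus\{\mathbf 0\}:\ w_1,\dots,w_d>0\Big\}$. *)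

theory Defs
  imports "HOL-Probability.Probability"
begin

text \<open>The dimension is the cardinality of the finite index type \<open>'d\<close>; it is at least one, as
  types are nonempty.\<close>

definition nonneg_orthant :: "(real ^ 'd) set" where
  "nonneg_orthant = {x. \<forall>i. 0 \<le> x $ i}"

definition pos_orthant :: "(real ^ 'd) set" where
  "pos_orthant = {x. \<forall>i. 0 < x $ i}"

definition punctured_orthant :: "(real ^ 'd) set" where
  "punctured_orthant = nonneg_orthant - {0}"

definition orthant_space :: "(real ^ 'd) measure" where
  "orthant_space = restrict_space borel nonneg_orthant"

definition punctured_space :: "(real ^ 'd) measure" where
  "punctured_space = restrict_space borel punctured_orthant"

text \<open>Entry \<open>b\<^sub>i\<^sub>j\<close> of the matrix is \<open>B $ i $ j\<close>.\<close>

definition admissible ::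
  "real ^ 'd \<Rightarrow> real ^ 'd \<Rightarrow> real ^ 'd ^ 'd \<Rightarrow> (real ^ 'd) measure \<Rightarrow> ('d \<Rightarrow> (real ^ 'd) measure) \<Rightarrow> bool"
  where
  "admissible c \<beta> B \<nu> \<mu> \<longleftrightarrow>
     c \<in> nonneg_orthant \<and> \<beta> \<in> nonneg_orthant \<and>
     (\<forall>i j. i \<noteq> j \<longrightarrow> 0 \<le> B $ i $ j) \<and>
     sets \<nu> = sets punctured_space \<and>
     (\<integral>\<^sup>+ r. ennreal (min 1 (norm r)) \<partial>\<nu>) < \<infinity> \<and>
     (\<forall>i. sets (\<mu> i) = sets punctured_space \<and>
          (\<integral>\<^sup>+ z. ennreal (min (norm z) ((norm z)\<^sup>2) + (\<Sum>j\<in>UNIV - {i}. min 1 (z $ j))) \<partial>\<mu> i) < \<infinity>)"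

definition branching_mechanism ::
  "real ^ 'd \<Rightarrow> real ^ 'd ^ 'd \<Rightarrow> ('d \<Rightarrow> (real ^ 'd) measure) \<Rightarrow> real ^ 'd \<Rightarrow> real ^ 'd" where
  "branching_mechanism c B \<mu> \<xi> =
     (\<chi> i. c $ i * (\<xi> $ i)\<^sup>2 - (B *v axis i 1) \<bullet> \<xi> +
           (\<integral>z. exp (- (\<xi> \<bullet> z)) - 1 + \<xi> $ i * min 1 (z $ i) \<partial>\<mu> i))"

definition immigration_mechanism ::
  "real ^ 'd \<Rightarrow> (real ^ 'd) measure \<Rightarrow> real ^ 'd \<Rightarrow> real" where
  "immigration_mechanism \<beta> \<nu> \<xi> = \<beta> \<bullet> \<xi> + (\<integral>r. 1 - exp (- (\<xi> \<bullet> r)) \<partial>\<nu>)"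

text \<open>Solutions in the orthant of \<open>\<partial>\<^sub>t v = - \<phi>(v)\<close>, \<open>v(0, \<xi>) = \<xi>\<close>, with a one-sided derivative at
  time 0.  Differentiability in \<open>t\<close> makes \<open>v\<close> locally bounded, so that \<open>v\<close> is unique on
  \<open>t \<ge> 0\<close>, \<open>\<xi> \<in> nonneg_orthant\<close>.\<close>

definition cumulant_semigroup ::
  "real ^ 'd \<Rightarrow> real ^ 'd ^ 'd \<Rightarrow> ('d \<Rightarrow> (real ^ 'd) measure) \<Rightarrow> (real \<Rightarrow> real ^ 'd \<Rightarrow> real ^ 'd) \<Rightarrow> bool"
  where
  "cumulant_semigroup c B \<mu> v \<longleftrightarrow>
     (\<forall>\<xi>\<in>nonneg_orthant. v 0 \<xi> = \<xi> \<and>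
        (\<forall>t\<ge>0. v t \<xi> \<in> nonneg_orthant \<and>
               ((\<lambda>s. v s \<xi>) has_vector_derivative - branching_mechanism c B \<mu> (v t \<xi>))
                 (at t within {0..})))"

definition markov_semigroup :: "'a measure \<Rightarrow> (real \<Rightarrow> 'a \<Rightarrow> 'a measure) \<Rightarrow> bool" where
  "markov_semigroup S Q \<longleftrightarrow>
     (\<forall>t\<ge>0. Q t \<in> S \<rightarrow>\<^sub>M prob_algebra S) \<and>
     (\<forall>x\<in>space S. Q 0 x = return S x) \<and>
     (\<forall>s\<ge>0. \<forall>t\<ge>0. \<forall>x\<in>space S. Q (s + t) x = Q s x \<bind> Q t)"

definition cbi_semigroup ::
  "real ^ 'd \<Rightarrow> real ^ 'd \<Rightarrow> real ^ 'd ^ 'd \<Rightarrow> (real ^ 'd) measure \<Rightarrow> ('d \<Rightarrow> (real ^ 'd) measure) \<Rightarrow>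
   (real \<Rightarrow> real ^ 'd \<Rightarrow> (real ^ 'd) measure) \<Rightarrow> bool" where
  "cbi_semigroup c \<beta> B \<nu> \<mu> Q \<longleftrightarrow>
     markov_semigroup orthant_space Q \<and>
     (\<exists>v. cumulant_semigroup c B \<mu> v \<and>
       (\<forall>t\<ge>0. \<forall>x\<in>nonneg_orthant. \<forall>\<xi>\<in>nonneg_orthant.
          (\<integral>y. exp (- (\<xi> \<bullet> y)) \<partial>Q t x) =
          exp (- (x \<bullet> v t \<xi>) - integral {0..t} (\<lambda>s. immigration_mechanism \<beta> \<nu> (v s \<xi>)))))"

definition cadlag :: "(real \<Rightarrow> 'b::topological_space) \<Rightarrow> bool" where
  "cadlag f \<longleftrightarrow>
     (\<forall>t\<ge>0. (f \<longlongrightarrow> f t) (at_right t)) \<and> (\<forall>t>0. \<exists>l. (f \<longlongrightarrow> l) (at_left t))"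

definition past :: "'w measure \<Rightarrow> 'a measure \<Rightarrow> (real \<Rightarrow> 'w \<Rightarrow> 'a) \<Rightarrow> real \<Rightarrow> 'w measure" where
  "past M S X s = sigma (space M) (\<Union>u\<in>{0..s}. {X u -` A \<inter> space M |A. A \<in> sets S})"

text \<open>A process with state space \<open>S\<close>, started from \<open>x\<close>, that is Markov with respect to its natural
  filtration.\<close>

definition markov_process_from ::
  "'w measure \<Rightarrow> 'a measure \<Rightarrow> (real \<Rightarrow> 'a \<Rightarrow> 'a measure) \<Rightarrow> (real \<Rightarrow> 'w \<Rightarrow> 'a) \<Rightarrow> 'a \<Rightarrow> bool" where
  "markov_process_from M S Q X x \<longleftrightarrow>
     prob_space M \<and>
     (\<forall>t\<ge>0. X t \<in> M \<rightarrow>\<^sub>M S) \<and>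
     (AE \<omega> in M. X 0 \<omega> = x) \<and>
     (\<forall>s\<ge>0. \<forall>t\<ge>0. \<forall>A\<in>sets S.
        AE \<omega> in M. real_cond_exp M (past M S X s) (\<lambda>\<omega>'. indicator A (X (s + t) \<omega>')) \<omega> =
                   measure (Q t (X s \<omega>)) A)"

text \<open>\<open>X\<close> is a process on the measurable space underlying \<open>\<Omega>\<close> (the measure of \<open>\<Omega>\<close> plays no
  role), and \<open>P x\<close> is the probability measure under which it starts from \<open>x\<close>.\<close>

definition cbi_process ::
  "real ^ 'd \<Rightarrow> real ^ 'd \<Rightarrow> real ^ 'd ^ 'd \<Rightarrow> (real ^ 'd) measure \<Rightarrow> ('d \<Rightarrow> (real ^ 'd) measure) \<Rightarrow>
   'w measure \<Rightarrow> (real ^ 'd \<Rightarrow> 'w measure) \<Rightarrow> (real \<Rightarrow> 'w \<Rightarrow> real ^ 'd) \<Rightarrow> bool" where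
  "cbi_process c \<beta> B \<nu> \<mu> \<Omega> P X \<longleftrightarrow>
     admissible c \<beta> B \<nu> \<mu> \<and>
     (\<forall>\<omega>\<in>space \<Omega>. cadlag (\<lambda>t. X t \<omega>)) \<and>
     (\<exists>Q. cbi_semigroup c \<beta> B \<nu> \<mu> Q \<and>
          (\<forall>x\<in>nonneg_orthant. sets (P x) = sets \<Omega> \<and>
             markov_process_from (P x) orthant_space Q X x))"

definition jump :: "(real \<Rightarrow> 'b::real_normed_vector) \<Rightarrow> real \<Rightarrow> 'b" where
  "jump f u = f u - Lim (at_left u) f"

text \<open>On \<open>{0<..t}\<close> a cadlag path has bounded jumps, hence the real-valued suprema are meaningful.\<close>

definition sup_jump :: "(real \<Rightarrow> real ^ 'd) \<Rightarrow> real \<Rightarrow> real ^ 'd" where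
  "sup_jump f t = (\<chi> i. SUP s\<in>{0<..t}. jump f s $ i)"

definition sup_jump_law ::
  "(real ^ 'd \<Rightarrow> 'w measure) \<Rightarrow> (real \<Rightarrow> 'w \<Rightarrow> real ^ 'd) \<Rightarrow> real \<Rightarrow> real ^ 'd \<Rightarrow> (real ^ 'd) measure"
  where
  "sup_jump_law P X t x = distr (P x) orthant_space (\<lambda>\<omega>. sup_jump (\<lambda>s. X s \<omega>) t)"

definition rectangles :: "(real ^ 'd) set set" where
  "rectangles = {cbox 0 w - {0} |w. w \<in> pos_orthant}"

end

theory Submission
  imports Defs
begin

text \<open>
  The state-dependent measure \<open>\<nu> + (\<Sum>j. y $ j * \<mu> j)\<close> is the intensity of the jumps of the process at \<open>y\<close>.
  Only Laplace transforms of the transition kernels are given, so the proof first recovers this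
  intensity from them, and then argues on grids, using one-step estimates and the Markov property.

  \<^item> \<^emph>\<open>From jumps to increments.\<close> The largest increment of a path with left limits over the cells of an
    ever finer grid converges to the supremum of its jumps (\<open>grid_max_tendsto_sup_jump\<close>).  It
    therefore suffices to control increments over short times \<open>h\<close>.

  \<^item> \<^emph>\<open>The law of a short increment.\<close> The logarithm of the Laplace transform at \<open>\<xi>\<close> of an increment
    from \<open>y\<close> is affine in \<open>y\<close>, and its derivative at \<open>h = 0\<close> is given by the branching and
    immigration mechanisms.  Second differences in \<open>\<xi>\<close> remove drift and compensation and leave the
    integral of \<open>quad z * exp (- (\<xi> \<bullet> z))\<close> against the intensity, together with a contribution of the
    diffusion that sits at \<open>z = 0\<close>.  In the coordinates \<open>exp (- (z $ i))\<close>, which map the increments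
    from a bounded set into a compact box, these exponentials are monomials; by Stone-Weierstrass
    the limit extends to all continuous functions of these coordinates, uniformly for bounded
    \<open>y\<close> (\<open>increment_form_limit\<close>).

  \<^item> \<^emph>\<open>No small suprema.\<close> If the intensity does not charge \<open>[0, w]\<close> without the origin, the rate of
    increments that exceed \<open>\<epsilon>\<close> in some coordinate and stay below \<open>w\<close> up to a tolerance tends to
    zero with the tolerance.  The number of grid cells is of order \<open>1 / h\<close>, so a union bound shows that
    such increments do not occur in the limit (\<open>sup_jump_small_probability\<close>).

  \<^item> \<^emph>\<open>Small suprema occur.\<close> If the intensity charges this set, then some state has a positive rate of
    jumps into it.  The process reaches such states within a time \<open>s\<close> with a probability that beats the
    probability, of order \<open>s\<close>, of a large increment up to then (\<open>reach_positive_rate\<close>; the positivity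
    of the start or of the immigration drift enters here).  From there it makes an
    increment of the desired size, and it then avoids large increments up to the end.  The last point
    requires all moderate times, whereas the rate of large increments is unbounded in the state.
    But from mass of order \<open>j\<close> a displacement by one unit takes a time of order \<open>1 / (j + 1)\<close>, and these
    times have a divergent sum (\<open>survive\<close>).  All bounds are uniform in the tolerance \<open>w'\<close> in place of
    \<open>w\<close>, which finally decreases to \<open>w\<close> (\<open>sup_jump_probability_positive\<close>).
\<close>

section \<open>Paths and their jumps\<close>

lemma cadlag_component:
  assumes "cadlag f"
  shows "cadlag (\<lambda>t. f t $ i)"
  using assms unfolding cadlag_def by (blast intro: tendsto_vec_nth)

lemma cadlag_tendsto_at_left:
  fixes f :: "real \<Rightarrow> 'a::t2_space"
  assumes "cadlag f" "0 < u"
  shows "(f \<longlongrightarrow> Lim (at_left u) f) (at_left u)"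
proof -
  obtain l where "(f \<longlongrightarrow> l) (at_left u)" using assms unfolding cadlag_def by blast
  moreover from this have "Lim (at_left u) f = l" by (intro tendsto_Lim) auto
  ultimately show ?thesis by simp
qed

lemma jump_component:
  assumes "cadlag f" "0 < u"
  shows "jump f u $ i = jump (\<lambda>t. f t $ i) u"
proof -
  have "Lim (at_left u) (\<lambda>t. f t $ i) = Lim (at_left u) f $ i"
    using tendsto_vec_nth[OF cadlag_tendsto_at_left[OF assms]] by (intro tendsto_Lim) auto
  then show ?thesis by (simp add: jump_def)
qed

lemma cadlag_near_left:
  fixes f :: "real \<Rightarrow> real"
  assumes "cadlag f" "0 < u" "0 < e"
  obtains d where "0 < d" "\<And>s. u - d < s \<Longrightarrow> s < u \<Longrightarrow> \<bar>f s - Lim (at_left u) f\<bar> < e"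
proof -
  have "\<forall>\<^sub>F s in at_left u. dist (f s) (Lim (at_left u) f) < e"
    using cadlag_tendsto_at_left[OF assms(1,2)] assms(3) by (rule tendstoD)
  then obtain b where "b < u" "\<And>s. b < s \<Longrightarrow> s < u \<Longrightarrow> dist (f s) (Lim (at_left u) f) < e"
    unfolding eventually_at_left_field by blast
  then show ?thesis by (intro that[of "u - b"]) (auto simp: dist_real_def)
qed

lemma cadlag_near_right:
  fixes f :: "real \<Rightarrow> real"
  assumes "cadlag f" "0 \<le> u" "0 < e"
  obtains d where "0 < d" "\<And>s. u \<le> s \<Longrightarrow> s < u + d \<Longrightarrow> \<bar>f s - f u\<bar> < e"
proof -
  have "\<forall>\<^sub>F s in at_right u. dist (f s) (f u) < e"
    using assms unfolding cadlag_def by (intro tendstoD) auto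
  then obtain b where b: "b > u" "\<And>s. u < s \<Longrightarrow> s < b \<Longrightarrow> dist (f s) (f u) < e"
    unfolding eventually_at_right_field by blast
  have "\<bar>f s - f u\<bar> < e" if "u \<le> s" "s < u + (b - u)" for s
    using b(2)[of s] that assms(3) by (cases "s = u") (auto simp: dist_real_def)
  then show ?thesis using b(1) by (intro that[of "b - u"]) auto
qed

lemma cadlag_bounded:
  fixes f :: "real \<Rightarrow> real"
  assumes "cadlag f" "0 < t"
  obtains C where "\<And>s. 0 \<le> s \<Longrightarrow> s \<le> t \<Longrightarrow> \<bar>f s\<bar> \<le> C"
proof -
  have loc: "\<exists>d>0. \<exists>C. \<forall>s\<in>{u - d<..<u + d} \<inter> {0..t}. \<bar>f s\<bar> \<le> C" if u: "u \<in> {0..t}" for u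
  proof -
    obtain d1 where d1: "0 < d1" "\<And>s. u \<le> s \<Longrightarrow> s < u + d1 \<Longrightarrow> \<bar>f s - f u\<bar> < 1"
      using cadlag_near_right[OF assms(1), of u 1] u by auto
    show ?thesis
    proof (cases "u = 0")
      case True
      have "\<bar>f s\<bar> \<le> \<bar>f u\<bar> + 1" if "s \<in> {u - d1<..<u + d1} \<inter> {0..t}" for s
        using d1(2)[of s] that True by auto
      then show ?thesis using d1(1) by blast
    next
      case False
      then obtain d2 where d2: "0 < d2"
          "\<And>s. u - d2 < s \<Longrightarrow> s < u \<Longrightarrow> \<bar>f s - Lim (at_left u) f\<bar> < 1"
        using cadlag_near_left[OF assms(1), of u 1] u by auto
      have "\<bar>f s\<bar> \<le> \<bar>f u\<bar> + \<bar>Lim (at_left u) f\<bar> + 1"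
        if "s \<in> {u - min d1 d2<..<u + min d1 d2} \<inter> {0..t}" for s
        using d1(2)[of s] d2(2)[of s] that by (cases "s < u") (simp_all, linarith+)
      then show ?thesis using d1(1) d2(1) by (metis min_less_iff_conj)
    qed
  qed
  then obtain d C where dC: "\<And>u. u \<in> {0..t} \<Longrightarrow> 0 < d u"
      "\<And>u s. u \<in> {0..t} \<Longrightarrow> s \<in> {u - d u<..<u + d u} \<inter> {0..t} \<Longrightarrow> \<bar>f s\<bar> \<le> C u"
    by metis
  obtain T where T: "T \<subseteq> {0..t}" "finite T" "{0..t} \<subseteq> (\<Union>u\<in>T. {u - d u<..<u + d u})"
  proof (rule compactE_image[of "{0..t}" "{0..t}" "\<lambda>u. {u - d u<..<u + d u}"])
    show "{0..t} \<subseteq> (\<Union>u\<in>{0..t}. {u - d u<..<u + d u})" using dC(1) by force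
  qed auto
  have "\<bar>f s\<bar> \<le> (\<Sum>u\<in>T. \<bar>C u\<bar>)" if s: "0 \<le> s" "s \<le> t" for s
  proof -
    obtain u where u: "u \<in> T" "s \<in> {u - d u<..<u + d u}" using T(3) s by force
    have "\<bar>f s\<bar> \<le> \<bar>C u\<bar>" using dC(2)[of u s] u T(1) s by force
    also have "\<dots> \<le> (\<Sum>u\<in>T. \<bar>C u\<bar>)" using u(1) T(2) by (intro member_le_sum) auto
    finally show ?thesis .
  qed
  then show ?thesis using that by blast
qed

lemma cadlag_left_limit_bound:
  fixes f :: "real \<Rightarrow> real"
  assumes "cadlag f" "0 < u" "0 < d" "\<And>s. u - d < s \<Longrightarrow> s < u \<Longrightarrow> \<bar>f s - a\<bar> \<le> C"
  shows "\<bar>Lim (at_left u) f - a\<bar> \<le> C"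
proof -
  have "((\<lambda>s. \<bar>f s - a\<bar>) \<longlongrightarrow> \<bar>Lim (at_left u) f - a\<bar>) (at_left u)"
    by (intro tendsto_intros cadlag_tendsto_at_left assms)
  moreover have "\<forall>\<^sub>F s in at_left u. \<bar>f s - a\<bar> \<le> C"
    unfolding eventually_at_left_field using assms(3,4) by (intro exI[of _ "u - d"]) auto
  ultimately show ?thesis by (intro tendsto_upperbound) auto
qed

lemma cadlag_bdd_above_jumps:
  fixes f :: "real \<Rightarrow> real"
  assumes "cadlag f" "0 < t"
  shows "bdd_above (jump f ` {0<..t})"
proof -
  obtain C where C: "\<And>s. 0 \<le> s \<Longrightarrow> s \<le> t \<Longrightarrow> \<bar>f s\<bar> \<le> C"
    using cadlag_bounded[OF assms] by blast
  have "jump f u \<le> 2 * C" if u: "u \<in> {0<..t}" for u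
  proof -
    have "\<bar>Lim (at_left u) f - 0\<bar> \<le> C"
      using C u by (intro cadlag_left_limit_bound[OF assms(1), of u u]) auto
    moreover have "\<bar>f u\<bar> \<le> C" using C[of u] u by simp
    ultimately show ?thesis unfolding jump_def by linarith
  qed
  then show ?thesis by (intro bdd_aboveI2)
qed

text \<open>Right continuity makes the jumps at times shortly after a given one small, so the supremum cannot be
  negative even if every jump is.\<close>

lemma SUP_jump_nonneg:
  fixes f :: "real \<Rightarrow> real"
  assumes "cadlag f" "0 < t"
  shows "0 \<le> (SUP s\<in>{0<..t}. jump f s)"
proof (rule field_le_epsilon)
  fix e :: real assume e: "0 < e"
  obtain d where d: "0 < d" "\<And>s. t/2 \<le> s \<Longrightarrow> s < t/2 + d \<Longrightarrow> \<bar>f s - f (t/2)\<bar> < e/2"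
    using cadlag_near_right[OF assms(1), of "t/2" "e/2"] assms e by auto
  define s where "s = t/2 + min d t / 2"
  have s: "t/2 < s" "s < t/2 + d" "s \<le> t" using d assms by (auto simp: s_def min_def field_simps)
  have "\<bar>Lim (at_left s) f - f (t/2)\<bar> \<le> e/2"
    using s d(2) assms
    by (intro cadlag_left_limit_bound[OF assms(1), of s "s - t/2"]) (auto intro!: less_imp_le)
  then have "- e \<le> jump f s" using d(2)[of s] s unfolding jump_def by (simp, linarith)
  also have "\<dots> \<le> (SUP s\<in>{0<..t}. jump f s)"
    using s assms by (intro cSUP_upper cadlag_bdd_above_jumps) auto
  finally show "0 \<le> (SUP s\<in>{0<..t}. jump f s) + e" by simp
qed

text \<open>Near a given time, a right-continuous path with left limits changes over short intervals
  either by almost nothing or by almost the jump at that time; compactness of \<open>[0, t]\<close> makes this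
  uniform.\<close>

lemma cadlag_increment_bound:
  fixes f :: "real \<Rightarrow> real"
  assumes "cadlag f" "0 < t" "0 < e"
  obtains d where "0 < d"
    "\<And>s s'. 0 \<le> s \<Longrightarrow> s \<le> s' \<Longrightarrow> s' \<le> t \<Longrightarrow> s' - s < d \<Longrightarrow>
       f s' - f s \<le> (SUP s\<in>{0<..t}. jump f s) + e"
proof -
  let ?S = "SUP s\<in>{0<..t}. jump f s"
  have S0: "0 \<le> ?S" using SUP_jump_nonneg[OF assms(1,2)] .
  have loc: "\<exists>d>0. \<forall>s\<in>{u - d<..<u + d}. \<forall>s'\<in>{u - d<..<u + d}.
      0 \<le> s \<longrightarrow> s \<le> s' \<longrightarrow> f s' - f s \<le> ?S + e" if u: "u \<in> {0..t}" for u
  proof -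
    obtain d1 where d1: "0 < d1" "\<And>s. u \<le> s \<Longrightarrow> s < u + d1 \<Longrightarrow> \<bar>f s - f u\<bar> < e/2"
      using cadlag_near_right[OF assms(1), of u "e/2"] u assms(3) by auto
    show ?thesis
    proof (cases "u = 0")
      case True
      have "f s' - f s \<le> ?S + e" if "s \<in> {u - d1<..<u + d1}" "s' \<in> {u - d1<..<u + d1}"
          "0 \<le> s" "s \<le> s'" for s s'
        using d1(2)[of s] d1(2)[of s'] that True S0 by (simp, linarith)
      then show ?thesis using d1(1) by blast
    next
      case False
      then obtain d2 where d2: "0 < d2"
          "\<And>s. u - d2 < s \<Longrightarrow> s < u \<Longrightarrow> \<bar>f s - Lim (at_left u) f\<bar> < e/2"
        using cadlag_near_left[OF assms(1), of u "e/2"] u assms(3) by auto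
      have J: "jump f u \<le> ?S" using u False
        by (intro cSUP_upper cadlag_bdd_above_jumps assms) auto
      have "f s' - f s \<le> ?S + e" if "s \<in> {u - min d1 d2<..<u + min d1 d2}"
        "s' \<in> {u - min d1 d2<..<u + min d1 d2}" "s \<le> s'" for s s'
      proof -
        have s: "u - d2 < s" "s' < u + d1" "u - d2 < s'" "s < u + d1" using that by auto
        show ?thesis
        proof (cases "s < u")
          case s_less: True
          show ?thesis
          proof (cases "s' < u")
            case True
            then show ?thesis using d2(2)[of s] d2(2)[of s'] s s_less S0 by linarith
          next
            case False
            then show ?thesis using d2(2)[of s] d1(2)[of s'] s s_less J unfolding jump_def by linarith
          qed
        next
          case False
          then show ?thesis using d1(2)[of s] d1(2)[of s'] s that(3) S0 by linarith
        qed
      qed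
      then show ?thesis using d1(1) d2(1) by (metis min_less_iff_conj)
    qed
  qed
  then obtain d where d: "\<And>u. u \<in> {0..t} \<Longrightarrow> 0 < d u"
    "\<And>u s s'. u \<in> {0..t} \<Longrightarrow> s \<in> {u - d u<..<u + d u} \<Longrightarrow> s' \<in> {u - d u<..<u + d u} \<Longrightarrow>
      0 \<le> s \<Longrightarrow> s \<le> s' \<Longrightarrow> f s' - f s \<le> ?S + e"
    by metis
  obtain r where r: "0 < r"
    "\<forall>x\<in>{0..t}. \<exists>G\<in>(\<lambda>u. {u - d u<..<u + d u}) ` {0..t}. ball x r \<subseteq> G"
  proof (rule Heine_Borel_lemma[of "{0..t}" "(\<lambda>u. {u - d u<..<u + d u}) ` {0..t}"])
    show "{0..t} \<subseteq> \<Union> ((\<lambda>u. {u - d u<..<u + d u}) ` {0..t})" using d(1) by force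
  qed auto
  have "f s' - f s \<le> ?S + e" if s: "0 \<le> s" "s \<le> s'" "s' \<le> t" "s' - s < r" for s s'
  proof -
    have "s \<in> {0..t}" using s by auto
    then obtain u where u: "u \<in> {0..t}" "ball s r \<subseteq> {u - d u<..<u + d u}" using r(2) by blast
    have "s \<in> ball s r" "s' \<in> ball s r" using s r(1) by (auto simp: dist_real_def)
    then show ?thesis using d(2)[OF u(1)] u(2) s by blast
  qed
  then show ?thesis using that r(1) by blast
qed

definition grid_max :: "(real \<Rightarrow> real) \<Rightarrow> real \<Rightarrow> nat \<Rightarrow> real" where
  "grid_max f t N = Max ((\<lambda>k. f (real (Suc k) * (t / real N)) - f (real k * (t / real N))) ` {..<N})"

text \<open>Refining the grid isolates every single jump in one cell, and \<open>cadlag_increment_bound\<close> shows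
  that the other cells cannot contribute more.\<close>

lemma grid_max_tendsto_SUP_jump:
  fixes f :: "real \<Rightarrow> real"
  assumes "cadlag f" "0 < t"
  shows "grid_max f t \<longlonglongrightarrow> (SUP s\<in>{0<..t}. jump f s)"
proof (rule LIMSEQ_I)
  let ?S = "SUP s\<in>{0<..t}. jump f s"
  fix e :: real assume e: "0 < e"
  obtain d where d: "0 < d"
    "\<And>s s'. 0 \<le> s \<Longrightarrow> s \<le> s' \<Longrightarrow> s' \<le> t \<Longrightarrow> s' - s < d \<Longrightarrow> f s' - f s \<le> ?S + e/2"
    using cadlag_increment_bound[OF assms, of "e/2"] e by auto
  have "\<exists>u\<in>{0<..t}. ?S - e/2 < jump f u"
    using less_cSUP_iff[OF _ cadlag_bdd_above_jumps[OF assms], of "?S - e/2"] e assms(2) by auto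
  then obtain u where u: "0 < u" "u \<le> t" "?S - e/2 < jump f u" by auto
  obtain d1 where d1: "0 < d1" "\<And>s. u \<le> s \<Longrightarrow> s < u + d1 \<Longrightarrow> \<bar>f s - f u\<bar> < e/4"
    using cadlag_near_right[OF assms(1), of u "e/4"] u e by auto
  obtain d2 where d2: "0 < d2" "\<And>s. u - d2 < s \<Longrightarrow> s < u \<Longrightarrow> \<bar>f s - Lim (at_left u) f\<bar> < e/4"
    using cadlag_near_left[OF assms(1), of u "e/4"] u e by auto
  define m where "m = min d (min d1 d2)"
  have m: "0 < m" "m \<le> d" "m \<le> d1" "m \<le> d2" using d d1 d2 by (auto simp: m_def)
  obtain N0 :: nat where N0: "t / m < real N0" using reals_Archimedean2 by blast
  have "norm (grid_max f t N - ?S) < e" if N: "N \<ge> Suc N0" for N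
  proof -
    define h where "h = t / real N"
    have Npos: "0 < real N" using N by simp
    have "t / m < real N" using N0 N by linarith
    then have h: "0 < h" "h < m" "real N * h = t" using assms(2) m(1) Npos
      by (auto simp: h_def field_simps)
    have inc_le: "f (real (Suc k) * h) - f (real k * h) \<le> ?S + e/2" if "k < N" for k
    proof (rule d(2))
      have "real (Suc k) * h \<le> real N * h" using that h(1) by (intro mult_right_mono) auto
      then show "real (Suc k) * h \<le> t" using h(3) by simp
      show "real (Suc k) * h - real k * h < d" using h m by (simp add: algebra_simps)
    qed (use h in \<open>auto simp: algebra_simps\<close>)
    define k where "k = nat (\<lceil>u / h\<rceil>) - 1"
    have c1: "1 \<le> \<lceil>u / h\<rceil>" using u h by (simp add: less_ceiling_iff one_le_ceiling)
    then have k': "real (Suc k) = of_int \<lceil>u / h\<rceil>" unfolding k_def by simp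
    then have k1: "u / h \<le> real (Suc k)" "real k < u / h" using ceiling_correct[of "u / h"]
      by linarith+
    then have k2: "u \<le> real (Suc k) * h" "real k * h < u" using h(1) by (auto simp: field_simps)
    have "real k * h < real N * h" using k2 u h by linarith
    then have kN: "k < N" using h(1) by simp
    have sep: "real (Suc k) * h = real k * h + h" by (simp add: algebra_simps)
    have "\<bar>f (real (Suc k) * h) - f u\<bar> < e/4" using k2 h m sep by (intro d1(2)) linarith+
    moreover have "\<bar>f (real k * h) - Lim (at_left u) f\<bar> < e/4"
      using k2 h m sep by (intro d2(2)) linarith+
    ultimately have "f (real (Suc k) * h) - f (real k * h) > ?S - e"
      using u(3) unfolding jump_def by linarith
    moreover have "f (real (Suc k) * h) - f (real k * h) \<le> grid_max f t N"
      unfolding grid_max_def h_def[symmetric] using kN by (intro Max_ge) auto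
    moreover have "grid_max f t N \<le> ?S + e/2"
      unfolding grid_max_def h_def[symmetric] using kN inc_le by (subst Max_le_iff) auto
    ultimately show ?thesis using e by (auto simp: abs_less_iff)
  qed
  then show "\<exists>no. \<forall>n\<ge>no. norm (grid_max f t n - ?S) < e" by blast
qed

lemma sup_jump_component:
  assumes "cadlag f"
  shows "sup_jump f t $ i = (SUP s\<in>{0<..t}. jump (\<lambda>t. f t $ i) s)"
  unfolding sup_jump_def vec_lambda_beta
  by (intro SUP_cong refl jump_component[OF assms]) auto

lemma grid_max_tendsto_sup_jump:
  assumes "cadlag f" "0 < t"
  shows "grid_max (\<lambda>s. f s $ i) t \<longlonglongrightarrow> sup_jump f t $ i"
  unfolding sup_jump_component[OF assms(1)]
  by (intro grid_max_tendsto_SUP_jump cadlag_component assms)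

lemma sup_jump_nonneg:
  assumes "cadlag f" "0 < t"
  shows "sup_jump f t \<in> nonneg_orthant"
  unfolding nonneg_orthant_def sup_jump_component[OF assms(1)] mem_Collect_eq
  by (intro allI SUP_jump_nonneg cadlag_component assms)

section \<open>Branching and immigration mechanisms\<close>

definition mass :: "real ^ 'd \<Rightarrow> real" where
  "mass y = (\<Sum>i\<in>UNIV. y $ i)"

text \<open>A substitute for the squared norm: of second order at the origin, bounded on the orthant, and, in
  contrast to the squared norm, a combination of exponentials.\<close>

definition quad :: "real ^ 'd \<Rightarrow> real" where
  "quad z = (\<Sum>i\<in>UNIV. (1 - exp (- (z $ i)))\<^sup>2)"

text \<open>These differences annihilate affine functions, hence the drift terms and the compensators of
  both mechanisms, and turn \<open>exp (- (\<xi> \<bullet> z))\<close> into a multiple of itself by \<open>quad z\<close>.\<close>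

definition second_difference :: "(real ^ 'd \<Rightarrow> real) \<Rightarrow> real ^ 'd \<Rightarrow> real" where
  "second_difference F \<xi> =
     (\<Sum>i\<in>UNIV. F \<xi> - 2 * F (\<xi> + axis i 1) + F (\<xi> + axis i 2))"

lemma nonneg_orthantD: "y \<in> nonneg_orthant \<Longrightarrow> 0 \<le> y $ i"
  by (simp add: nonneg_orthant_def)

lemma nonneg_orthant_add: "x \<in> nonneg_orthant \<Longrightarrow> y \<in> nonneg_orthant \<Longrightarrow> x + y \<in> nonneg_orthant"
  by (simp add: nonneg_orthant_def)

lemma axis_nonneg_orthant: "0 \<le> a \<Longrightarrow> axis i a \<in> nonneg_orthant"
  by (simp add: nonneg_orthant_def axis_def)

lemma inner_nonneg_orthant: "x \<in> nonneg_orthant \<Longrightarrow> y \<in> nonneg_orthant \<Longrightarrow> 0 \<le> x \<bullet> y"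
  unfolding inner_vec_def by (intro sum_nonneg) (auto simp: nonneg_orthant_def)

lemma component_le_mass: "y \<in> nonneg_orthant \<Longrightarrow> y $ i \<le> mass y"
  unfolding mass_def by (rule member_le_sum) (auto simp: nonneg_orthant_def)

lemma mass_nonneg: "y \<in> nonneg_orthant \<Longrightarrow> 0 \<le> mass y"
  unfolding mass_def by (intro sum_nonneg) (auto simp: nonneg_orthant_def)

lemma punctured_orthant_subset: "punctured_orthant \<subseteq> nonneg_orthant"
  by (auto simp: punctured_orthant_def)

lemma closed_nonneg_orthant: "closed (nonneg_orthant :: (real ^ 'd) set)"
proof -
  have "(nonneg_orthant :: (real ^ 'd) set) = (\<Inter>i. {x. 0 \<le> x $ i})"
    by (auto simp: nonneg_orthant_def)
  also have "closed \<dots>"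
    by (intro closed_INT ballI closed_Collect_le continuous_intros)
  finally show ?thesis .
qed

lemma nonneg_orthant_borel [measurable]: "nonneg_orthant \<in> sets borel"
  by (intro borel_closed closed_nonneg_orthant)

lemma punctured_orthant_borel [measurable]: "punctured_orthant \<in> sets borel"
  unfolding punctured_orthant_def by measurable

lemma space_orthant_space [simp]: "space orthant_space = nonneg_orthant"
  by (simp add: orthant_space_def space_restrict_space)

lemma measurable_component [measurable]: "(\<lambda>x :: real ^ 'd. x $ i) \<in> borel_measurable borel"
  by (intro borel_measurable_continuous_onI continuous_intros)

lemma quad_measurable [measurable]: "quad \<in> borel_measurable borel"
  unfolding quad_def by measurable

lemma quad_nonneg: "0 \<le> quad z"
  unfolding quad_def by (intro sum_nonneg) simp

lemma second_difference_exp: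
  "second_difference (\<lambda>\<xi>. exp (- (\<xi> \<bullet> z))) \<xi> = quad z * exp (- (\<xi> \<bullet> z))"
proof -
  have "exp (- (\<xi> \<bullet> z)) - 2 * exp (- ((\<xi> + axis i 1) \<bullet> z)) + exp (- ((\<xi> + axis i 2) \<bullet> z)) =
      (1 - exp (- (z $ i)))\<^sup>2 * exp (- (\<xi> \<bullet> z))" for i
  proof -
    have "(exp (- (z $ i)))\<^sup>2 = exp (- (2 * z $ i))"
      by (simp add: power2_eq_square flip: exp_add)
    moreover have "exp (- ((\<xi> + axis i a) \<bullet> z)) = exp (- (\<xi> \<bullet> z)) * exp (- (a * z $ i))" for a
      by (simp add: inner_add_left inner_axis' algebra_simps flip: exp_add)
    ultimately show ?thesis by (simp add: power2_eq_square algebra_simps)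
  qed
  then show ?thesis
    by (simp add: second_difference_def quad_def sum_distrib_right)
qed

lemma second_difference_add:
  "second_difference (\<lambda>\<xi>. F \<xi> + G \<xi>) \<xi> = second_difference F \<xi> + second_difference G \<xi>"
  by (simp add: second_difference_def sum.distrib[symmetric] algebra_simps)

lemma second_difference_diff:
  "second_difference (\<lambda>\<xi>. F \<xi> - G \<xi>) \<xi> = second_difference F \<xi> - second_difference G \<xi>"
  unfolding second_difference_def sum_subtractf[symmetric] by (intro sum.cong) auto

lemma second_difference_sum:
  "second_difference (\<lambda>\<xi>. \<Sum>j\<in>I. F j \<xi>) \<xi> = (\<Sum>j\<in>I. second_difference (F j) \<xi>)"
  by (induction I rule: infinite_finite_induct)
     (simp_all add: second_difference_add, simp_all add: second_difference_def)

lemma second_difference_cmult: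
  "second_difference (\<lambda>\<xi>. a * F \<xi>) \<xi> = a * second_difference F \<xi>"
  unfolding second_difference_def sum_distrib_left by (intro sum.cong) (auto simp: algebra_simps)

lemma second_difference_linear: "second_difference (\<lambda>\<xi>. b \<bullet> \<xi>) \<xi> = 0"
  by (simp add: second_difference_def inner_add_right inner_axis)

lemma second_difference_component: "second_difference (\<lambda>\<xi>. \<xi> $ j * m) \<xi> = 0"
  by (auto simp: second_difference_def axis_def algebra_simps intro!: sum.neutral)

lemma second_difference_const: "second_difference (\<lambda>\<xi>. b) \<xi> = 0"
  by (simp add: second_difference_def)

lemma second_difference_square: "second_difference (\<lambda>\<xi>. (\<xi> $ j)\<^sup>2) \<xi> = 2"
proof -
  have "second_difference (\<lambda>\<xi>. (\<xi> $ j)\<^sup>2) \<xi> = (\<Sum>i\<in>UNIV. if i = j then 2 else 0)"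
    unfolding second_difference_def
    by (intro sum.cong) (auto simp: axis_def power2_eq_square algebra_simps)
  then show ?thesis by simp
qed

lemma second_difference_integral:
  fixes \<xi> :: "real ^ 'd"
  assumes "\<And>\<xi>. \<xi> \<in> nonneg_orthant \<Longrightarrow> integrable M (F \<xi>)" "\<xi> \<in> nonneg_orthant"
  shows "second_difference (\<lambda>\<xi>. \<integral>z. F \<xi> z \<partial>M) \<xi> = (\<integral>z. second_difference (\<lambda>\<xi>. F \<xi> z) \<xi> \<partial>M)"
proof -
  have i: "integrable M (F \<xi>)" "integrable M (F (\<xi> + axis i 1))" "integrable M (F (\<xi> + axis i 2))"
    for i by (intro assms nonneg_orthant_add axis_nonneg_orthant; simp)+
  have "(\<integral>z. second_difference (\<lambda>\<xi>. F \<xi> z) \<xi> \<partial>M) =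
     (\<Sum>i\<in>UNIV. \<integral>z. F \<xi> z - 2 * F (\<xi> + axis i 1) z + F (\<xi> + axis i 2) z \<partial>M)"
    unfolding second_difference_def using i by (intro Bochner_Integration.integral_sum) auto
  also have "\<dots> = second_difference (\<lambda>\<xi>. \<integral>z. F \<xi> z \<partial>M) \<xi>"
    unfolding second_difference_def using i by (intro sum.cong refl) simp
  finally show ?thesis by simp
qed

lemma abs_exp_minus_diff_le:
  fixes a b :: real
  assumes "0 \<le> a" "0 \<le> b"
  shows "\<bar>exp (- a) - exp (- b)\<bar> \<le> \<bar>a - b\<bar>"
proof -
  have *: "exp (- a) - exp (- b) \<le> b - a" if "0 \<le> a" "a \<le> b" for a b :: real
  proof -
    have "exp (- a) - exp (- b) = exp (- a) * (1 - exp (- (b - a)))"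
      by (simp add: algebra_simps flip: exp_add)
    also have "\<dots> \<le> 1 * (b - a)"
      using exp_ge_add_one_self[of "-(b-a)"] that by (intro mult_mono) (auto simp del: minus_diff_eq)
    finally show ?thesis by simp
  qed
  show ?thesis
    using *[of a b] *[of b a] assms by (cases "a \<le> b") auto
qed

lemma abs_exp_minus_second_order:
  fixes p :: real
  assumes "0 \<le> p"
  shows "\<bar>exp (- p) - 1 + p\<bar> \<le> p\<^sup>2"
proof -
  have 1: "0 \<le> exp (- p) - 1 + p" using exp_ge_add_one_self[of "-p"] by simp
  have 2: "exp (- p) - 1 + p \<le> p\<^sup>2"
  proof (cases "p \<le> 1")
    case True
    have "1 - exp (-p) = exp (-p) * (exp p - 1)" by (simp add: algebra_simps flip: exp_add)
    also have "\<dots> \<ge> exp (-p) * p" using exp_ge_add_one_self[of p] by (intro mult_left_mono) (simp_all add: algebra_simps)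
    moreover have "exp (-p) * p \<ge> (1 - p) * p"
      using exp_ge_add_one_self[of "-p"] assms by (intro mult_right_mono) auto
    ultimately have "1 - exp (-p) \<ge> (1 - p) * p" by linarith
    then show ?thesis by (simp add: power2_eq_square algebra_simps)
  next
    case False
    then have "p \<le> p\<^sup>2" by (simp add: power2_eq_square)
    moreover have "exp (-p) \<le> 1" using assms by simp
    ultimately show ?thesis by linarith
  qed
  show ?thesis using 1 2 by simp
qed

lemma one_minus_exp_sum_le:
  fixes a :: "'i \<Rightarrow> real"
  assumes "\<And>i. i \<in> I \<Longrightarrow> 0 \<le> a i"
  shows "1 - exp (- (\<Sum>i\<in>I. a i)) \<le> (\<Sum>i\<in>I. min 1 (a i))"
  using assms
proof (induction I rule: infinite_finite_induct)
  case (insert x F)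
  have "1 - exp (- (a x)) \<le> min 1 (a x)"
    using exp_ge_add_one_self[of "- a x"] by (auto simp: min_def)
  moreover have "exp (- (a x)) * (1 - exp (- sum a F)) \<le> 1 - exp (- sum a F)"
    using insert by (intro mult_left_le_one_le) (auto intro!: sum_nonneg)
  moreover have "1 - exp (- sum a F) \<le> (\<Sum>i\<in>F. min 1 (a i))" using insert by auto
  moreover have "exp (- (a x + sum a F)) = exp (- (a x)) * exp (- sum a F)"
    by (simp flip: exp_add)
  ultimately have "1 - exp (- (a x + sum a F)) \<le> min 1 (a x) + (\<Sum>i\<in>F. min 1 (a i))"
    unfolding right_diff_distrib by linarith
  then show ?case using insert by simp
qed auto

lemma sq_one_minus_exp_le:
  fixes a :: real
  assumes "0 \<le> a"
  shows "(1 - exp (- a))\<^sup>2 \<le> min 1 a" "(1 - exp (- a))\<^sup>2 \<le> a\<^sup>2"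
proof -
  have 1: "0 \<le> 1 - exp (-a)" "1 - exp (-a) \<le> a" "1 - exp (-a) \<le> 1"
    using assms exp_ge_add_one_self[of "- a"] by auto
  then have "(1 - exp (-a))\<^sup>2 \<le> 1 - exp (-a)"
    by (simp add: power2_eq_square mult_left_le)
  then show "(1 - exp (- a))\<^sup>2 \<le> min 1 a" using 1 by linarith
  show "(1 - exp (- a))\<^sup>2 \<le> a\<^sup>2" using 1 by (intro power_mono)
qed

locale cbi_parameters =
  fixes c \<beta> :: "real ^ 'd" and B :: "real ^ 'd ^ 'd"
    and \<nu> :: "(real ^ 'd) measure" and \<mu> :: "'d \<Rightarrow> (real ^ 'd) measure"
  assumes adm: "admissible c \<beta> B \<nu> \<mu>"
    and tail: "(\<integral>\<^sup>+ r. ennreal (norm r) * indicator {r. 1 \<le> norm r} r \<partial>\<nu>) < \<infinity>"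
begin

abbreviation "\<phi> \<equiv> branching_mechanism c B \<mu>"
abbreviation "\<psi> \<equiv> immigration_mechanism \<beta> \<nu>"

lemma sets_\<nu> [measurable_cong]: "sets \<nu> = sets (restrict_space borel punctured_orthant)"
  and sets_\<mu> [measurable_cong]: "sets (\<mu> i) = sets (restrict_space borel punctured_orthant)"
  using adm by (auto simp: admissible_def punctured_space_def)

lemma space_\<nu> [simp]: "space \<nu> = punctured_orthant"
  and space_\<mu> [simp]: "space (\<mu> i) = punctured_orthant"
  using sets_eq_imp_space_eq[OF sets_\<nu>] sets_eq_imp_space_eq[OF sets_\<mu>, of i]
  by (auto simp: space_restrict_space)

lemma borel_measurable_levy:
  assumes "f \<in> borel_measurable borel"
  shows "f \<in> borel_measurable \<nu>" "f \<in> borel_measurable (\<mu> i)"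
  using measurable_restrict_space1[OF assms, of punctured_orthant]
  by (simp_all cong: measurable_cong_sets add: sets_\<nu> sets_\<mu>)

lemma c_nonneg: "0 \<le> c $ i"
  and B_nonneg: "i \<noteq> j \<Longrightarrow> 0 \<le> B $ i $ j"
  using adm by (auto simp: admissible_def nonneg_orthant_def)

lemma integrable_min_norm_\<nu>: "integrable \<nu> (\<lambda>r. min 1 (norm r))"
  using adm unfolding admissible_def
  by (intro integrableI_nonneg borel_measurable_levy) auto

text \<open>Near the origin the first moment is finite by admissibility, away from it by the moment assumption.
  It makes the immigration mechanism Lipschitz continuous.\<close>

lemma integrable_norm_\<nu>: "integrable \<nu> norm"
proof (rule integrableI_bounded)
  have "(\<integral>\<^sup>+ r. ennreal (norm r) \<partial>\<nu>) \<le>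
      (\<integral>\<^sup>+ r. ennreal (min 1 (norm r)) + ennreal (norm r) * indicator {r. 1 \<le> norm r} r \<partial>\<nu>)"
    by (intro nn_integral_mono) (auto simp: indicator_def min_def)
  also have "\<dots> = (\<integral>\<^sup>+ r. ennreal (min 1 (norm r)) \<partial>\<nu>) +
      (\<integral>\<^sup>+ r. ennreal (norm r) * indicator {r. 1 \<le> norm r} r \<partial>\<nu>)"
    by (intro nn_integral_add borel_measurable_levy) measurable
  also have "\<dots> < \<infinity>" using tail adm by (simp add: admissible_def)
  finally show "(\<integral>\<^sup>+ r. ennreal (norm (norm r)) \<partial>\<nu>) < \<infinity>" by simp
qed (intro borel_measurable_levy borel_measurable_norm measurable_ident)

definition branching_weight :: "'d \<Rightarrow> real ^ 'd \<Rightarrow> real" where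
  "branching_weight i z = min (norm z) ((norm z)\<^sup>2) + (\<Sum>j\<in>UNIV - {i}. min 1 (z $ j))"

lemma integrable_branching_weight: "integrable (\<mu> i) (branching_weight i)"
proof (rule integrableI_nonneg)
  show "AE z in \<mu> i. 0 \<le> branching_weight i z"
    by (intro AE_I2) (auto simp: branching_weight_def punctured_orthant_def nonneg_orthant_def
        intro!: add_nonneg_nonneg sum_nonneg)
  show "(\<integral>\<^sup>+ z. ennreal (branching_weight i z) \<partial>\<mu> i) < \<infinity>"
    using adm by (simp add: admissible_def branching_weight_def)
  show "branching_weight i \<in> borel_measurable (\<mu> i)"
    unfolding branching_weight_def by (intro borel_measurable_levy) measurable
qed

lemma integrable_immigration_integrand:
  assumes "\<xi> \<in> nonneg_orthant"
  shows "integrable \<nu> (\<lambda>r. 1 - exp (- (\<xi> \<bullet> r)))"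
proof (rule Bochner_Integration.integrable_bound)
  show "integrable \<nu> (\<lambda>r. norm \<xi> * norm r)" using integrable_norm_\<nu> by simp
  show "(\<lambda>r. 1 - exp (- (\<xi> \<bullet> r))) \<in> borel_measurable \<nu>" by (intro borel_measurable_levy) measurable
  show "AE r in \<nu>. norm (1 - exp (- (\<xi> \<bullet> r))) \<le> norm (norm \<xi> * norm r)"
  proof (intro AE_I2)
    fix r assume "r \<in> space \<nu>"
    then have "0 \<le> \<xi> \<bullet> r"
      using assms punctured_orthant_subset by (auto intro!: inner_nonneg_orthant)
    then have "\<bar>exp (- 0) - exp (- (\<xi> \<bullet> r))\<bar> \<le> \<xi> \<bullet> r" using abs_exp_minus_diff_le[of 0 "\<xi> \<bullet> r"] by simp
    also have "\<dots> \<le> norm \<xi> * norm r" by (rule norm_cauchy_schwarz)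
    finally show "norm (1 - exp (- (\<xi> \<bullet> r))) \<le> norm (norm \<xi> * norm r)" by simp
  qed
qed

lemma immigration_mechanism_lipschitz:
  assumes "\<xi> \<in> nonneg_orthant" "\<eta> \<in> nonneg_orthant"
  shows "\<bar>\<psi> \<xi> - \<psi> \<eta>\<bar> \<le> (norm \<beta> + (\<integral>r. norm r \<partial>\<nu>)) * norm (\<xi> - \<eta>)"
proof -
  have "\<psi> \<xi> - \<psi> \<eta> = \<beta> \<bullet> (\<xi> - \<eta>) + (\<integral>r. exp (- (\<eta> \<bullet> r)) - exp (- (\<xi> \<bullet> r)) \<partial>\<nu>)"
    using integrable_immigration_integrand[OF assms(1)] integrable_immigration_integrand[OF assms(2)]
    unfolding immigration_mechanism_def
    by (simp add: inner_diff_right Bochner_Integration.integral_diff[symmetric] del: Bochner_Integration.integral_diff)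
  moreover have "\<bar>\<beta> \<bullet> (\<xi> - \<eta>)\<bar> \<le> norm \<beta> * norm (\<xi> - \<eta>)" by (rule Cauchy_Schwarz_ineq2)
  moreover have "\<bar>\<integral>r. exp (- (\<eta> \<bullet> r)) - exp (- (\<xi> \<bullet> r)) \<partial>\<nu>\<bar> \<le> (\<integral>r. norm r * norm (\<xi> - \<eta>) \<partial>\<nu>)"
  proof -
    have "norm (exp (- (\<eta> \<bullet> r)) - exp (- (\<xi> \<bullet> r))) \<le> norm r * norm (\<xi> - \<eta>)"
      if "r \<in> space \<nu>" for r
    proof -
      have "r \<in> nonneg_orthant" using that punctured_orthant_subset by auto
      then have "\<bar>exp (- (\<eta> \<bullet> r)) - exp (- (\<xi> \<bullet> r))\<bar> \<le> \<bar>\<eta> \<bullet> r - \<xi> \<bullet> r\<bar>"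
        by (intro abs_exp_minus_diff_le inner_nonneg_orthant assms)
      also have "\<dots> = \<bar>(\<eta> - \<xi>) \<bullet> r\<bar>" by (simp add: inner_diff_left)
      also have "\<dots> \<le> norm (\<eta> - \<xi>) * norm r" by (rule Cauchy_Schwarz_ineq2)
      finally show ?thesis by (simp add: norm_minus_commute mult.commute)
    qed
    moreover have "integrable \<nu> (\<lambda>r. norm r * norm (\<xi> - \<eta>))" using integrable_norm_\<nu> by simp
    moreover have "integrable \<nu> (\<lambda>r. exp (- (\<eta> \<bullet> r)) - exp (- (\<xi> \<bullet> r)))"
      using Bochner_Integration.integrable_diff[OF integrable_immigration_integrand[OF assms(1)]
          integrable_immigration_integrand[OF assms(2)]] by simp
    ultimately have "norm (\<integral>r. exp (- (\<eta> \<bullet> r)) - exp (- (\<xi> \<bullet> r)) \<partial>\<nu>) \<le> (\<integral>r. norm r * norm (\<xi> - \<eta>) \<partial>\<nu>)"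
      by (intro order_trans[OF integral_norm_bound] integral_mono) auto
    then show ?thesis by simp
  qed
  ultimately show ?thesis by (simp add: algebra_simps)
qed

lemma continuous_on_immigration_mechanism: "continuous_on nonneg_orthant \<psi>"
proof -
  have "0 \<le> norm \<beta> + (\<integral>r. norm r \<partial>\<nu>)" by (intro add_nonneg_nonneg Bochner_Integration.integral_nonneg) auto
  then have "(norm \<beta> + (\<integral>r. norm r \<partial>\<nu>))-lipschitz_on nonneg_orthant \<psi>"
    by (intro lipschitz_onI) (auto simp: dist_norm intro!: immigration_mechanism_lipschitz)
  then show ?thesis by (rule lipschitz_on_continuous_on)
qed

text \<open>Coordinate \<open>i\<close> is compensated, so it contributes to second order near the origin; the other
  coordinates contribute to first order, which the weight allows for.\<close>

lemma branching_integrand_bound: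
  assumes "\<xi> \<in> nonneg_orthant" "z \<in> nonneg_orthant"
  shows "\<bar>exp (- (\<xi> \<bullet> z)) - 1 + \<xi> $ i * min 1 (z $ i)\<bar> \<le> (1 + mass \<xi>)\<^sup>2 * branching_weight i z"
proof -
  let ?q = "\<Sum>j\<in>UNIV - {i}. \<xi> $ j * z $ j"
  have z: "0 \<le> z $ j" "z $ j \<le> norm z" and x: "0 \<le> \<xi> $ j" "\<xi> $ j \<le> mass \<xi>" for j
    using assms component_le_mass[of \<xi> j] component_le_norm_cart[of z j]
    by (auto simp: nonneg_orthant_def)
  have m0: "0 \<le> mass \<xi>" by (rule mass_nonneg[OF assms(1)])
  have split: "\<xi> \<bullet> z = \<xi> $ i * z $ i + ?q"
    unfolding inner_vec_def by (simp add: sum.remove[of UNIV i])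
  have q0: "0 \<le> ?q" using z x by (intro sum_nonneg) auto
  have pos: "0 \<le> \<xi> $ i * z $ i" using z x by simp
  have A: "\<bar>exp (- (\<xi> \<bullet> z)) - exp (- (\<xi> $ i * z $ i))\<bar> \<le> (1 + mass \<xi>)\<^sup>2 * (\<Sum>j\<in>UNIV - {i}. min 1 (z $ j))"
  proof -
    have "\<bar>exp (- (\<xi> \<bullet> z)) - exp (- (\<xi> $ i * z $ i))\<bar> = exp (- (\<xi> $ i * z $ i)) * (1 - exp (- ?q))"
    proof -
      have "exp (- (\<xi> \<bullet> z)) = exp (- (\<xi> $ i * z $ i)) * exp (- ?q)"
        unfolding split by (simp flip: exp_add)
      moreover have "exp (- ?q) \<le> 1" using q0 by simp
      ultimately have "exp (- (\<xi> \<bullet> z)) - exp (- (\<xi> $ i * z $ i)) =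
          - (exp (- (\<xi> $ i * z $ i)) * (1 - exp (- ?q)))"
        and "0 \<le> exp (- (\<xi> $ i * z $ i)) * (1 - exp (- ?q))" by (simp_all add: algebra_simps)
      then show ?thesis by simp
    qed
    also have "\<dots> \<le> 1 * (1 - exp (- ?q))" using pos q0 by (intro mult_right_mono) auto
    also have "\<dots> \<le> (\<Sum>j\<in>UNIV - {i}. min 1 (\<xi> $ j * z $ j))"
      using one_minus_exp_sum_le[of "UNIV - {i}" "\<lambda>j. \<xi> $ j * z $ j"] z x by simp
    also have "\<dots> \<le> (\<Sum>j\<in>UNIV - {i}. (1 + mass \<xi>)\<^sup>2 * min 1 (z $ j))"
    proof (intro sum_mono)
      fix j
      have a: "\<xi> $ j \<le> (1 + mass \<xi>)\<^sup>2" "1 \<le> (1 + mass \<xi>)\<^sup>2"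
        using x[of j] m0 zero_le_square[of "mass \<xi>"] unfolding power2_eq_square distrib_left distrib_right
        by linarith+
      then have "\<xi> $ j * z $ j \<le> (1 + mass \<xi>)\<^sup>2 * z $ j" using z by (intro mult_right_mono) auto
      then show "min 1 (\<xi> $ j * z $ j) \<le> (1 + mass \<xi>)\<^sup>2 * min 1 (z $ j)"
        using a by (auto simp: min_def)
    qed
    finally show ?thesis by (simp add: sum_distrib_left)
  qed
  have C: "\<bar>exp (- (\<xi> $ i * z $ i)) - 1 + \<xi> $ i * min 1 (z $ i)\<bar> \<le> (1 + mass \<xi>)\<^sup>2 * min (norm z) ((norm z)\<^sup>2)"
  proof (cases "z $ i \<le> 1")
    case True
    have "\<bar>exp (- (\<xi> $ i * z $ i)) - 1 + \<xi> $ i * min 1 (z $ i)\<bar> \<le> (\<xi> $ i * z $ i)\<^sup>2"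
      using True abs_exp_minus_second_order[OF pos] by (simp add: min_def)
    also have "\<dots> = (\<xi> $ i)\<^sup>2 * (z $ i)\<^sup>2" by (simp add: power_mult_distrib)
    also have "\<dots> \<le> (1 + mass \<xi>)\<^sup>2 * min (norm z) ((norm z)\<^sup>2)"
    proof (rule mult_mono)
      show "(\<xi> $ i)\<^sup>2 \<le> (1 + mass \<xi>)\<^sup>2" using x[of i] by (intro power_mono) auto
      have "(z $ i)\<^sup>2 \<le> (norm z)\<^sup>2" using z by (intro power_mono) auto
      moreover have "(z $ i)\<^sup>2 \<le> norm z"
        using z[of i] True mult_left_le[of "z $ i" "z $ i"] by (simp add: power2_eq_square)
      ultimately show "(z $ i)\<^sup>2 \<le> min (norm z) ((norm z)\<^sup>2)" by simp
    qed auto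
    finally show ?thesis .
  next
    case False
    then have nz: "1 < norm z" using z[of i] by linarith
    have "exp (- (\<xi> $ i * z $ i)) \<le> 1" using pos by simp
    moreover have "0 < exp (- (\<xi> $ i * z $ i))" by simp
    moreover have "min 1 (z $ i) = 1" using False by simp
    ultimately have "\<bar>exp (- (\<xi> $ i * z $ i)) - 1 + \<xi> $ i * min 1 (z $ i)\<bar> \<le> 1 + \<xi> $ i"
      using x(1)[of i] by linarith
    also have "\<dots> \<le> (1 + mass \<xi>)\<^sup>2 * 1"
      using x[of i] m0 zero_le_square[of "mass \<xi>"]
      unfolding power2_eq_square distrib_left distrib_right by linarith
    also have "\<dots> \<le> (1 + mass \<xi>)\<^sup>2 * min (norm z) ((norm z)\<^sup>2)"
      using nz by (intro mult_left_mono) auto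
    finally show ?thesis .
  qed
  have "\<bar>exp (- (\<xi> \<bullet> z)) - 1 + \<xi> $ i * min 1 (z $ i)\<bar> \<le>
     \<bar>exp (- (\<xi> \<bullet> z)) - exp (- (\<xi> $ i * z $ i))\<bar> + \<bar>exp (- (\<xi> $ i * z $ i)) - 1 + \<xi> $ i * min 1 (z $ i)\<bar>"
    by linarith
  also have "\<dots> \<le> (1 + mass \<xi>)\<^sup>2 * branching_weight i z"
    using A C unfolding branching_weight_def distrib_left by linarith
  finally show ?thesis .
qed

lemma integrable_branching_integrand:
  assumes "\<xi> \<in> nonneg_orthant"
  shows "integrable (\<mu> i) (\<lambda>z. exp (- (\<xi> \<bullet> z)) - 1 + \<xi> $ i * min 1 (z $ i))"
proof (rule Bochner_Integration.integrable_bound)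
  show "integrable (\<mu> i) (\<lambda>z. (1 + mass \<xi>)\<^sup>2 * branching_weight i z)"
    using integrable_branching_weight by simp
  show "(\<lambda>z. exp (- (\<xi> \<bullet> z)) - 1 + \<xi> $ i * min 1 (z $ i)) \<in> borel_measurable (\<mu> i)"
    by (intro borel_measurable_levy) measurable
  show "AE z in \<mu> i. norm (exp (- (\<xi> \<bullet> z)) - 1 + \<xi> $ i * min 1 (z $ i))
      \<le> norm ((1 + mass \<xi>)\<^sup>2 * branching_weight i z)"
  proof (intro AE_I2)
    fix z assume "z \<in> space (\<mu> i)"
    then have "z \<in> nonneg_orthant" using punctured_orthant_subset by auto
    from branching_integrand_bound[OF assms this, of i]
    show "norm (exp (- (\<xi> \<bullet> z)) - 1 + \<xi> $ i * min 1 (z $ i))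
      \<le> norm ((1 + mass \<xi>)\<^sup>2 * branching_weight i z)" by simp
  qed
qed

lemma quad_le:
  assumes "z \<in> nonneg_orthant"
  shows "quad z \<le> real CARD('d) * min 1 (norm z)" "quad z \<le> real CARD('d) * branching_weight i z"
proof -
  have z: "0 \<le> z $ j" "z $ j \<le> norm z" for j
    using assms component_le_norm_cart[of z j] by (auto simp: nonneg_orthant_def)
  have 1: "(1 - exp (- (z $ j)))\<^sup>2 \<le> min 1 (norm z)" for j
    using sq_one_minus_exp_le[OF z(1)[of j]] z[of j] by (auto simp: min_def split: if_splits)
  have 2: "(1 - exp (- (z $ j)))\<^sup>2 \<le> branching_weight i z" for j
  proof -
    have "(1 - exp (- (z $ j)))\<^sup>2 \<le> (norm z)\<^sup>2"
      using sq_one_minus_exp_le(2)[OF z(1)[of j]] power_mono[OF z(2) z(1), of j 2] by linarith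
    moreover have "(1 - exp (- (z $ j)))\<^sup>2 \<le> norm z" using 1[of j] by auto
    moreover have "0 \<le> (\<Sum>j\<in>UNIV - {i}. min 1 (z $ j))" using z by (intro sum_nonneg) auto
    ultimately show ?thesis unfolding branching_weight_def by auto
  qed
  show "quad z \<le> real CARD('d) * min 1 (norm z)"
    unfolding quad_def using sum_bounded_above[of UNIV "\<lambda>j. (1 - exp (- (z $ j)))\<^sup>2", OF 1] by simp
  show "quad z \<le> real CARD('d) * branching_weight i z"
    unfolding quad_def using sum_bounded_above[of UNIV "\<lambda>j. (1 - exp (- (z $ j)))\<^sup>2", OF 2] by simp
qed

lemma integrable_quad:
  assumes [measurable]: "f \<in> borel_measurable borel"
    and bound: "\<And>z. z \<in> punctured_orthant \<Longrightarrow> \<bar>f z\<bar> \<le> C"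
  shows "integrable \<nu> (\<lambda>z. quad z * f z)" "integrable (\<mu> i) (\<lambda>z. quad z * f z)"
proof -
  have *: "norm (quad z * f z) \<le> norm (\<bar>C\<bar> * (real CARD('d) * min 1 (norm z)))"
    "norm (quad z * f z) \<le> norm (\<bar>C\<bar> * (real CARD('d) * branching_weight i z))"
    if "z \<in> punctured_orthant" for z
  proof -
    have z: "z \<in> nonneg_orthant" using that punctured_orthant_subset by auto
    have a: "\<bar>f z\<bar> \<le> \<bar>C\<bar>" using bound[OF that] by simp
    have "norm (quad z * f z) = \<bar>f z\<bar> * quad z" using quad_nonneg[of z] by (simp add: abs_mult)
    also have "\<bar>f z\<bar> * quad z \<le> \<bar>C\<bar> * (real CARD('d) * min 1 (norm z))"
      using a quad_le(1)[OF z] quad_nonneg by (intro mult_mono) auto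
    finally show "norm (quad z * f z) \<le> norm (\<bar>C\<bar> * (real CARD('d) * min 1 (norm z)))" by simp
    have "norm (quad z * f z) = \<bar>f z\<bar> * quad z" using quad_nonneg[of z] by (simp add: abs_mult)
    also have "\<bar>f z\<bar> * quad z \<le> \<bar>C\<bar> * (real CARD('d) * branching_weight i z)"
      using a quad_le(2)[OF z] quad_nonneg by (intro mult_mono) auto
    also have "\<dots> \<le> norm \<dots>" by simp
    finally show "norm (quad z * f z) \<le> norm (\<bar>C\<bar> * (real CARD('d) * branching_weight i z))" .
  qed
  show "integrable \<nu> (\<lambda>z. quad z * f z)"
    by (rule Bochner_Integration.integrable_bound[of _ "\<lambda>z. \<bar>C\<bar> * (real CARD('d) * min 1 (norm z))"])
       (use * integrable_min_norm_\<nu> in \<open>auto intro!: borel_measurable_levy\<close>)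
  show "integrable (\<mu> i) (\<lambda>z. quad z * f z)"
    by (rule Bochner_Integration.integrable_bound[of _ "\<lambda>z. \<bar>C\<bar> * (real CARD('d) * branching_weight i z)"])
       (use * integrable_branching_weight in \<open>auto intro!: borel_measurable_levy\<close>)
qed

lemma second_difference_immigration:
  assumes "\<xi> \<in> nonneg_orthant"
  shows "second_difference \<psi> \<xi> = - (\<integral>z. quad z * exp (- (\<xi> \<bullet> z)) \<partial>\<nu>)"
proof -
  have "second_difference \<psi> \<xi> = second_difference (\<lambda>\<xi>. \<integral>r. 1 - exp (- (\<xi> \<bullet> r)) \<partial>\<nu>) \<xi>"
    unfolding immigration_mechanism_def
    by (simp only: second_difference_add second_difference_linear add_0)
  also have "\<dots> = (\<integral>z. second_difference (\<lambda>\<xi>. 1 - exp (- (\<xi> \<bullet> z))) \<xi> \<partial>\<nu>)"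
    by (intro second_difference_integral integrable_immigration_integrand assms)
  finally show ?thesis
    by (simp add: second_difference_diff second_difference_const second_difference_exp)
qed

text \<open>The diffusion coefficient survives as well, since \<open>(\<xi> $ j)\<^sup>2\<close> has second difference 2 in
  direction \<open>j\<close>.\<close>

lemma second_difference_branching:
  assumes "\<xi> \<in> nonneg_orthant"
  shows "second_difference (\<lambda>\<xi>. \<phi> \<xi> $ j) \<xi> = 2 * c $ j + (\<integral>z. quad z * exp (- (\<xi> \<bullet> z)) \<partial>\<mu> j)"
proof -
  have "second_difference (\<lambda>\<xi>. \<phi> \<xi> $ j) \<xi> = 2 * c $ j +
      second_difference (\<lambda>\<xi>. \<integral>z. exp (- (\<xi> \<bullet> z)) - 1 + \<xi> $ j * min 1 (z $ j) \<partial>\<mu> j) \<xi>"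
    unfolding branching_mechanism_def vec_lambda_beta
    by (simp only: second_difference_add second_difference_diff second_difference_linear
        second_difference_cmult second_difference_square diff_0_right mult.commute)
  also have "second_difference (\<lambda>\<xi>. \<integral>z. exp (- (\<xi> \<bullet> z)) - 1 + \<xi> $ j * min 1 (z $ j) \<partial>\<mu> j) \<xi> =
      (\<integral>z. second_difference (\<lambda>\<xi>. exp (- (\<xi> \<bullet> z)) - 1 + \<xi> $ j * min 1 (z $ j)) \<xi> \<partial>\<mu> j)"
    by (intro second_difference_integral integrable_branching_integrand assms)
  finally show ?thesis
    by (simp only: second_difference_add second_difference_diff second_difference_const
        second_difference_exp second_difference_component) simp
qed

lemma immigration_axis_ge:
  assumes "0 \<le> l"
  shows "l * \<beta> $ i \<le> \<psi> (axis i l)"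
proof -
  have "0 \<le> (\<integral>r. 1 - exp (- (axis i l \<bullet> r)) \<partial>\<nu>)"
    using assms punctured_orthant_subset
    by (intro Bochner_Integration.integral_nonneg) (auto simp: inner_axis' nonneg_orthant_def)
  then show ?thesis by (simp add: immigration_mechanism_def inner_axis mult.commute)
qed

text \<open>Individuals of type \<open>j\<close> can create mass in coordinate \<open>i\<close> but cannot remove any: neither diffusion
  nor compensation of coordinate \<open>j\<close> is visible in direction \<open>i\<close>.\<close>

lemma branching_axis_nonpos:
  assumes "0 \<le> l" "j \<noteq> i"
  shows "\<phi> (axis i l) $ j \<le> 0"
proof -
  have "(B *v axis j 1) \<bullet> axis i l = l * B $ i $ j"
    by (simp add: inner_axis matrix_vector_mult_basis column_def)
  moreover have off: "axis i l $ j = 0" using assms(2) by (simp add: axis_def)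
  moreover have "0 \<le> (\<integral>z. - (exp (- (axis i l \<bullet> z)) - 1 + axis i l $ j * min 1 (z $ j)) \<partial>\<mu> j)"
    using assms(1) punctured_orthant_subset
    by (intro Bochner_Integration.integral_nonneg) (auto simp: off inner_axis' nonneg_orthant_def)
  then have "(\<integral>z. exp (- (axis i l \<bullet> z)) - 1 + axis i l $ j * min 1 (z $ j) \<partial>\<mu> j) \<le> 0"
    unfolding integral_minus by simp
  ultimately have "\<phi> (axis i l) $ j \<le> - (l * B $ i $ j)"
    unfolding branching_mechanism_def vec_lambda_beta off by simp
  moreover have "0 \<le> l * B $ i $ j" using assms B_nonneg[of i j] by simp
  ultimately show ?thesis by linarith
qed

end

section \<open>Small-time behaviour of the Laplace transform of an increment\<close>

lemma abs_exp_minus_one_le: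
  fixes x :: real
  shows "\<bar>exp x - 1\<bar> \<le> \<bar>x\<bar> * exp \<bar>x\<bar>"
proof (cases "0 \<le> x")
  case True
  have "exp x - 1 = exp x * (1 - exp (- x))" by (simp add: algebra_simps flip: exp_add)
  also have "\<dots> \<le> exp x * x" using exp_ge_add_one_self[of "- x"] by (intro mult_left_mono) auto
  finally show ?thesis using True by (simp add: mult.commute)
next
  case False
  then have "exp x \<le> 1" by simp
  then have "\<bar>exp x - 1\<bar> \<le> \<bar>x\<bar> * 1" using exp_ge_add_one_self[of x] False by linarith
  also have "\<dots> \<le> \<bar>x\<bar> * exp \<bar>x\<bar>" by (intro mult_left_mono) auto
  finally show ?thesis .
qed

lemma abs_exp_second_order:
  fixes w :: real
  assumes "\<bar>w\<bar> \<le> 1"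
  shows "\<bar>exp (- w) - 1 + w\<bar> \<le> w\<^sup>2"
proof (cases "0 \<le> w")
  case True
  then show ?thesis by (rule abs_exp_minus_second_order)
next
  case False
  then have "exp (- w) \<le> 1 + (- w) + (- w)\<^sup>2" using assms by (intro exp_bound) auto
  then show ?thesis using exp_ge_add_one_self[of "- w"] by simp
qed

definition orthant_ball :: "real \<Rightarrow> (real ^ 'd) set" where
  "orthant_ball K = {y \<in> nonneg_orthant. mass y \<le> K}"

locale cbi_kernel = cbi_parameters c \<beta> B \<nu> \<mu>
  for c \<beta> :: "real ^ 'd" and B :: "real ^ 'd ^ 'd"
    and \<nu> :: "(real ^ 'd) measure" and \<mu> :: "'d \<Rightarrow> (real ^ 'd) measure" +
  fixes v :: "real \<Rightarrow> real ^ 'd \<Rightarrow> real ^ 'd"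
    and Q :: "real \<Rightarrow> real ^ 'd \<Rightarrow> (real ^ 'd) measure"
  assumes cumulant: "cumulant_semigroup c B \<mu> v"
    and markov: "markov_semigroup orthant_space Q"
    and laplace: "\<And>t x \<xi>. 0 \<le> t \<Longrightarrow> x \<in> nonneg_orthant \<Longrightarrow> \<xi> \<in> nonneg_orthant \<Longrightarrow>
          (\<integral>y. exp (- (\<xi> \<bullet> y)) \<partial>Q t x) =
          exp (- (x \<bullet> v t \<xi>) - integral {0..t} (\<lambda>s. immigration_mechanism \<beta> \<nu> (v s \<xi>)))"
begin

lemma Q_measurable: "0 \<le> h \<Longrightarrow> Q h \<in> orthant_space \<rightarrow>\<^sub>M prob_algebra orthant_space"
  using markov by (simp add: markov_semigroup_def)

lemma
  assumes "0 \<le> h" "y \<in> nonneg_orthant"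
  shows prob_space_Q: "prob_space (Q h y)"
    and sets_Q: "sets (Q h y) = sets orthant_space"
    and space_Q: "space (Q h y) = nonneg_orthant"
proof -
  have "Q h y \<in> space (prob_algebra orthant_space)"
    using measurable_space[OF Q_measurable[OF assms(1)], of y] assms(2) by simp
  then show "prob_space (Q h y)" and s: "sets (Q h y) = sets orthant_space"
    by (auto simp: space_prob_algebra)
  show "space (Q h y) = nonneg_orthant" using sets_eq_imp_space_eq[OF s] by simp
qed

lemma borel_measurable_Q:
  assumes "0 \<le> h" "y \<in> nonneg_orthant" "f \<in> borel_measurable borel"
  shows "f \<in> borel_measurable (Q h y)"
  using measurable_restrict_space1[OF assms(3), of nonneg_orthant] sets_Q[OF assms(1,2)]
  by (simp cong: measurable_cong_sets add: orthant_space_def)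

lemma integrable_Q:
  fixes f :: "real ^ 'd \<Rightarrow> real"
  assumes "0 \<le> h" "y \<in> nonneg_orthant" "f \<in> borel_measurable borel"
    and "\<And>y'. y' \<in> nonneg_orthant \<Longrightarrow> \<bar>f y'\<bar> \<le> C"
  shows "integrable (Q h y) f"
proof -
  interpret prob_space "Q h y" by (rule prob_space_Q[OF assms(1,2)])
  show ?thesis
    by (rule integrable_const_bound[of _ C])
       (use assms space_Q[OF assms(1,2)] borel_measurable_Q in auto)
qed

lemma v_zero: "\<xi> \<in> nonneg_orthant \<Longrightarrow> v 0 \<xi> = \<xi>"
  and v_nonneg: "\<xi> \<in> nonneg_orthant \<Longrightarrow> 0 \<le> t \<Longrightarrow> v t \<xi> \<in> nonneg_orthant"
  and v_deriv: "\<xi> \<in> nonneg_orthant \<Longrightarrow> 0 \<le> t \<Longrightarrow>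
    ((\<lambda>s. v s \<xi>) has_vector_derivative - \<phi> (v t \<xi>)) (at t within {0..})"
  using cumulant unfolding cumulant_semigroup_def by auto

lemma continuous_on_v: "\<xi> \<in> nonneg_orthant \<Longrightarrow> continuous_on {0..} (\<lambda>s. v s \<xi>)"
  unfolding continuous_on_eq_continuous_within
  by (auto intro: has_vector_derivative_continuous v_deriv)

definition immigration_integral :: "real ^ 'd \<Rightarrow> real \<Rightarrow> real" where
  "immigration_integral \<xi> h = integral {0..h} (\<lambda>s. \<psi> (v s \<xi>))"

lemma v_increment_limit:
  assumes "\<xi> \<in> nonneg_orthant"
  shows "((\<lambda>h. (v h \<xi> $ i - \<xi> $ i) / h) \<longlongrightarrow> - (\<phi> \<xi> $ i)) (at_right 0)"
proof -
  have "((\<lambda>s. v s \<xi> $ i) has_vector_derivative - (\<phi> (v 0 \<xi>)) $ i) (at 0 within {0..})"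
    using bounded_linear.has_vector_derivative[OF bounded_linear_vec_nth v_deriv[OF assms order_refl], of i]
    by simp
  then have "((\<lambda>s. v s \<xi> $ i) has_real_derivative - (\<phi> \<xi> $ i)) (at 0 within {0..})"
    using v_zero[OF assms] by (simp add: has_real_derivative_iff_has_vector_derivative)
  then have "((\<lambda>h. (v h \<xi> $ i - \<xi> $ i) / h) \<longlongrightarrow> - (\<phi> \<xi> $ i)) (at 0 within {0..})"
    using v_zero[OF assms] by (simp add: has_field_derivative_iff)
  then show ?thesis by (rule tendsto_within_subset) auto
qed

lemma immigration_integral_limit:
  assumes "\<xi> \<in> nonneg_orthant"
  shows "((\<lambda>h. immigration_integral \<xi> h / h) \<longlongrightarrow> \<psi> \<xi>) (at_right 0)"
proof -
  have "continuous_on {0..1} (\<lambda>s. \<psi> (v s \<xi>))"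
    by (rule continuous_on_compose2[OF continuous_on_immigration_mechanism
          continuous_on_subset[OF continuous_on_v[OF assms]]])
       (use v_nonneg[OF assms] in auto)
  then have "((\<lambda>u. integral {0..u} (\<lambda>s. \<psi> (v s \<xi>))) has_vector_derivative \<psi> (v 0 \<xi>)) (at 0 within {0..1})"
    by (intro integral_has_vector_derivative) auto
  then have "((\<lambda>h. immigration_integral \<xi> h / h) \<longlongrightarrow> \<psi> \<xi>) (at 0 within {0..1})"
    using v_zero[OF assms]
    by (simp add: has_real_derivative_iff_has_vector_derivative[symmetric] has_field_derivative_iff
        immigration_integral_def)
  then show ?thesis by (simp add: at_within_Icc_at_right)
qed

definition laplace_increment :: "real \<Rightarrow> real ^ 'd \<Rightarrow> real ^ 'd \<Rightarrow> real" where
  "laplace_increment h \<xi> y = (\<integral>y'. exp (- (\<xi> \<bullet> (y' - y))) \<partial>Q h y)"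

text \<open>By the affine form of the transition semigroup the Laplace transform of an increment is
  \<open>exp (- (h * laplace_rate h \<xi> y))\<close>, and this rate is affine in \<open>y\<close>.  Hence estimates that are uniform
  in \<open>y\<close> reduce to the behaviour of finitely many functions of \<open>h\<close>.\<close>

definition laplace_rate :: "real \<Rightarrow> real ^ 'd \<Rightarrow> real ^ 'd \<Rightarrow> real" where
  "laplace_rate h \<xi> y = (\<Sum>i\<in>UNIV. y $ i * ((v h \<xi> $ i - \<xi> $ i) / h)) + immigration_integral \<xi> h / h"

lemma laplace_increment_eq:
  assumes "0 < h" "y \<in> nonneg_orthant" "\<xi> \<in> nonneg_orthant"
  shows "laplace_increment h \<xi> y = exp (- (h * laplace_rate h \<xi> y))"
proof -
  have "laplace_increment h \<xi> y = (\<integral>y'. exp (\<xi> \<bullet> y) * exp (- (\<xi> \<bullet> y')) \<partial>Q h y)"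
    unfolding laplace_increment_def
    by (intro Bochner_Integration.integral_cong refl) (simp add: inner_diff_right flip: exp_add)
  also have "\<dots> = exp (\<xi> \<bullet> y) * exp (- (y \<bullet> v h \<xi>) - immigration_integral \<xi> h)"
    using laplace[of h y \<xi>] assms by (simp add: immigration_integral_def)
  also have "\<dots> = exp (\<xi> \<bullet> y + (- (y \<bullet> v h \<xi>) - immigration_integral \<xi> h))"
    by (simp only: exp_add)
  also have "\<xi> \<bullet> y + (- (y \<bullet> v h \<xi>) - immigration_integral \<xi> h) = - (h * laplace_rate h \<xi> y)"
  proof -
    have "h * (\<Sum>i\<in>UNIV. y $ i * ((v h \<xi> $ i - \<xi> $ i) / h)) = (\<Sum>i\<in>UNIV. y $ i * v h \<xi> $ i - \<xi> $ i * y $ i)"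
      unfolding sum_distrib_left using assms(1) by (intro sum.cong) (auto simp: field_simps)
    then show ?thesis using assms(1)
      unfolding laplace_rate_def inner_vec_def by (simp add: distrib_left sum_subtractf)
  qed
  finally show ?thesis .
qed

lemma abs_weighted_sum_le:
  assumes "y \<in> nonneg_orthant"
  shows "\<bar>\<Sum>i\<in>UNIV. y $ i * a i\<bar> \<le> mass y * (\<Sum>i\<in>UNIV. \<bar>a i\<bar>)"
proof -
  have "\<bar>\<Sum>i\<in>UNIV. y $ i * a i\<bar> \<le> (\<Sum>i\<in>UNIV. \<bar>y $ i * a i\<bar>)" by (rule sum_abs)
  also have "\<dots> \<le> (\<Sum>i\<in>UNIV. mass y * \<bar>a i\<bar>)"
    using component_le_mass[OF assms] nonneg_orthantD[OF assms]
    by (intro sum_mono) (auto simp: abs_mult intro!: mult_right_mono)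
  finally show ?thesis by (simp add: sum_distrib_left)
qed

text \<open>The linear growth in the mass is what later makes a stage of length \<open>1 / (j + 1)\<close> affordable from
  mass of order \<open>j\<close>.\<close>

lemma laplace_increment_bound:
  assumes "\<xi> \<in> nonneg_orthant"
  shows "\<exists>C>0. \<forall>\<^sub>F h in at_right 0. \<forall>y\<in>nonneg_orthant. h * (1 + mass y) \<le> 1 \<longrightarrow>
      \<bar>laplace_increment h \<xi> y - 1\<bar> \<le> C * (1 + mass y) * h"
proof -
  define a where "a h = (\<Sum>i\<in>UNIV. \<bar>(v h \<xi> $ i - \<xi> $ i) / h\<bar>) + \<bar>immigration_integral \<xi> h / h\<bar>" for h
  define A where "A = (\<Sum>i\<in>UNIV. \<bar>- \<phi> \<xi> $ i\<bar>) + \<bar>\<psi> \<xi>\<bar> + 1"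
  have A: "1 \<le> A" unfolding A_def by (simp add: add_nonneg_nonneg sum_nonneg)
  have "(a \<longlongrightarrow> (\<Sum>i\<in>UNIV. \<bar>- \<phi> \<xi> $ i\<bar>) + \<bar>\<psi> \<xi>\<bar>) (at_right 0)"
    unfolding a_def using v_increment_limit[OF assms] immigration_integral_limit[OF assms]
    by (intro tendsto_add tendsto_sum tendsto_rabs) auto
  then have "\<forall>\<^sub>F h in at_right 0. a h < A" by (rule order_tendstoD) (simp add: A_def)
  moreover have "\<forall>\<^sub>F h in at_right 0. (0::real) < h" by (simp add: eventually_at_right_less)
  ultimately have "\<forall>\<^sub>F h in at_right 0. \<forall>y\<in>nonneg_orthant. h * (1 + mass y) \<le> 1 \<longrightarrow>
      \<bar>laplace_increment h \<xi> y - 1\<bar> \<le> (A * exp A) * (1 + mass y) * h"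
  proof eventually_elim
    case (elim h)
    show ?case
    proof (intro ballI impI)
      fix y :: "real ^ 'd" assume y: "y \<in> nonneg_orthant" and hy: "h * (1 + mass y) \<le> 1"
      note m = mass_nonneg[OF y]
      have ai: "(\<Sum>i\<in>UNIV. \<bar>(v h \<xi> $ i - \<xi> $ i) / h\<bar>) \<le> a h" "\<bar>immigration_integral \<xi> h / h\<bar> \<le> a h"
        "0 \<le> a h" unfolding a_def by (auto intro!: sum_nonneg add_nonneg_nonneg)
      have "\<bar>laplace_rate h \<xi> y\<bar> \<le> mass y * (\<Sum>i\<in>UNIV. \<bar>(v h \<xi> $ i - \<xi> $ i) / h\<bar>)
          + \<bar>immigration_integral \<xi> h / h\<bar>"
        unfolding laplace_rate_def
        using abs_weighted_sum_le[OF y, of "\<lambda>i. (v h \<xi> $ i - \<xi> $ i) / h"] by linarith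
      also have "\<dots> \<le> mass y * a h + a h" using ai m by (intro add_mono mult_left_mono) auto
      also have "\<dots> \<le> mass y * A + A" using elim(1) m by (intro add_mono mult_left_mono) auto
      finally have r: "\<bar>laplace_rate h \<xi> y\<bar> \<le> A * (1 + mass y)" by (simp add: algebra_simps)
      have w: "\<bar>h * laplace_rate h \<xi> y\<bar> \<le> A * (1 + mass y) * h"
        using mult_left_mono[OF r, of h] elim(2) by (simp add: abs_mult algebra_simps)
      also have "\<dots> \<le> A * 1" using mult_left_mono[OF hy, of A] A by (simp add: algebra_simps)
      finally have w1: "\<bar>h * laplace_rate h \<xi> y\<bar> \<le> A" by simp
      have "\<bar>laplace_increment h \<xi> y - 1\<bar> \<le> \<bar>h * laplace_rate h \<xi> y\<bar> * exp \<bar>h * laplace_rate h \<xi> y\<bar>"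
        unfolding laplace_increment_eq[OF elim(2) y assms]
        using abs_exp_minus_one_le[of "- (h * laplace_rate h \<xi> y)"] by simp
      also have "\<dots> \<le> (A * (1 + mass y) * h) * exp A" using w w1 by (intro mult_mono) auto
      finally show "\<bar>laplace_increment h \<xi> y - 1\<bar> \<le> (A * exp A) * (1 + mass y) * h"
        by (simp add: algebra_simps)
    qed
  qed
  then show ?thesis using A by (intro exI[of _ "A * exp A"]) auto
qed

lemma laplace_increment_limit:
  assumes "\<xi> \<in> nonneg_orthant" "0 \<le> K"
  shows "uniform_limit (orthant_ball K) (\<lambda>h y. (laplace_increment h \<xi> y - 1) / h)
      (\<lambda>y. (\<Sum>i\<in>UNIV. y $ i * \<phi> \<xi> $ i) - \<psi> \<xi>) (at_right 0)"
proof -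
  define d where "d h = K * (\<Sum>i\<in>UNIV. \<bar>(v h \<xi> $ i - \<xi> $ i) / h + \<phi> \<xi> $ i\<bar>)
      + \<bar>immigration_integral \<xi> h / h - \<psi> \<xi>\<bar>" for h
  define b where "b h = K * (\<Sum>i\<in>UNIV. \<bar>(v h \<xi> $ i - \<xi> $ i) / h\<bar>) + \<bar>immigration_integral \<xi> h / h\<bar>" for h
  have "(d \<longlongrightarrow> K * (\<Sum>i\<in>(UNIV :: 'd set). \<bar>- \<phi> \<xi> $ i + \<phi> \<xi> $ i\<bar>) + \<bar>\<psi> \<xi> - \<psi> \<xi>\<bar>) (at_right 0)"
    unfolding d_def using v_increment_limit[OF assms(1)] immigration_integral_limit[OF assms(1)]
    by (intro tendsto_intros) auto
  then have d: "(d \<longlongrightarrow> 0) (at_right 0)" by simp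
  have b: "(b \<longlongrightarrow> K * (\<Sum>i\<in>(UNIV :: 'd set). \<bar>- \<phi> \<xi> $ i\<bar>) + \<bar>\<psi> \<xi>\<bar>) (at_right 0)"
    unfolding b_def using v_increment_limit[OF assms(1)] immigration_integral_limit[OF assms(1)]
    by (intro tendsto_intros) auto
  have h0: "((\<lambda>h. h) \<longlongrightarrow> (0 :: real)) (at_right 0)" by (rule tendsto_ident_at)
  have bh: "((\<lambda>h. b h * h) \<longlongrightarrow> 0) (at_right 0)"
    using tendsto_mult[OF b h0] by simp
  have tot: "((\<lambda>h. d h + b h * (b h * h)) \<longlongrightarrow> 0) (at_right 0)"
    using tendsto_add[OF d tendsto_mult[OF b bh]] by simp
  show ?thesis
  proof (rule uniform_limitI)
    fix e :: real assume e: "0 < e"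
    have "\<forall>\<^sub>F h in at_right 0. (0::real) < h" by (simp add: eventually_at_right_less)
    moreover have "\<forall>\<^sub>F h in at_right 0. b h * h < 1" by (rule order_tendstoD(2)[OF bh]) simp
    moreover have "\<forall>\<^sub>F h in at_right 0. d h + b h * (b h * h) < e"
      by (rule order_tendstoD(2)[OF tot e])
    ultimately show "\<forall>\<^sub>F h in at_right 0. \<forall>y\<in>orthant_ball K. dist ((laplace_increment h \<xi> y - 1) / h)
        ((\<Sum>i\<in>UNIV. y $ i * \<phi> \<xi> $ i) - \<psi> \<xi>) < e"
    proof eventually_elim
      case (elim h)
      show ?case
      proof
        fix y :: "real ^ 'd" assume "y \<in> orthant_ball K"
        then have y: "y \<in> nonneg_orthant" and yK: "mass y \<le> K" by (auto simp: orthant_ball_def)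
        let ?r = "laplace_rate h \<xi> y" and ?L = "(\<Sum>i\<in>UNIV. y $ i * \<phi> \<xi> $ i) - \<psi> \<xi>"
        have rL: "?r + ?L = (\<Sum>i\<in>UNIV. y $ i * ((v h \<xi> $ i - \<xi> $ i) / h + \<phi> \<xi> $ i))
            + (immigration_integral \<xi> h / h - \<psi> \<xi>)"
          unfolding laplace_rate_def by (simp add: distrib_left sum.distrib)
        have "\<bar>?r + ?L\<bar> \<le> mass y * (\<Sum>i\<in>UNIV. \<bar>(v h \<xi> $ i - \<xi> $ i) / h + \<phi> \<xi> $ i\<bar>)
            + \<bar>immigration_integral \<xi> h / h - \<psi> \<xi>\<bar>"
          unfolding rL
          using abs_weighted_sum_le[OF y, of "\<lambda>i. (v h \<xi> $ i - \<xi> $ i) / h + \<phi> \<xi> $ i"] by linarith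
        also have "\<dots> \<le> d h" unfolding d_def
          using yK by (intro add_mono mult_right_mono order_refl) (auto intro!: sum_nonneg)
        finally have 1: "\<bar>?r + ?L\<bar> \<le> d h" .
        have "\<bar>?r\<bar> \<le> mass y * (\<Sum>i\<in>UNIV. \<bar>(v h \<xi> $ i - \<xi> $ i) / h\<bar>)
            + \<bar>immigration_integral \<xi> h / h\<bar>"
          unfolding laplace_rate_def
          using abs_weighted_sum_le[OF y, of "\<lambda>i. (v h \<xi> $ i - \<xi> $ i) / h"] by linarith
        also have "\<dots> \<le> b h" unfolding b_def
          using yK by (intro add_mono mult_right_mono order_refl) (auto intro!: sum_nonneg)
        finally have 2: "\<bar>?r\<bar> \<le> b h" .
        have "\<bar>h * ?r\<bar> \<le> b h * h" using mult_left_mono[OF 2, of h] elim(1) by (simp add: abs_mult mult.commute)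
        then have "\<bar>h * ?r\<bar> \<le> 1" using elim(2) by linarith
        then have "\<bar>exp (- (h * ?r)) - 1 + h * ?r\<bar> \<le> (h * ?r)\<^sup>2" by (rule abs_exp_second_order)
        then have "\<bar>exp (- (h * ?r)) - 1 + h * ?r\<bar> / h \<le> (h * ?r)\<^sup>2 / h"
          using elim(1) by (intro divide_right_mono) auto
        moreover have "(h * ?r)\<^sup>2 / h = h * ?r\<^sup>2" using elim(1) by (simp add: power2_eq_square)
        moreover have "\<bar>exp (- (h * ?r)) - 1 + h * ?r\<bar> / h = \<bar>(exp (- (h * ?r)) - 1) / h + ?r\<bar>"
          using elim(1) by (simp add: abs_div_pos add_divide_distrib)
        ultimately have "\<bar>(exp (- (h * ?r)) - 1) / h + ?r\<bar> \<le> h * ?r\<^sup>2" by linarith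
        also have "?r\<^sup>2 \<le> (b h)\<^sup>2" using 2 by (metis abs_ge_zero power2_abs power_mono)
        then have "h * ?r\<^sup>2 \<le> b h * (b h * h)"
          using mult_left_mono[of "?r\<^sup>2" "(b h)\<^sup>2" h] elim(1)
          by (simp add: power2_eq_square mult.assoc mult.commute mult.left_commute)
        finally have 3: "\<bar>(exp (- (h * ?r)) - 1) / h + ?r\<bar> \<le> b h * (b h * h)" .
        have "\<bar>(exp (- (h * ?r)) - 1) / h - ?L\<bar> < e" using 1 3 elim(3) by linarith
        then show "dist ((laplace_increment h \<xi> y - 1) / h) ?L < e"
          unfolding laplace_increment_eq[OF elim(1) y assms(1)] dist_real_def .
      qed
    qed
  qed
qed

end

section \<open>Small-time law of an increment away from zero\<close>

text \<open>These coordinates compactify the increments: those from a bounded set stay in a compact box even if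
  the target is arbitrarily far away.  The zero increment corresponds to the point \<open>1\<close>.\<close>

definition exp_chart :: "real ^ 'd \<Rightarrow> real ^ 'd" where
  "exp_chart z = (\<chi> i. exp (- (z $ i)))"

lemma exp_chart_measurable [measurable]: "exp_chart \<in> borel_measurable borel"
  unfolding exp_chart_def by (intro borel_measurable_continuous_onI continuous_intros)

text \<open>Polynomials in the coordinates, generated by monomials, since monomials in the chart are the
  exponentials to which the Laplace transform gives access.\<close>

inductive vec_poly :: "(real ^ 'd \<Rightarrow> real) \<Rightarrow> bool" where
  monomial: "vec_poly (\<lambda>u. \<Prod>i\<in>UNIV. u $ i ^ n i)"
| add: "vec_poly p \<Longrightarrow> vec_poly q \<Longrightarrow> vec_poly (\<lambda>u. p u + q u)"
| scale: "vec_poly p \<Longrightarrow> vec_poly (\<lambda>u. a * p u)"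

lemma vec_poly_mult:
  assumes "vec_poly p" "vec_poly q"
  shows "vec_poly (\<lambda>u. p u * q u)"
  using assms(1)
proof (induction rule: vec_poly.induct)
  case (monomial n)
  show ?case using assms(2)
  proof (induction rule: vec_poly.induct)
    case (monomial m)
    show ?case
      unfolding prod.distrib[symmetric] power_add[symmetric] by (rule vec_poly.monomial)
  next
    case (add p q)
    show ?case unfolding distrib_left by (rule vec_poly.add[OF add.IH])
  next
    case (scale p a)
    have "(\<lambda>u. (\<Prod>i\<in>UNIV. u $ i ^ n i) * (a * p u)) = (\<lambda>u. a * ((\<Prod>i\<in>UNIV. u $ i ^ n i) * p u))"
      by (rule ext) (rule mult.left_commute)
    then show ?case by (rule ssubst) (rule vec_poly.scale[OF scale.IH])
  qed
next
  case (add p q)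
  show ?case unfolding distrib_right by (rule vec_poly.add[OF add.IH])
next
  case (scale p a)
  show ?case unfolding mult.assoc by (rule vec_poly.scale[OF scale.IH])
qed

lemma continuous_on_vec_poly: "vec_poly p \<Longrightarrow> continuous_on A p"
  by (induction rule: vec_poly.induct) (auto intro!: continuous_intros)

lemma vec_poly_approximation:
  fixes g :: "real ^ 'd \<Rightarrow> real"
  assumes "compact A" "continuous_on A g" "0 < e"
  obtains p where "vec_poly p" "\<And>u. u \<in> A \<Longrightarrow> \<bar>g u - p u\<bar> < e"
proof -
  interpret function_ring_on "Collect vec_poly" A
  proof
    fix a :: real
    have "vec_poly (\<lambda>u :: real ^ 'd. a * (\<Prod>i\<in>UNIV. u $ i ^ 0))"
      by (rule vec_poly.scale[OF vec_poly.monomial])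
    then show "(\<lambda>_ :: real ^ 'd. a) \<in> Collect vec_poly" by simp
  next
    fix x y :: "real ^ 'd" assume "x \<noteq> y"
    then obtain i where i: "x $ i \<noteq> y $ i" by (auto simp: vec_eq_iff)
    have "vec_poly (\<lambda>u :: real ^ 'd. \<Prod>j\<in>UNIV. u $ j ^ (if j = i then 1 else 0))"
      by (rule vec_poly.monomial)
    moreover have "(\<Prod>j\<in>UNIV. u $ j ^ (if j = i then 1 else 0)) = u $ i" for u :: "real ^ 'd"
    proof -
      have "(\<Prod>j\<in>UNIV. u $ j ^ (if j = i then 1 else 0)) = (\<Prod>j\<in>UNIV. if j = i then u $ j else 1)"
        by (rule prod.cong) auto
      then show ?thesis by simp
    qed
    ultimately have "(\<lambda>u :: real ^ 'd. u $ i) \<in> Collect vec_poly"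
      unfolding mem_Collect_eq by (simp only:)
    from bexI[of "\<lambda>f. f x \<noteq> f y", OF i this]
    show "\<exists>f\<in>Collect vec_poly. f x \<noteq> f y" .
  next
    fix p q :: "real ^ 'd \<Rightarrow> real" assume "p \<in> Collect vec_poly" "q \<in> Collect vec_poly"
    then have pq: "vec_poly p" "vec_poly q" by auto
    show "(\<lambda>x. p x + q x) \<in> Collect vec_poly" unfolding mem_Collect_eq by (rule vec_poly.add[OF pq])
    show "(\<lambda>x. p x * q x) \<in> Collect vec_poly" unfolding mem_Collect_eq by (rule vec_poly_mult[OF pq])
  next
    fix p :: "real ^ 'd \<Rightarrow> real" assume "p \<in> Collect vec_poly"
    then show "continuous_on A p" by (intro continuous_on_vec_poly) simp
  qed (rule assms)
  obtain p where "p \<in> Collect vec_poly" "\<forall>u\<in>A. \<bar>g u - p u\<bar> < e"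
    using Stone_Weierstrass_basic[OF assms(2,3)] by (elim bexE)
  then show ?thesis using that by blast
qed

text \<open>The chart maps increments from a point of mass at most \<open>K\<close> into this box, uniformly in the
  target.\<close>

definition chart_box :: "real \<Rightarrow> (real ^ 'd) set" where
  "chart_box K = cbox 0 (\<chi> i. exp K)"

lemma compact_chart_box: "compact (chart_box K)"
  by (simp add: chart_box_def compact_cbox)

lemma exp_chart_in_chart_box:
  assumes "y \<in> orthant_ball K" "y' \<in> nonneg_orthant"
  shows "exp_chart (y' - y) \<in> chart_box K"
proof -
  have "y $ i - y' $ i \<le> K" for i
  proof -
    have "y $ i \<le> K" "0 \<le> y' $ i"
      using assms component_le_mass[of y i] by (auto simp: orthant_ball_def nonneg_orthant_def)
    then show ?thesis by linarith
  qed
  then show ?thesis by (simp add: exp_chart_def chart_box_def mem_box_cart)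
qed

lemma zero_orthant_ball: "0 \<le> K \<Longrightarrow> 0 \<in> orthant_ball K"
  by (simp add: orthant_ball_def nonneg_orthant_def mass_def)

lemma exp_chart_orthant_in_chart_box:
  assumes "0 \<le> K" "z \<in> nonneg_orthant"
  shows "exp_chart z \<in> chart_box K"
  using exp_chart_in_chart_box[OF zero_orthant_ball[OF assms(1)] assms(2)] by simp

lemma one_in_chart_box: "0 \<le> K \<Longrightarrow> 1 \<in> chart_box K"
  by (simp add: chart_box_def mem_box_cart)

lemma quad_eq_exp_chart: "quad z = (\<Sum>i\<in>UNIV. (1 - exp_chart z $ i)\<^sup>2)"
  by (simp add: quad_def exp_chart_def)

lemma quad_le_of_chart_box:
  assumes "exp_chart z \<in> chart_box K"
  shows "quad (z :: real ^ 'd) \<le> real CARD('d) * (1 + exp K)\<^sup>2"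
proof -
  have "(1 - exp_chart z $ i)\<^sup>2 \<le> (1 + exp K)\<^sup>2" for i
  proof -
    have "0 \<le> exp_chart z $ i" "exp_chart z $ i \<le> exp K"
      using assms by (auto simp: chart_box_def mem_box_cart)
    then show ?thesis
      using exp_gt_zero[of K] by (intro abs_le_square_iff[THEN iffD1]) linarith
  qed
  then show ?thesis
    unfolding quad_eq_exp_chart using sum_bounded_above[of UNIV "\<lambda>i. (1 - exp_chart z $ i)\<^sup>2"] by simp
qed

lemma continuous_bounded_on_chart_box:
  fixes g :: "real ^ 'd \<Rightarrow> real"
  assumes "continuous_on UNIV g"
  obtains C where "0 \<le> C" "\<And>u. u \<in> chart_box K \<Longrightarrow> \<bar>g u\<bar> \<le> C"
proof -
  have "compact (g ` chart_box K)"
    by (intro compact_continuous_image continuous_on_subset[OF assms] compact_chart_box) auto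
  then have "bounded (g ` chart_box K)" by (rule compact_imp_bounded)
  then obtain C where "\<And>u. u \<in> chart_box K \<Longrightarrow> \<bar>g u\<bar> \<le> C" unfolding bounded_iff by auto
  then show ?thesis by (intro that[of "\<bar>C\<bar>"]) force+
qed

lemma uniform_limit_sum:
  fixes f :: "'i \<Rightarrow> 'a \<Rightarrow> 'b \<Rightarrow> real"
  assumes "\<And>i. i \<in> I \<Longrightarrow> uniform_limit A (f i) (l i) F"
  shows "uniform_limit A (\<lambda>n x. \<Sum>i\<in>I. f i n x) (\<lambda>x. \<Sum>i\<in>I. l i x) F"
  using assms by (induction I rule: infinite_finite_induct) (auto intro!: uniform_limit_intros)

lemma uniform_limit_cmult:
  fixes f :: "'a \<Rightarrow> 'b \<Rightarrow> real"
  assumes "uniform_limit A f l F"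
  shows "uniform_limit A (\<lambda>n x. a * f n x) (\<lambda>x. a * l x) F"
  using bounded_linear.uniform_limit[OF bounded_linear_mult_right assms] by simp

context cbi_kernel
begin

text \<open>The limit of \<open>increment_form\<close>: the jump intensity at \<open>y\<close>, weighted by \<open>quad\<close>, and a point mass at the
  zero increment that stems from the diffusion.\<close>

definition levy_form :: "real ^ 'd \<Rightarrow> (real ^ 'd \<Rightarrow> real) \<Rightarrow> real" where
  "levy_form y g = (\<integral>z. quad z * g (exp_chart z) \<partial>\<nu>)
     + (\<Sum>j\<in>UNIV. y $ j * (\<integral>z. quad z * g (exp_chart z) \<partial>\<mu> j)) + 2 * (\<Sum>j\<in>UNIV. y $ j * c $ j) * g 1"

definition increment_form :: "real \<Rightarrow> real ^ 'd \<Rightarrow> (real ^ 'd \<Rightarrow> real) \<Rightarrow> real" where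
  "increment_form h y g = (\<integral>y'. quad (y' - y) * g (exp_chart (y' - y)) \<partial>Q h y) / h"

lemma integrable_increment:
  assumes "0 \<le> h" "y \<in> nonneg_orthant" "continuous_on UNIV g"
  shows "integrable (Q h y) (\<lambda>y'. quad (y' - y) * g (exp_chart (y' - y)))"
proof -
  let ?K = "mass y"
  have yK: "y \<in> orthant_ball ?K" using assms by (simp add: orthant_ball_def)
  obtain C where C: "0 \<le> C" "\<And>u. u \<in> chart_box ?K \<Longrightarrow> \<bar>g u\<bar> \<le> C"
    using continuous_bounded_on_chart_box[OF assms(3)] by blast
  have [measurable]: "g \<in> borel_measurable borel"
    using assms(3) by (rule borel_measurable_continuous_onI)
  show ?thesis
  proof (rule integrable_Q[OF assms(1,2)])
    fix y' :: "real ^ 'd" assume "y' \<in> nonneg_orthant"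
    from exp_chart_in_chart_box[OF yK this]
    have "\<bar>g (exp_chart (y' - y))\<bar> \<le> C" "quad (y' - y) \<le> real CARD('d) * (1 + exp ?K)\<^sup>2"
      using C quad_le_of_chart_box by auto
    then show "\<bar>quad (y' - y) * g (exp_chart (y' - y))\<bar> \<le> (real CARD('d) * (1 + exp ?K)\<^sup>2) * C"
      using quad_nonneg[of "y' - y"] C(1) unfolding abs_mult by (intro mult_mono) auto
  qed measurable
qed

lemma integrable_levy:
  assumes "continuous_on UNIV g"
  shows "integrable \<nu> (\<lambda>z. quad z * g (exp_chart z))" "integrable (\<mu> i) (\<lambda>z. quad z * g (exp_chart z))"
proof -
  obtain C where C: "0 \<le> C" "\<And>u. u \<in> chart_box 0 \<Longrightarrow> \<bar>g u\<bar> \<le> C"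
    using continuous_bounded_on_chart_box[OF assms] by blast
  have [measurable]: "g \<in> borel_measurable borel"
    using assms by (rule borel_measurable_continuous_onI)
  have "\<bar>g (exp_chart z)\<bar> \<le> C" if "z \<in> punctured_orthant" for z
    using exp_chart_orthant_in_chart_box[of 0 z] that punctured_orthant_subset C(2) by auto
  then show "integrable \<nu> (\<lambda>z. quad z * g (exp_chart z))" "integrable (\<mu> i) (\<lambda>z. quad z * g (exp_chart z))"
    by (intro integrable_quad[where C = C]; measurable)+
qed

lemma levy_form_add:
  assumes "continuous_on UNIV p" "continuous_on UNIV q"
  shows "levy_form y (\<lambda>u. p u + q u) = levy_form y p + levy_form y q"
  using integrable_levy[OF assms(1)] integrable_levy[OF assms(2)]
  by (simp add: levy_form_def distrib_left sum.distrib)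

lemma levy_form_cmult: "levy_form y (\<lambda>u. a * p u) = a * levy_form y p"
proof -
  have "quad z * (a * p (exp_chart z)) = a * (quad z * p (exp_chart z))" for z :: "real ^ 'd" by simp
  then have "levy_form y (\<lambda>u. a * p u) = a * (\<integral>z. quad z * p (exp_chart z) \<partial>\<nu>)
     + (\<Sum>j\<in>UNIV. a * (y $ j * (\<integral>z. quad z * p (exp_chart z) \<partial>\<mu> j))) + a * (2 * (\<Sum>j\<in>UNIV. y $ j * c $ j) * p 1)"
    unfolding levy_form_def by (simp only: Bochner_Integration.integral_mult_right_zero mult.left_commute)
  then show ?thesis by (simp only: levy_form_def distrib_left sum_distrib_left)
qed

lemma levy_form_mono:
  assumes "continuous_on UNIV p" "continuous_on UNIV q" "y \<in> nonneg_orthant"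
    and le: "\<And>u. u \<in> chart_box 0 \<Longrightarrow> p u \<le> q u"
  shows "levy_form y p \<le> levy_form y q"
proof -
  have *: "quad z * p (exp_chart z) \<le> quad z * q (exp_chart z)" if "z \<in> punctured_orthant" for z
    using that punctured_orthant_subset quad_nonneg[of z]
    by (intro mult_left_mono le exp_chart_orthant_in_chart_box) auto
  have "(\<integral>z. quad z * p (exp_chart z) \<partial>\<nu>) \<le> (\<integral>z. quad z * q (exp_chart z) \<partial>\<nu>)"
    "(\<integral>z. quad z * p (exp_chart z) \<partial>\<mu> j) \<le> (\<integral>z. quad z * q (exp_chart z) \<partial>\<mu> j)" for j
    using integrable_levy[OF assms(1)] integrable_levy[OF assms(2)] *
    by (auto intro!: integral_mono)
  moreover have "2 * (\<Sum>j\<in>UNIV. y $ j * c $ j) * p 1 \<le> 2 * (\<Sum>j\<in>UNIV. y $ j * c $ j) * q 1"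
    using c_nonneg nonneg_orthantD[OF assms(3)]
    by (intro mult_left_mono le one_in_chart_box) (auto intro!: sum_nonneg mult_nonneg_nonneg)
  moreover have "(\<Sum>j\<in>UNIV. y $ j * (\<integral>z. quad z * p (exp_chart z) \<partial>\<mu> j)) \<le>
      (\<Sum>j\<in>UNIV. y $ j * (\<integral>z. quad z * q (exp_chart z) \<partial>\<mu> j))"
    using calculation(2) nonneg_orthantD[OF assms(3)] by (intro sum_mono mult_left_mono) auto
  ultimately show ?thesis unfolding levy_form_def by linarith
qed

lemma increment_form_mono:
  assumes "continuous_on UNIV p" "continuous_on UNIV q" "y \<in> orthant_ball K" "0 < h"
    and le: "\<And>u. u \<in> chart_box K \<Longrightarrow> p u \<le> q u"
  shows "increment_form h y p \<le> increment_form h y q"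
proof -
  have y: "y \<in> nonneg_orthant" using assms by (simp add: orthant_ball_def)
  have "quad (y' - y) * p (exp_chart (y' - y)) \<le> quad (y' - y) * q (exp_chart (y' - y))"
    if "y' \<in> space (Q h y)" for y'
    using that space_Q[of h y] assms y quad_nonneg[of "y' - y"]
    by (intro mult_left_mono le exp_chart_in_chart_box[OF assms(3)]) auto
  then show ?thesis unfolding increment_form_def
    using assms y by (intro divide_right_mono integral_mono integrable_increment) auto
qed

lemma increment_form_add:
  assumes "continuous_on UNIV p" "continuous_on UNIV q" "y \<in> nonneg_orthant" "0 < h"
  shows "increment_form h y (\<lambda>u. p u + q u) = increment_form h y p + increment_form h y q"
  using integrable_increment[OF _ assms(3) assms(1), of h] integrable_increment[OF _ assms(3) assms(2), of h] assms(4)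
  by (simp add: increment_form_def distrib_left add_divide_distrib)

lemma increment_form_cmult:
  "increment_form h y (\<lambda>u. a * p u) = a * increment_form h y p"
proof -
  have "quad z * (a * p (exp_chart z)) = a * (quad z * p (exp_chart z))" for z :: "real ^ 'd" by simp
  then show ?thesis
    by (simp only: increment_form_def Bochner_Integration.integral_mult_right_zero times_divide_eq_right)
qed

lemma integrable_exp_increment:
  assumes "0 \<le> h" "y \<in> nonneg_orthant" "\<xi> \<in> nonneg_orthant"
  shows "integrable (Q h y) (\<lambda>y'. exp (- (\<xi> \<bullet> (y' - y))))"
proof (rule integrable_Q[OF assms(1,2)])
  fix y' :: "real ^ 'd" assume "y' \<in> nonneg_orthant"
  then show "\<bar>exp (- (\<xi> \<bullet> (y' - y)))\<bar> \<le> exp (\<xi> \<bullet> y)"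
    using inner_nonneg_orthant[OF assms(3)] by (simp add: inner_diff_right)
qed measurable

text \<open>A monomial in the chart is an exponential in the increment, so both sides are second differences in
  the Laplace variable: of the transform of the increment and of its derivative at time zero.\<close>

lemma increment_form_monomial_limit:
  assumes "0 \<le> K"
  shows "uniform_limit (orthant_ball K) (\<lambda>h y. increment_form h y (\<lambda>u. \<Prod>i\<in>UNIV. u $ i ^ n i))
    (\<lambda>y. levy_form y (\<lambda>u. \<Prod>i\<in>UNIV. u $ i ^ n i)) (at_right 0)"
proof -
  define \<xi> :: "real ^ 'd" where "\<xi> = (\<chi> i. real (n i))"
  have \<xi>: "\<xi> \<in> nonneg_orthant" by (simp add: \<xi>_def nonneg_orthant_def)
  have mono: "(\<Prod>i\<in>UNIV. exp_chart z $ i ^ n i) = exp (- (\<xi> \<bullet> z))" for z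
  proof -
    have "exp_chart z $ i ^ n i = exp (- (\<xi> $ i * z $ i))" for i
      by (simp add: exp_chart_def \<xi>_def flip: exp_of_nat_mult)
    then have "(\<Prod>i\<in>UNIV. exp_chart z $ i ^ n i) = exp (\<Sum>i\<in>UNIV. - (\<xi> $ i * z $ i))"
      by (simp add: exp_sum)
    then show ?thesis by (simp add: inner_vec_def sum_negf)
  qed
  have ul: "uniform_limit (orthant_ball K)
      (\<lambda>h y. second_difference (\<lambda>\<xi>. (laplace_increment h \<xi> y - 1) / h) \<xi>)
      (\<lambda>y. second_difference (\<lambda>\<xi>. (\<Sum>i\<in>UNIV. y $ i * \<phi> \<xi> $ i) - \<psi> \<xi>) \<xi>) (at_right 0)"
    unfolding second_difference_def
    by (intro uniform_limit_sum uniform_limit_add uniform_limit_minus uniform_limit_cmult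
        laplace_increment_limit assms \<xi> nonneg_orthant_add axis_nonneg_orthant) auto
  have ev: "\<forall>\<^sub>F h in at_right 0. (0::real) < h" by (simp add: eventually_at_right_less)
  show ?thesis
  proof (rule uniform_limit_cong[THEN iffD1, OF _ _ ul])
    show "\<forall>\<^sub>F h in at_right 0. \<forall>y\<in>orthant_ball K.
      second_difference (\<lambda>\<xi>. (laplace_increment h \<xi> y - 1) / h) \<xi> =
      increment_form h y (\<lambda>u. \<Prod>i\<in>UNIV. u $ i ^ n i)"
      using ev
    proof eventually_elim
      case (elim h)
      show ?case
      proof
        fix y :: "real ^ 'd" assume "y \<in> orthant_ball K"
        then have y: "y \<in> nonneg_orthant" by (simp add: orthant_ball_def)
        have "second_difference (\<lambda>\<xi>. (laplace_increment h \<xi> y - 1) / h) \<xi> =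
            second_difference (\<lambda>\<xi>. (1 / h) * laplace_increment h \<xi> y - 1 / h) \<xi>"
          by (simp add: diff_divide_distrib)
        also have "\<dots> = (1 / h) * second_difference (\<lambda>\<xi>. laplace_increment h \<xi> y) \<xi>"
          by (simp only: second_difference_diff second_difference_cmult second_difference_const diff_0_right)
        also have "second_difference (\<lambda>\<xi>. laplace_increment h \<xi> y) \<xi> =
            (\<integral>y'. second_difference (\<lambda>\<xi>. exp (- (\<xi> \<bullet> (y' - y)))) \<xi> \<partial>Q h y)"
          unfolding laplace_increment_def
          using elim y \<xi> by (intro second_difference_integral integrable_exp_increment) auto
        finally show "second_difference (\<lambda>\<xi>. (laplace_increment h \<xi> y - 1) / h) \<xi> =
            increment_form h y (\<lambda>u. \<Prod>i\<in>UNIV. u $ i ^ n i)"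
          by (simp add: second_difference_exp increment_form_def mono)
      qed
    qed
    fix y :: "real ^ 'd" assume "y \<in> orthant_ball K"
    have "second_difference (\<lambda>\<xi>. (\<Sum>i\<in>UNIV. y $ i * \<phi> \<xi> $ i) - \<psi> \<xi>) \<xi> =
        (\<Sum>j\<in>UNIV. y $ j * (2 * c $ j + (\<integral>z. quad z * exp (- (\<xi> \<bullet> z)) \<partial>\<mu> j)))
        + (\<integral>z. quad z * exp (- (\<xi> \<bullet> z)) \<partial>\<nu>)"
      by (simp only: second_difference_diff second_difference_sum second_difference_cmult
          second_difference_branching[OF \<xi>] second_difference_immigration[OF \<xi>] diff_minus_eq_add)
    also have "\<dots> = levy_form y (\<lambda>u. \<Prod>i\<in>UNIV. u $ i ^ n i)"
      unfolding levy_form_def mono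
      by (simp add: distrib_left sum.distrib sum_distrib_left mult.left_commute)
    finally show "second_difference (\<lambda>\<xi>. (\<Sum>i\<in>UNIV. y $ i * \<phi> \<xi> $ i) - \<psi> \<xi>) \<xi> =
        levy_form y (\<lambda>u. \<Prod>i\<in>UNIV. u $ i ^ n i)" .
  qed
qed

lemma increment_form_poly_limit:
  assumes "0 \<le> K" "vec_poly p"
  shows "uniform_limit (orthant_ball K) (\<lambda>h y. increment_form h y p) (\<lambda>y. levy_form y p) (at_right 0)"
  using assms(2)
proof induction
  case (monomial n)
  show ?case by (rule increment_form_monomial_limit[OF assms(1)])
next
  case (add p q)
  note cont = continuous_on_vec_poly[OF add.hyps(1)] continuous_on_vec_poly[OF add.hyps(2)]
  have ev: "\<forall>\<^sub>F h in at_right 0. (0::real) < h" by (simp add: eventually_at_right_less)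
  show ?case
  proof (rule uniform_limit_cong[THEN iffD1, OF _ _ uniform_limit_add[OF add.IH]])
    show "\<forall>\<^sub>F h in at_right 0. \<forall>y\<in>orthant_ball K.
        increment_form h y p + increment_form h y q = increment_form h y (\<lambda>u. p u + q u)"
      using ev by eventually_elim (auto simp: orthant_ball_def increment_form_add cont)
  qed (simp add: levy_form_add cont)
next
  case (scale p a)
  then show ?case
    by (simp add: levy_form_cmult increment_form_cmult uniform_limit_cmult)
qed

text \<open>Both forms are monotone in \<open>g\<close> and bounded on the constant function 1, so uniform approximation by
  polynomials on the compact box carries the limit over.\<close>

lemma increment_form_limit:
  assumes K: "0 \<le> K" and g: "continuous_on UNIV g"
  shows "uniform_limit (orthant_ball K) (\<lambda>h y. increment_form h y g) (\<lambda>y. levy_form y g) (at_right 0)"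
proof (rule uniform_limitI)
  fix e :: real assume e: "0 < e"
  define M where "M = (\<integral>z. quad z \<partial>\<nu>) + (\<Sum>j\<in>UNIV. K * (\<integral>z. quad z \<partial>\<mu> j)) + 2 * (\<Sum>j\<in>UNIV. K * c $ j)"
  have M: "levy_form y (\<lambda>_. 1) \<le> M" if "y \<in> orthant_ball K" for y
  proof -
    have "y $ j \<le> K" for j using that component_le_mass[of y j] by (auto simp: orthant_ball_def)
    then show ?thesis unfolding levy_form_def M_def
      using c_nonneg quad_nonneg
      by (auto intro!: add_mono sum_mono mult_right_mono Bochner_Integration.integral_nonneg)
  qed
  have M0: "0 \<le> M" using K c_nonneg quad_nonneg unfolding M_def
    by (intro add_nonneg_nonneg sum_nonneg mult_nonneg_nonneg Bochner_Integration.integral_nonneg) auto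
  define e' where "e' = e / (4 * (M + 1))"
  have e': "0 < e'" using e M0 by (simp add: e'_def)
  obtain p where p: "vec_poly p" and gp: "\<And>u. u \<in> chart_box K \<Longrightarrow> \<bar>g u - p u\<bar> < e'"
    using vec_poly_approximation[OF compact_chart_box continuous_on_subset[OF g subset_UNIV] e'] by blast
  have pc: "continuous_on UNIV p" by (rule continuous_on_vec_poly[OF p])
  have one: "vec_poly (\<lambda>_ :: real ^ 'd. 1 :: real)" using vec_poly.monomial[of "\<lambda>_. 0"] by simp
  have c1: "continuous_on UNIV (\<lambda>_ :: real ^ 'd. e')" by simp
  have "\<forall>\<^sub>F h in at_right 0. (0::real) < h" by (simp add: eventually_at_right_less)
  moreover have "\<forall>\<^sub>F h in at_right 0. \<forall>y\<in>orthant_ball K. dist (increment_form h y (\<lambda>_. 1)) (levy_form y (\<lambda>_. 1)) < 1"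
    by (rule uniform_limitD[OF increment_form_poly_limit[OF K one]]) simp
  moreover have "\<forall>\<^sub>F h in at_right 0. \<forall>y\<in>orthant_ball K. dist (increment_form h y p) (levy_form y p) < e / 2"
    by (rule uniform_limitD[OF increment_form_poly_limit[OF K p]]) (use e in simp)
  ultimately show "\<forall>\<^sub>F h in at_right 0. \<forall>y\<in>orthant_ball K. dist (increment_form h y g) (levy_form y g) < e"
  proof eventually_elim
    case (elim h)
    show ?case
    proof
      fix y :: "real ^ 'd" assume yK: "y \<in> orthant_ball K"
      then have y: "y \<in> nonneg_orthant" by (simp add: orthant_ball_def)
      have up: "g u \<le> p u + e' * 1" "p u \<le> g u + e' * 1" if "u \<in> chart_box K" for u
        using gp[OF that] by auto
      have sub: "chart_box 0 \<subseteq> (chart_box K :: (real ^ 'd) set)"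
      proof
        fix u :: "real ^ 'd" assume "u \<in> chart_box 0"
        then have u: "0 \<le> u $ i" "u $ i \<le> 1" for i by (auto simp: chart_box_def mem_box_cart)
        have "1 \<le> exp K" using K by simp
        then show "u \<in> chart_box K"
          using u order_trans[OF u(2)] by (simp add: chart_box_def mem_box_cart)
      qed
      have I1: "increment_form h y (\<lambda>_. 1) \<le> M + 1" 
      proof -
        have "\<bar>increment_form h y (\<lambda>_. 1) - levy_form y (\<lambda>_. 1)\<bar> < 1"
          using elim(2) yK unfolding dist_real_def by blast
        then show ?thesis using M[OF yK] by linarith
      qed
      have gc: "continuous_on UNIV (\<lambda>u. g u + e' * 1)" "continuous_on UNIV (\<lambda>u. p u + e' * 1)"
        by (intro continuous_intros g pc)+
      have IE: "increment_form h y (\<lambda>u. q u + e' * 1) = increment_form h y q + e' * increment_form h y (\<lambda>_. 1)"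
        if "continuous_on UNIV q" for q
        using increment_form_add[OF that _ y elim(1), of "\<lambda>u. e' * 1"] increment_form_cmult[of h y e' "\<lambda>_. 1"] by simp
      have LE: "levy_form y (\<lambda>u. q u + e' * 1) = levy_form y q + e' * levy_form y (\<lambda>_. 1)"
        if "continuous_on UNIV q" for q
        using levy_form_add[OF that, of "\<lambda>u. e' * 1" y] levy_form_cmult[of y e' "\<lambda>_. 1"] by simp
      have a: "increment_form h y g \<le> increment_form h y p + e' * increment_form h y (\<lambda>_. 1)"
        "increment_form h y p \<le> increment_form h y g + e' * increment_form h y (\<lambda>_. 1)"
        unfolding IE[OF g, symmetric] IE[OF pc, symmetric]
        by (rule increment_form_mono[OF g gc(2) yK elim(1) up(1)], assumption)
           (rule increment_form_mono[OF pc gc(1) yK elim(1) up(2)], assumption)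
      have b: "levy_form y g \<le> levy_form y p + e' * levy_form y (\<lambda>_. 1)"
        "levy_form y p \<le> levy_form y g + e' * levy_form y (\<lambda>_. 1)"
        unfolding LE[OF g, symmetric] LE[OF pc, symmetric]
        by (rule levy_form_mono[OF g gc(2) y up(1)[OF subsetD[OF sub]]], assumption)
           (rule levy_form_mono[OF pc gc(1) y up(2)[OF subsetD[OF sub]]], assumption)
      have "e' * increment_form h y (\<lambda>_. 1) \<le> e' * (M + 1)" "e' * levy_form y (\<lambda>_. 1) \<le> e' * (M + 1)"
        using I1 M[OF yK] e' by (auto intro!: mult_left_mono)
      moreover have "e' * (M + 1) = e / 4" using M0 by (simp add: e'_def field_simps)
      moreover have "\<bar>increment_form h y p - levy_form y p\<bar> < e / 2" using elim(3) yK unfolding dist_real_def by blast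
      ultimately have "\<bar>increment_form h y g - levy_form y g\<bar> < e" using a b e by linarith
      then show "dist (increment_form h y g) (levy_form y g) < e" by (simp add: dist_real_def)
    qed
  qed
qed

end

section \<open>Large increments and displacement over short times\<close>

definition large_increments :: "real \<Rightarrow> (real ^ 'd) set" where
  "large_increments \<eta> = {z. \<exists>i. \<eta> \<le> z $ i}"

definition orthant_box :: "real ^ 'd \<Rightarrow> real \<Rightarrow> (real ^ 'd) set" where
  "orthant_box y0 r = {y \<in> nonneg_orthant. \<forall>i. \<bar>y $ i - y0 $ i\<bar> \<le> r}"

lemma large_increments_borel [measurable]: "large_increments \<eta> \<in> sets borel"
proof -
  have "large_increments \<eta> = (\<Union>i. {z \<in> space borel. \<eta> \<le> z $ i})"
    by (auto simp: large_increments_def)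
  also have "\<dots> \<in> sets borel" by measurable
  finally show ?thesis .
qed

lemma quad_zero [simp]: "quad 0 = 0"
  by (simp add: quad_def)

lemma sq_one_minus_exp_ge:
  fixes a r :: real
  assumes "0 \<le> r" "r \<le> \<bar>a\<bar>"
  shows "(1 - exp (- r))\<^sup>2 \<le> (1 - exp (- a))\<^sup>2"
proof -
  have r: "0 \<le> 1 - exp (- r)" using assms by simp
  have "1 - exp (- r) \<le> \<bar>1 - exp (- a)\<bar>"
  proof (cases "0 \<le> a")
    case True
    then show ?thesis using assms by (auto intro!: order_trans[OF _ abs_ge_self])
  next
    case False
    then have "exp r \<le> exp (- a)" using assms by simp
    moreover have "2 \<le> exp r + exp (- r)"
      using exp_ge_add_one_self[of r] exp_ge_add_one_self[of "- r"] by linarith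
    ultimately show ?thesis by linarith
  qed
  then show ?thesis using r by (simp add: abs_le_square_iff[symmetric])
qed

lemma quad_ge:
  assumes "0 \<le> r" "r \<le> \<bar>z $ i\<bar>"
  shows "(1 - exp (- r))\<^sup>2 \<le> quad z"
proof -
  have "(1 - exp (- r))\<^sup>2 \<le> (1 - exp (- (z $ i)))\<^sup>2" by (rule sq_one_minus_exp_ge[OF assms])
  also have "\<dots> \<le> quad z" unfolding quad_def by (rule member_le_sum) auto
  finally show ?thesis .
qed

lemma mass_orthant_box:
  fixes y0 :: "real ^ 'd"
  assumes "y \<in> orthant_box y0 r" "r \<le> 1" "mass y0 \<le> K"
  shows "mass y \<le> K + real CARD('d)"
proof -
  have "mass y \<le> (\<Sum>i\<in>UNIV. y0 $ i + 1)" unfolding mass_def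
  proof (rule sum_mono)
    fix i
    have "\<bar>y $ i - y0 $ i\<bar> \<le> r" using assms(1) by (simp add: orthant_box_def)
    then show "y $ i \<le> y0 $ i + 1" using assms(2) by linarith
  qed
  then show ?thesis using assms(3) by (simp add: sum.distrib mass_def)
qed

context cbi_kernel
begin

lemma axis_increment_bound:
  "\<exists>C>0. \<forall>\<^sub>F h in at_right 0. \<forall>y\<in>nonneg_orthant. h * (1 + mass y) \<le> 1 \<longrightarrow>
     (\<forall>i. \<forall>a\<in>{1, 2}. \<bar>laplace_increment h (axis i a) y - 1\<bar> \<le> C * (1 + mass y) * h)"
proof -
  let ?P = "\<lambda>C i a h. \<forall>y\<in>nonneg_orthant. h * (1 + mass y) \<le> 1 \<longrightarrow>
     \<bar>laplace_increment h (axis i a) y - 1\<bar> \<le> C * (1 + mass y) * h"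
  have "\<forall>i. \<forall>a\<in>{1, 2}. \<exists>C>0. \<forall>\<^sub>F h in at_right 0. ?P C i a h"
    by (intro allI ballI laplace_increment_bound axis_nonneg_orthant) auto
  then have "\<forall>i a. \<exists>C. a \<in> {1, 2} \<longrightarrow> 0 < C \<and> (\<forall>\<^sub>F h in at_right 0. ?P C i a h)" by blast
  then obtain C where "\<forall>i a. a \<in> {1, 2} \<longrightarrow> 0 < C i a \<and> (\<forall>\<^sub>F h in at_right 0. ?P (C i a) i a h)"
    unfolding choice_iff by (elim exE)
  then have C: "\<And>i a. a \<in> {1, 2} \<Longrightarrow> 0 < C i a"
      "\<And>i a. a \<in> {1, 2} \<Longrightarrow> \<forall>\<^sub>F h in at_right 0. ?P (C i a) i a h"
    by blast+
  define M where "M = (\<Sum>i\<in>UNIV. C i 1 + C i 2)"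
  have le: "C i a \<le> M" if "a \<in> {1, 2}" for i a
  proof -
    have "C i a \<le> C i 1 + C i 2" using that C(1)[of 1 i] C(1)[of 2 i] by auto
    also have "\<dots> \<le> M" unfolding M_def
      using less_imp_le[OF add_pos_pos[OF C(1) C(1)]] by (intro member_le_sum) auto
    finally show ?thesis .
  qed
  have "0 < M" using C(1)[of 1 undefined] le[of 1 undefined] by simp
  have "\<forall>\<^sub>F h in at_right 0. \<forall>i\<in>UNIV. ?P (C i 1) i 1 h \<and> ?P (C i 2) i 2 h"
  proof (rule eventually_ball_finite)
    show "\<forall>i\<in>UNIV. \<forall>\<^sub>F h in at_right 0. ?P (C i 1) i 1 h \<and> ?P (C i 2) i 2 h"
      by (intro ballI, rule eventually_conj[OF C(2) C(2)]) auto
  qed simp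
  moreover have "\<forall>\<^sub>F h in at_right 0. (0::real) < h" by (simp add: eventually_at_right_less)
  ultimately have "\<forall>\<^sub>F h in at_right 0. \<forall>y\<in>nonneg_orthant. h * (1 + mass y) \<le> 1 \<longrightarrow>
     (\<forall>i. \<forall>a\<in>{1, 2}. \<bar>laplace_increment h (axis i a) y - 1\<bar> \<le> M * (1 + mass y) * h)"
  proof eventually_elim
    case (elim h)
    show ?case
    proof (intro ballI impI allI)
      fix y :: "real ^ 'd" and i :: 'd and a :: real
      assume y: "y \<in> nonneg_orthant" "h * (1 + mass y) \<le> 1" and a: "a \<in> {1, 2}"
      have "\<bar>laplace_increment h (axis i a) y - 1\<bar> \<le> C i a * (1 + mass y) * h"
        using elim(1) y a by blast
      also have "\<dots> \<le> M * (1 + mass y) * h"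
        using le[OF a] mass_nonneg[OF y(1)] elim(2) by (intro mult_right_mono) auto
      finally show "\<bar>laplace_increment h (axis i a) y - 1\<bar> \<le> M * (1 + mass y) * h" .
    qed
  qed
  then show ?thesis using \<open>0 < M\<close> by blast
qed

lemma integral_exp_shift:
  "(\<integral>y'. exp (- (a * (y' $ i - y0 $ i))) \<partial>Q h y) = exp (- (a * (y $ i - y0 $ i))) * laplace_increment h (axis i a) y"
proof -
  have "exp (- (a * (y' $ i - y0 $ i))) = exp (- (a * (y $ i - y0 $ i))) * exp (- (axis i a \<bullet> (y' - y)))" for y'
  proof -
    have "- (a * (y' $ i - y0 $ i)) = - (a * (y $ i - y0 $ i)) + - (axis i a \<bullet> (y' - y))"
      by (simp add: inner_axis' algebra_simps)
    then show ?thesis by (simp only: exp_add)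
  qed
  then have "(\<integral>y'. exp (- (a * (y' $ i - y0 $ i))) \<partial>Q h y) =
      (\<integral>y'. exp (- (a * (y $ i - y0 $ i))) * exp (- (axis i a \<bullet> (y' - y))) \<partial>Q h y)"
    by (intro Bochner_Integration.integral_cong refl)
  then show ?thesis unfolding laplace_increment_def by (simp only: Bochner_Integration.integral_mult_right_zero)
qed

lemma integrable_exp_shift:
  assumes "0 \<le> h" "y \<in> nonneg_orthant" "0 \<le> a"
  shows "integrable (Q h y) (\<lambda>y'. exp (- (a * (y' $ i - y0 $ i))))"
proof (rule integrable_Q[OF assms(1,2), where C = "exp (a * y0 $ i)"])
  fix y' :: "real ^ 'd" assume "y' \<in> nonneg_orthant"
  then have "0 \<le> a * y' $ i" using assms(3) by (simp add: nonneg_orthant_def)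
  then show "\<bar>exp (- (a * (y' $ i - y0 $ i)))\<bar> \<le> exp (a * y0 $ i)" by (simp add: algebra_simps)
qed measurable

lemma quad_shift: "quad (y' - y0) = (\<Sum>i\<in>UNIV. 1 - 2 * exp (- (1 * (y' $ i - y0 $ i))) + exp (- (2 * (y' $ i - y0 $ i))))"
proof -
  have sq: "(1 - exp (- a))\<^sup>2 = 1 - 2 * exp (- (1 * a)) + exp (- (2 * a))" for a :: real
  proof -
    have "exp (- (2 * a)) = exp (- a) * exp (- a)" unfolding exp_add[symmetric] by simp
    then show ?thesis by (simp add: power2_eq_square algebra_simps)
  qed
  show ?thesis by (simp only: quad_def vector_minus_component sq)
qed

lemma integrable_quad_shift:
  assumes "0 \<le> h" "y \<in> nonneg_orthant"
  shows "integrable (Q h y) (\<lambda>y'. quad (y' - y0))"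
proof -
  interpret prob_space "Q h y" by (rule prob_space_Q[OF assms])
  show ?thesis unfolding quad_shift
    by (intro Bochner_Integration.integrable_sum Bochner_Integration.integrable_add
        Bochner_Integration.integrable_diff integrable_mult_right integrable_exp_shift assms) auto
qed

text \<open>The function \<open>quad (\<cdot> - y0)\<close> serves as a Lyapunov function: it vanishes at \<open>y0\<close>, is bounded below
  away from \<open>y0\<close>, and near \<open>y0\<close> increases in the mean at most linearly in time.\<close>

lemma quad_drift:
  "\<exists>C>0. \<forall>\<^sub>F h in at_right 0. \<forall>y0. \<forall>y\<in>orthant_box y0 1. h * (1 + mass y) \<le> 1 \<longrightarrow>
     (\<integral>y'. quad (y' - y0) \<partial>Q h y) \<le> quad (y - y0) + C * (1 + mass y) * h"
proof -
  obtain C where C: "0 < C" and ev: "\<forall>\<^sub>F h in at_right 0. \<forall>y\<in>nonneg_orthant. h * (1 + mass y) \<le> 1 \<longrightarrow>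
     (\<forall>i. \<forall>a\<in>{1, 2}. \<bar>laplace_increment h (axis i a) y - 1\<bar> \<le> C * (1 + mass y) * h)"
    using axis_increment_bound by blast
  let ?C = "real CARD('d) * ((2 * exp 1 + exp 2) * C)"
  have "\<forall>\<^sub>F h in at_right 0. (0::real) < h" by (simp add: eventually_at_right_less)
  with ev have "\<forall>\<^sub>F h in at_right 0. \<forall>y0. \<forall>y\<in>orthant_box y0 1. h * (1 + mass y) \<le> 1 \<longrightarrow>
     (\<integral>y'. quad (y' - y0) \<partial>Q h y) \<le> quad (y - y0) + ?C * (1 + mass y) * h"
  proof eventually_elim
    case (elim h)
    show ?case
    proof (intro allI ballI impI)
      fix y0 y :: "real ^ 'd" assume box: "y \<in> orthant_box y0 1" and hy: "h * (1 + mass y) \<le> 1"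
      then have y: "y \<in> nonneg_orthant" and d: "\<bar>y $ i - y0 $ i\<bar> \<le> 1" for i by (auto simp: orthant_box_def)
      interpret prob_space "Q h y" using prob_space_Q[of h y] elim y by simp
      let ?e = "\<lambda>i a. exp (- (a * (y $ i - y0 $ i)))" and ?L = "\<lambda>i a. laplace_increment h (axis i a) y"
      let ?B = "C * (1 + mass y) * h"
      have int: "integrable (Q h y) (\<lambda>y'. exp (- (a * (y' $ i - y0 $ i))))" if "0 \<le> a" for a i
        using integrable_exp_shift[OF _ y that] elim by simp
      have "(\<integral>y'. quad (y' - y0) \<partial>Q h y) = (\<Sum>i\<in>UNIV. 1 - 2 * (?e i 1 * ?L i 1) + ?e i 2 * ?L i 2)"
      proof -
        have "(\<integral>y'. quad (y' - y0) \<partial>Q h y) = (\<Sum>i\<in>UNIV. \<integral>y'. 1 - 2 * exp (- (1 * (y' $ i - y0 $ i)))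
            + exp (- (2 * (y' $ i - y0 $ i))) \<partial>Q h y)"
          unfolding quad_shift
          by (intro Bochner_Integration.integral_sum Bochner_Integration.integrable_add
              Bochner_Integration.integrable_diff integrable_mult_right int) auto
        also have "\<dots> = (\<Sum>i\<in>UNIV. 1 - 2 * (\<integral>y'. exp (- (1 * (y' $ i - y0 $ i))) \<partial>Q h y)
            + (\<integral>y'. exp (- (2 * (y' $ i - y0 $ i))) \<partial>Q h y))"
          using int[of 1] int[of 2] by (intro sum.cong refl) (simp add: prob_space)
        finally show ?thesis unfolding integral_exp_shift[where h = h and y = y] .
      qed
      also have "\<dots> \<le> (\<Sum>i\<in>UNIV. (1 - 2 * ?e i 1 + ?e i 2) + (2 * exp 1 + exp 2) * ?B)"
      proof (rule sum_mono)
        fix i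
        have B: "\<bar>?L i 1 - 1\<bar> \<le> ?B" "\<bar>?L i 2 - 1\<bar> \<le> ?B" using elim(1) y hy by blast+
        have e: "?e i 1 \<le> exp 1" "?e i 2 \<le> exp 2" using d[of i] by auto
        have B0: "0 \<le> ?B" using B by linarith
        have "\<bar>?e i 1 * (?L i 1 - 1)\<bar> \<le> exp 1 * ?B" "\<bar>?e i 2 * (?L i 2 - 1)\<bar> \<le> exp 2 * ?B"
          unfolding abs_mult using B e by (intro mult_mono; simp)+
        then have "- (?e i 1 * (?L i 1 - 1)) \<le> exp 1 * ?B" "?e i 2 * (?L i 2 - 1) \<le> exp 2 * ?B" by linarith+
        then show "1 - 2 * (?e i 1 * ?L i 1) + ?e i 2 * ?L i 2 \<le>
            (1 - 2 * ?e i 1 + ?e i 2) + (2 * exp 1 + exp 2) * ?B"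
          unfolding right_diff_distrib distrib_right by simp
      qed
      also have "\<dots> = quad (y - y0) + ?C * (1 + mass y) * h"
        by (simp add: sum.distrib quad_shift)
      finally show "(\<integral>y'. quad (y' - y0) \<partial>Q h y) \<le> quad (y - y0) + ?C * (1 + mass y) * h" .
    qed
  qed
  moreover have "0 < ?C" using C by (simp add: add_pos_pos)
  ultimately show ?thesis by blast
qed

abbreviation step_prob :: "real \<Rightarrow> real ^ 'd \<Rightarrow> (real ^ 'd) set \<Rightarrow> real" where
  "step_prob h y A \<equiv> measure (Q h y) {y' \<in> nonneg_orthant. y' - y \<in> A}"

lemma increment_event_sets:
  assumes "0 \<le> h" "y \<in> nonneg_orthant" and [measurable]: "A \<in> sets borel"
  shows "{y' \<in> nonneg_orthant. y' - y \<in> A} \<in> sets (Q h y)"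
proof -
  have "{y' \<in> space borel. y' - y \<in> A} \<inter> nonneg_orthant \<in> sets borel" by measurable
  then have "{y' \<in> space borel. y' - y \<in> A} \<inter> nonneg_orthant \<in> sets orthant_space"
    unfolding orthant_space_def by (subst sets_restrict_space_iff) auto
  then show ?thesis using sets_Q[OF assms(1,2)] by (simp add: Int_def conj_commute)
qed

lemma integral_increment_indicator:
  assumes "0 \<le> h" "y \<in> nonneg_orthant" "A \<in> sets borel"
  shows "(\<integral>y'. indicator A (y' - y) \<partial>Q h y) = step_prob h y A"
proof -
  have "(\<integral>y'. indicator A (y' - y) \<partial>Q h y) =
      (\<integral>y'. indicat_real {y' \<in> nonneg_orthant. y' - y \<in> A} y' \<partial>Q h y)"
    using space_Q[OF assms(1,2)] by (intro Bochner_Integration.integral_cong) (auto simp: indicator_def)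
  then show ?thesis using increment_event_sets[OF assms] sets.sets_into_space[OF increment_event_sets[OF assms]]
    by (simp add: Int_absorb2)
qed

text \<open>Markov's inequality for \<open>quad (\<cdot> - y)\<close> at its own centre.\<close>

lemma large_increment_bound:
  assumes "0 < \<eta>"
  shows "\<exists>C>0. \<forall>\<^sub>F h in at_right 0. \<forall>y\<in>nonneg_orthant. h * (1 + mass y) \<le> 1 \<longrightarrow>
     step_prob h y (large_increments \<eta>) \<le> C * (1 + mass y) * h"
proof -
  obtain C where C: "0 < C" and ev: "\<forall>\<^sub>F h in at_right 0. \<forall>y0. \<forall>y\<in>orthant_box y0 1. h * (1 + mass y) \<le> 1 \<longrightarrow>
     (\<integral>y'. quad (y' - y0) \<partial>Q h y) \<le> quad (y - y0) + C * (1 + mass y) * h"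
    using quad_drift by blast
  define k where "k = (1 - exp (- \<eta>))\<^sup>2"
  have k: "0 < k" using assms by (simp add: k_def)
  have "\<forall>\<^sub>F h in at_right 0. (0::real) < h" by (simp add: eventually_at_right_less)
  with ev have "\<forall>\<^sub>F h in at_right 0. \<forall>y\<in>nonneg_orthant. h * (1 + mass y) \<le> 1 \<longrightarrow>
     step_prob h y (large_increments \<eta>) \<le> (C / k) * (1 + mass y) * h"
  proof eventually_elim
    case (elim h)
    show ?case
    proof (intro ballI impI)
      fix y :: "real ^ 'd" assume y: "y \<in> nonneg_orthant" and hy: "h * (1 + mass y) \<le> 1"
      interpret prob_space "Q h y" using prob_space_Q[of h y] elim y by simp
      have h0: "0 \<le> h" using elim by simp
      have box: "y \<in> orthant_box y 1" using y by (simp add: orthant_box_def)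
      have "k * step_prob h y (large_increments \<eta>) =
          (\<integral>y'. k * indicator (large_increments \<eta>) (y' - y) \<partial>Q h y)"
        using integral_increment_indicator[OF h0 y large_increments_borel] by simp
      also have "\<dots> \<le> (\<integral>y'. quad (y' - y) \<partial>Q h y)"
      proof (rule integral_mono)
        show "integrable (Q h y) (\<lambda>y'. quad (y' - y))" by (rule integrable_quad_shift[OF h0 y])
        show "integrable (Q h y) (\<lambda>y'. k * indicator (large_increments \<eta>) (y' - y))"
          by (rule integrable_Q[OF h0 y, where C = k]) (measurable, auto simp: indicator_def k_def)
        fix y' :: "real ^ 'd"
        show "k * indicator (large_increments \<eta>) (y' - y) \<le> quad (y' - y)"
        proof (cases "y' - y \<in> large_increments \<eta>")
          case True
          then obtain i where "\<eta> \<le> (y' - y) $ i" by (auto simp: large_increments_def)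
          then show ?thesis using quad_ge[of \<eta> "y' - y" i] assms True by (simp add: k_def)
        qed (simp add: quad_nonneg)
      qed
      also have "\<dots> \<le> C * (1 + mass y) * h" 
      proof -
        have "(\<integral>y'. quad (y' - y) \<partial>Q h y) \<le> quad (y - y) + C * (1 + mass y) * h"
          using elim(1) box hy by blast
        then show ?thesis by simp
      qed
      finally show "step_prob h y (large_increments \<eta>) \<le> (C / k) * (1 + mass y) * h"
        using k by (simp add: field_simps)
    qed
  qed
  moreover have "0 < C / k" using C k by simp
  ultimately show ?thesis by blast
qed

end

section \<open>The discretised process\<close>

lemma harmonic_tail_unbounded: "\<exists>J. M \<le> (\<Sum>i<J. 1 / (real j + real i + 1))"
proof (rule ccontr)
  assume "\<not> ?thesis"
  then have "(\<Sum>i<J. 1 / (real j + real i + 1)) \<le> M" for J by (meson linear)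
  then have "summable (\<lambda>i. 1 / (real j + real i + 1))"
    by (intro summableI_nonneg_bounded[where x = M]) auto
  then have "summable (\<lambda>i. inverse (of_nat (i + (j + 1)) :: real))"
    by (simp add: inverse_eq_divide add.commute add.left_commute)
  then show False
    using summable_iff_shift[of "\<lambda>n. inverse (of_nat n :: real)" "j + 1"] not_summable_harmonic[where 'a = real]
    by blast
qed

context cbi_kernel
begin

text \<open>The probability that \<open>n\<close> steps of length \<open>h\<close> from \<open>y\<close> all have increments in \<open>E\<close>, and that
  one of them lies in \<open>G\<close> unless the flag \<open>b\<close> records that this has happened before.\<close>

primrec chain_prob :: "real \<Rightarrow> (real ^ 'd) set \<Rightarrow> (real ^ 'd) set \<Rightarrow> nat \<Rightarrow> bool \<Rightarrow> real ^ 'd \<Rightarrow> real" where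
  "chain_prob h E G 0 b y = (if b then 1 else 0)"
| "chain_prob h E G (Suc n) b y =
     (\<integral>y'. indicator E (y' - y) * chain_prob h E G n (b \<or> y' - y \<in> G) y' \<partial>Q h y)"

lemma kernel_integral_measurable:
  assumes "0 \<le> h"
    and f: "(\<lambda>(y, y'). f y y') \<in> borel_measurable (orthant_space \<Otimes>\<^sub>M orthant_space)"
    and nonneg: "\<And>y y'. 0 \<le> f y y'"
  shows "(\<lambda>y. \<integral>y'. f y y' \<partial>Q h y :: real) \<in> borel_measurable orthant_space"
proof -
  have "(\<lambda>(y, y'). ennreal (f y y')) \<in> borel_measurable (orthant_space \<Otimes>\<^sub>M orthant_space)"
    using measurable_compose[OF f measurable_ennreal] by (simp add: case_prod_beta')
  then have "(\<lambda>y. \<integral>\<^sup>+ y'. ennreal (f y y') \<partial>Q h y) \<in> borel_measurable orthant_space"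
    by (rule nn_integral_measurable_subprob_algebra2[OF _ measurable_prob_algebraD[OF Q_measurable[OF assms(1)]]])
  then have m: "(\<lambda>y. enn2real (\<integral>\<^sup>+ y'. ennreal (f y y') \<partial>Q h y)) \<in> borel_measurable orthant_space"
    by measurable
  have eq: "(\<integral>y'. f y y' \<partial>Q h y) = enn2real (\<integral>\<^sup>+ y'. ennreal (f y y') \<partial>Q h y)"
    if y: "y \<in> space orthant_space" for y
  proof (rule integral_eq_nn_integral)
    have "(\<lambda>y'. f y y') \<in> borel_measurable orthant_space"
      using measurable_Pair2[OF f y] by simp
    then show "(\<lambda>y'. f y y') \<in> borel_measurable (Q h y)"
      using sets_Q[OF assms(1)] y by (simp cong: measurable_cong_sets)
  qed (use nonneg in simp)
  show ?thesis by (rule measurable_cong[THEN iffD2, OF eq m])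
qed

lemma measurable_orthant_ident: "(\<lambda>y. y) \<in> borel_measurable orthant_space"
  unfolding orthant_space_def by (rule measurable_restrict_space1) simp

lemma measurable_increment:
  "(\<lambda>p. snd p - fst p :: real ^ 'd) \<in> borel_measurable (orthant_space \<Otimes>\<^sub>M orthant_space)"
  by (intro borel_measurable_diff measurable_compose[OF measurable_fst measurable_orthant_ident]
      measurable_compose[OF measurable_snd measurable_orthant_ident])

lemma chain_step_measurable:
  fixes E G :: "(real ^ 'd) set"
  assumes [measurable]: "E \<in> sets borel" "G \<in> sets borel"
    and m: "\<And>b. g b \<in> borel_measurable orthant_space"
  shows "(\<lambda>(y, y'). indicator E (y' - y) * g (b \<or> y' - y \<in> G) y' :: real)
    \<in> borel_measurable (orthant_space \<Otimes>\<^sub>M orthant_space)"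
proof -
  have ind: "(\<lambda>p. indicator A (snd p - fst p) :: real) \<in> borel_measurable (orthant_space \<Otimes>\<^sub>M orthant_space)"
    if "A \<in> sets borel" for A :: "(real ^ 'd) set"
    using measurable_compose[OF measurable_increment borel_measurable_indicator[OF that]] .
  have g: "(\<lambda>p. g b' (snd p)) \<in> borel_measurable (orthant_space \<Otimes>\<^sub>M orthant_space)" for b'
    by (rule measurable_compose[OF measurable_snd m])
  have "(\<lambda>p. indicator E (snd p - fst p) * (indicator G (snd p - fst p) * g True (snd p)
      + indicator (- G) (snd p - fst p) * g b (snd p)) :: real)
    \<in> borel_measurable (orthant_space \<Otimes>\<^sub>M orthant_space)"
    by (rule borel_measurable_times[OF ind[OF assms(1)] borel_measurable_add[OF
          borel_measurable_times[OF ind[OF assms(2)] g] borel_measurable_times[OF ind[OF borel_comp[OF assms(2)]] g]]])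
  also have "(\<lambda>p. indicator E (snd p - fst p) * (indicator G (snd p - fst p) * g True (snd p)
      + indicator (- G) (snd p - fst p) * g b (snd p)) :: real)
    = (\<lambda>(y, y'). indicator E (y' - y) * g (b \<or> y' - y \<in> G) y')"
    by (auto simp: fun_eq_iff indicator_def)
  finally show ?thesis .
qed

lemma chain_prob_props:
  assumes "0 \<le> h" "E \<in> sets borel" "G \<in> sets borel"
  shows "chain_prob h E G n b \<in> borel_measurable orthant_space \<and>
    (\<forall>y. 0 \<le> chain_prob h E G n b y) \<and> (\<forall>y\<in>nonneg_orthant. chain_prob h E G n b y \<le> 1)"
proof (induction n arbitrary: b)
  case 0
  then show ?case by simp
next
  case (Suc n)
  have n0: "0 \<le> chain_prob h E G (Suc n) b y" for y
    unfolding chain_prob.simps using Suc by (intro Bochner_Integration.integral_nonneg) auto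
  have m: "chain_prob h E G (Suc n) b \<in> borel_measurable orthant_space"
    unfolding chain_prob.simps[abs_def]
    by (rule kernel_integral_measurable[OF assms(1) chain_step_measurable[OF assms(2,3)]]) (use Suc in auto)
  have "chain_prob h E G (Suc n) b y \<le> 1" if y: "y \<in> nonneg_orthant" for y
  proof -
    interpret prob_space "Q h y" by (rule prob_space_Q[OF assms(1) y])
    have "chain_prob h E G (Suc n) b y \<le> (\<integral>y'. 1 \<partial>Q h y)" unfolding chain_prob.simps
      using Suc space_Q[OF assms(1) y]
      by (intro integral_mono') (auto simp: indicator_def)
    then show ?thesis by (simp add: prob_space)
  qed
  then show ?case using n0 m by blast
qed

lemma chain_prob_nonneg:
  assumes "0 \<le> h" "E \<in> sets borel" "G \<in> sets borel"
  shows "0 \<le> chain_prob h E G n b y"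
  using chain_prob_props[OF assms, of n b] by blast

lemma integrable_chain_step:
  assumes "0 \<le> h" "E \<in> sets borel" "G \<in> sets borel" "y \<in> nonneg_orthant"
  shows "integrable (Q h y) (\<lambda>y'. indicator E (y' - y) * chain_prob h E G n (b \<or> y' - y \<in> G) y')"
proof -
  interpret prob_space "Q h y" by (rule prob_space_Q[OF assms(1,4)])
  have p: "chain_prob h E G n b \<in> borel_measurable orthant_space" for b
    using chain_prob_props[OF assms(1-3)] by blast
  have "(\<lambda>y'. indicator E (y' - y) * chain_prob h E G n (b \<or> y' - y \<in> G) y') \<in> borel_measurable orthant_space"
    using measurable_Pair2[OF chain_step_measurable[OF assms(2,3) p], of y] assms(4) by simp
  then have "(\<lambda>y'. indicator E (y' - y) * chain_prob h E G n (b \<or> y' - y \<in> G) y') \<in> borel_measurable (Q h y)"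
    using sets_Q[OF assms(1,4)] by (simp cong: measurable_cong_sets)
  then show ?thesis
  proof (rule integrable_const_bound[of _ 1, rotated])
    show "AE y' in Q h y. norm (indicator E (y' - y) * chain_prob h E G n (b \<or> y' - y \<in> G) y') \<le> 1"
    proof (rule AE_I2)
      fix y' assume "y' \<in> space (Q h y)"
      then have "0 \<le> chain_prob h E G n b y'" "chain_prob h E G n b y' \<le> 1" for b
        using chain_prob_props[OF assms(1-3), of n b] space_Q[OF assms(1,4)] by auto
      then show "norm (indicator E (y' - y) * chain_prob h E G n (b \<or> y' - y \<in> G) y') \<le> 1"
        by (auto simp: indicator_def)
    qed
  qed
qed

text \<open>One step of the recursion: inside a box around \<open>y0\<close> a lower bound that is linear in
  \<open>quad (\<cdot> - y0)\<close> loses only an amount of order \<open>h\<close>, through the drift of \<open>quad\<close> and through the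
  rare large increments; outside the box it is vacuous.\<close>

lemma integral_lower_step:
  assumes h: "0 \<le> h" and y: "y \<in> nonneg_orthant" and A: "A \<in> sets borel"
    and L: "L \<in> sets borel" "L \<subseteq> large_increments \<eta>"
    and "0 \<le> a" "0 \<le> k" "0 \<le> g" "0 \<le> b"
    and int: "integrable (Q h y) f"
    and lower: "\<And>y'. y' \<in> nonneg_orthant \<Longrightarrow>
      g * indicator A (y' - y) + k * (1 - a * quad (y' - y0) - b) - k * indicator L (y' - y) \<le> f y'"
    and drift: "(\<integral>y'. quad (y' - y0) \<partial>Q h y) \<le> quad (y - y0) + d1"
    and large: "step_prob h y (large_increments \<eta>) \<le> d2"
  shows "g * step_prob h y A
    + k * (1 - a * quad (y - y0) - b - (a * d1 + d2)) \<le> (\<integral>y'. f y' \<partial>Q h y)"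
proof -
  interpret prob_space "Q h y" by (rule prob_space_Q[OF h y])
  have iA: "integrable (Q h y) (\<lambda>y'. indicat_real A (y' - y))"
    and iL: "integrable (Q h y) (\<lambda>y'. indicat_real L (y' - y))"
    using A L by (intro integrable_Q[OF h y, where C = 1]; measurable; auto simp: indicator_def)+
  have iq: "integrable (Q h y) (\<lambda>y'. quad (y' - y0))" by (rule integrable_quad_shift[OF h y])
  let ?l = "\<lambda>y'. g * indicator A (y' - y) + k * (1 - a * quad (y' - y0) - b) - k * indicator L (y' - y)"
  have i: "integrable (Q h y) ?l" using iA iL iq by simp
  have "step_prob h y L \<le>
      step_prob h y (large_increments \<eta>)"
    using L(2) by (intro finite_measure_mono increment_event_sets[OF h y]) auto
  then have mL: "k * step_prob h y L \<le> k * d2"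
    using large assms(7) by (intro mult_left_mono) auto
  have mq: "k * (a * (\<integral>y'. quad (y' - y0) \<partial>Q h y)) \<le> k * (a * (quad (y - y0) + d1))"
    using drift assms by (intro mult_left_mono) auto
  have "(\<integral>y'. ?l y' \<partial>Q h y) = g * step_prob h y A
      + k * (1 - a * (\<integral>y'. quad (y' - y0) \<partial>Q h y) - b) - k * step_prob h y L"
    using iA iL iq integral_increment_indicator[OF h y A] integral_increment_indicator[OF h y L(1)]
    by (simp add: prob_space)
  moreover have "(\<integral>y'. ?l y' \<partial>Q h y) \<le> (\<integral>y'. f y' \<partial>Q h y)"
    using lower space_Q[OF h y] by (intro integral_mono[OF i int]) auto
  ultimately show ?thesis using mL mq by (simp add: algebra_simps)
qed

definition one_step_bounds :: "real \<Rightarrow> real \<Rightarrow> real \<Rightarrow> real \<Rightarrow> bool" where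
  "one_step_bounds \<eta> C D h \<longleftrightarrow> (\<forall>K\<ge>0. \<forall>y0. mass y0 \<le> K \<longrightarrow> h * (1 + K) \<le> D \<longrightarrow>
     (\<forall>y\<in>orthant_box y0 1. (\<integral>y'. quad (y' - y0) \<partial>Q h y) \<le> quad (y - y0) + C * (1 + K) * h \<and>
        step_prob h y (large_increments \<eta>) \<le> C * (1 + K) * h))"

lemma local_step_constants:
  assumes "0 < \<eta>"
  shows "\<exists>C>0. \<exists>D>0. \<forall>\<^sub>F h in at_right 0. one_step_bounds \<eta> C D h"
proof -
  obtain C1 where C1: "0 < C1" and ev1: "\<forall>\<^sub>F h in at_right 0. \<forall>y0. \<forall>y\<in>orthant_box y0 1. h * (1 + mass y) \<le> 1 \<longrightarrow>
     (\<integral>y'. quad (y' - y0) \<partial>Q h y) \<le> quad (y - y0) + C1 * (1 + mass y) * h"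
    using quad_drift by blast
  obtain C2 where C2: "0 < C2" and ev2: "\<forall>\<^sub>F h in at_right 0. \<forall>y\<in>nonneg_orthant. h * (1 + mass y) \<le> 1 \<longrightarrow>
     step_prob h y (large_increments \<eta>) \<le> C2 * (1 + mass y) * h"
    using large_increment_bound[OF assms] by blast
  define D where "D = 1 + real CARD('d)"
  define C where "C = (C1 + C2) * D"
  have D: "1 \<le> D" by (simp add: D_def)
  have "\<forall>\<^sub>F h in at_right 0. (0::real) < h" by (simp add: eventually_at_right_less)
  with ev1 ev2 have "\<forall>\<^sub>F h in at_right 0. one_step_bounds \<eta> C (1 / D) h"
  proof eventually_elim
    case (elim h)
    show ?case unfolding one_step_bounds_def
    proof (intro allI impI ballI)
      fix K :: real and y0 y :: "real ^ 'd"
      assume K: "0 \<le> K" and y0: "mass y0 \<le> K" and hK: "h * (1 + K) \<le> 1 / D" and box: "y \<in> orthant_box y0 1"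
      have y: "y \<in> nonneg_orthant" using box by (simp add: orthant_box_def)
      have "mass y \<le> K + real CARD('d)" by (rule mass_orthant_box[OF box _ y0]) simp
      moreover have "0 \<le> K * real CARD('d)" using K by simp
      ultimately have m: "1 + mass y \<le> (1 + K) * D" by (simp add: D_def algebra_simps)
      have "h * (1 + mass y) \<le> h * ((1 + K) * D)" using m elim(3) by (intro mult_left_mono) auto
      also have "\<dots> = (h * (1 + K)) * D" by simp
      also have "\<dots> \<le> (1 / D) * D" using hK D by (intro mult_right_mono) auto
      also have "\<dots> = 1" using D by simp
      finally have hy: "h * (1 + mass y) \<le> 1" .
      have b: "C' * (1 + mass y) * h \<le> C * (1 + K) * h" if "0 < C'" "C' \<le> C1 + C2" for C'
      proof -
        have "C' * (1 + mass y) \<le> (C1 + C2) * ((1 + K) * D)"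
          using m that mass_nonneg[OF y] by (intro mult_mono) auto
        then have "C' * (1 + mass y) \<le> C * (1 + K)" by (simp add: C_def mult.commute mult.left_commute)
        then show ?thesis using elim(3) by (intro mult_right_mono) auto
      qed
      have "(\<integral>y'. quad (y' - y0) \<partial>Q h y) \<le> quad (y - y0) + C1 * (1 + mass y) * h"
        using elim(1) box hy by blast
      moreover have "step_prob h y (large_increments \<eta>) \<le> C2 * (1 + mass y) * h"
        using elim(2) y hy by blast
      ultimately show "(\<integral>y'. quad (y' - y0) \<partial>Q h y) \<le> quad (y - y0) + C * (1 + K) * h \<and>
        step_prob h y (large_increments \<eta>) \<le> C * (1 + K) * h"
        using b[of C1] b[of C2] C1 C2 by linarith
    qed
  qed
  moreover have "0 < C" "0 < 1 / D" using C1 C2 D by (auto simp: C_def)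
  ultimately show ?thesis by blast
qed

definition box_weight :: "real \<Rightarrow> real" where
  "box_weight r = 1 / (1 - exp (- r))\<^sup>2"

lemma outside_box:
  assumes "0 < r" "y \<in> nonneg_orthant" "y \<notin> orthant_box y0 r"
  shows "1 \<le> box_weight r * quad (y - y0)"
proof -
  obtain i where "r < \<bar>(y - y0) $ i\<bar>" using assms by (auto simp: orthant_box_def not_le)
  then have "(1 - exp (- r))\<^sup>2 \<le> quad (y - y0)" using assms by (intro quad_ge[of r "y - y0" i]) auto
  moreover have "0 < (1 - exp (- r))\<^sup>2" using assms by simp
  ultimately show ?thesis by (simp add: box_weight_def field_simps)
qed

definition survival_step :: "real \<Rightarrow> real \<Rightarrow> real \<Rightarrow> real \<Rightarrow> bool" where
  "survival_step \<eta> b D h \<longleftrightarrow> (\<forall>K\<ge>0. \<forall>y0. mass y0 \<le> K \<longrightarrow> h * (1 + K) \<le> D \<longrightarrow>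
    (\<forall>E\<in>sets borel. \<forall>G\<in>sets borel. - E \<subseteq> large_increments \<eta> \<longrightarrow>
      (\<forall>\<gamma>\<ge>0. \<forall>m. (\<forall>y\<in>orthant_box y0 1. \<gamma> \<le> chain_prob h E G m True y) \<longrightarrow>
        (\<forall>n. \<forall>y\<in>nonneg_orthant.
           \<gamma> * (1 - box_weight 1 * quad (y - y0) - b * (1 + K) * (real n * h)) \<le> chain_prob h E G (n + m) True y))))"

text \<open>Induction on the number of steps by \<open>integral_lower_step\<close>.  The weight makes the lower bound
  nonpositive outside the box around \<open>y0\<close>, so it is trivial after an exit from the box.\<close>

lemma survive_local:
  assumes "0 < \<eta>"
  shows "\<exists>b>0. \<exists>D>0. \<forall>\<^sub>F h in at_right 0. survival_step \<eta> b D h"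
proof -
  define a where "a = box_weight 1"
  have a0: "0 \<le> a" by (simp add: a_def box_weight_def)
  obtain C D where C: "0 < C" "0 < D" and ev: "\<forall>\<^sub>F h in at_right 0. one_step_bounds \<eta> C D h"
    using local_step_constants[OF assms] by blast
  define b where "b = (a + 1) * C"
  have b: "0 < b" using a0 C by (simp add: b_def)
  have "\<forall>\<^sub>F h in at_right 0. (0::real) < h" by (simp add: eventually_at_right_less)
  with ev have "\<forall>\<^sub>F h in at_right 0. survival_step \<eta> b D h"
  proof eventually_elim
    case (elim h)
    show ?case unfolding survival_step_def a_def[symmetric]
    proof (intro allI impI ballI)
      fix K \<gamma> :: real and y0 y :: "real ^ 'd" and E G :: "(real ^ 'd) set" and m n :: nat
      assume K: "0 \<le> K" and y0: "mass y0 \<le> K" and hK: "h * (1 + K) \<le> D"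
        and EG[measurable]: "E \<in> sets borel" "G \<in> sets borel" and E: "- E \<subseteq> large_increments \<eta>" and g: "0 \<le> \<gamma>"
        and base: "\<forall>y\<in>orthant_box y0 1. \<gamma> \<le> chain_prob h E G m True y" and y: "y \<in> nonneg_orthant"
      have h0: "0 \<le> h" using elim by simp
      note nonneg = chain_prob_nonneg[OF h0 EG]
      have err: "0 \<le> b * (1 + K) * (real n * h)" for n using b K h0 by simp
      have outside: "\<gamma> * (1 - a * quad (y - y0) - b * (1 + K) * (real n * h)) \<le> chain_prob h E G k True y"
        if "y \<in> nonneg_orthant" "y \<notin> orthant_box y0 1" for n k y
      proof -
        have "1 - a * quad (y - y0) - b * (1 + K) * (real n * h) \<le> 0"
          using outside_box[OF zero_less_one that, folded a_def] err[of n] by linarith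
        then have "\<gamma> * (1 - a * quad (y - y0) - b * (1 + K) * (real n * h)) \<le> 0"
          using g by (simp add: mult_nonneg_nonpos)
        also have "\<dots> \<le> chain_prob h E G k True y" by (rule nonneg)
        finally show ?thesis .
      qed
      show "\<gamma> * (1 - a * quad (y - y0) - b * (1 + K) * (real n * h)) \<le> chain_prob h E G (n + m) True y"
        using y
      proof (induction n arbitrary: y)
        case 0
        show ?case
        proof (cases "y \<in> orthant_box y0 1")
          case True
          have "\<gamma> * (1 - a * quad (y - y0)) \<le> \<gamma> * 1"
            using g a0 quad_nonneg[of "y - y0"] by (intro mult_left_mono) auto
          then show ?thesis using base True by fastforce
        next
          case False
          then show ?thesis using outside[OF 0 False, of 0 m] by simp
        qed
      next
        case (Suc n)
        show ?case
        proof (cases "y \<in> orthant_box y0 1")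
          case True
          have dr: "(\<integral>y'. quad (y' - y0) \<partial>Q h y) \<le> quad (y - y0) + C * (1 + K) * h"
            "step_prob h y (large_increments \<eta>) \<le> C * (1 + K) * h"
            using elim(1) K y0 hK True unfolding one_step_bounds_def by blast+
          have lower: "0 * indicator {} (y' - y) + \<gamma> * (1 - a * quad (y' - y0) - b * (1 + K) * (real n * h)) - \<gamma> * indicator (- E) (y' - y)
              \<le> indicator E (y' - y) * chain_prob h E G (n + m) (True \<or> y' - y \<in> G) y'"
            if "y' \<in> nonneg_orthant" for y'
          proof (cases "y' - y \<in> E")
            case True
            then show ?thesis using Suc.IH[OF that] by simp
          next
            case False
            have "0 \<le> a * quad (y' - y0)" using a0 quad_nonneg[of "y' - y0"] by simp
            then have "\<gamma> * (1 - a * quad (y' - y0) - b * (1 + K) * (real n * h)) \<le> \<gamma> * 1"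
              using g err[of n] by (intro mult_left_mono) linarith
            then show ?thesis using False by simp
          qed
          have "0 * step_prob h y {} +
            \<gamma> * (1 - a * quad (y - y0) - b * (1 + K) * (real n * h) - (a * (C * (1 + K) * h) + C * (1 + K) * h))
            \<le> (\<integral>y'. indicator E (y' - y) * chain_prob h E G (n + m) (True \<or> y' - y \<in> G) y' \<partial>Q h y)"
            by (rule integral_lower_step[OF h0 Suc.prems _ _ E a0 g order_refl err
                  integrable_chain_step[OF h0 EG Suc.prems] lower dr]) auto
          moreover have "1 - a * quad (y - y0) - b * (1 + K) * (real n * h) - (a * (C * (1 + K) * h) + C * (1 + K) * h)
              = 1 - a * quad (y - y0) - b * (1 + K) * (real (Suc n) * h)"
            by (simp add: b_def algebra_simps)
          ultimately show ?thesis by (simp only: chain_prob.simps add_Suc mult_zero_left add_0)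
        next
          case False
          show ?thesis by (rule outside[OF Suc.prems False])
        qed
      qed
    qed
  qed
  then show ?thesis using b C by blast
qed

definition survival_bound :: "real \<Rightarrow> real \<Rightarrow> real \<Rightarrow> real \<Rightarrow> real \<Rightarrow> bool" where
  "survival_bound \<eta> \<gamma> T R h \<longleftrightarrow> (\<forall>E\<in>sets borel. \<forall>G\<in>sets borel. - E \<subseteq> large_increments \<eta> \<longrightarrow>
    (\<forall>n. real n * h \<le> T \<longrightarrow> (\<forall>y\<in>orthant_ball R. \<gamma> \<le> chain_prob h E G n True y)))"

text \<open>Starting in the ball of radius \<open>j * CARD('d)\<close>, the process stays in the next ball for a time of order
  \<open>1 / (j + 1)\<close>.  These times have a divergent sum, so every time horizon is covered by finitely many
  stages.\<close>

lemma survive_levels: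
  assumes "0 < \<eta>"
  shows "\<exists>c>0. \<forall>J j. \<exists>\<gamma>>0. \<forall>\<^sub>F h in at_right 0. survival_bound \<eta> \<gamma> (c * (\<Sum>i<J. 1 / (real j + real i + 1))) (real j * real CARD('d)) h"
proof -
  let ?d = "real CARD('d)"
  obtain b D where b: "0 < b" "0 < D" and ev: "\<forall>\<^sub>F h in at_right 0. survival_step \<eta> b D h"
    using survive_local[OF assms] by blast
  \<comment> \<open>A stage of length \<open>c / (j + 1)\<close> loses at most a quarter; rounding to the grid costs another quarter.\<close>
  define c where "c = 1 / (4 * b * (1 + ?d))"
  have c: "0 < c" using b by (simp add: c_def)
  have ev0: "\<forall>\<^sub>F h in at_right 0. (0::real) < h" by (simp add: eventually_at_right_less)
  have "\<exists>\<gamma>>0. \<forall>\<^sub>F h in at_right 0. survival_bound \<eta> \<gamma> (c * (\<Sum>i<J. 1 / (real j + real i + 1))) (real j * ?d) h" for J j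
  proof (induction J arbitrary: j)
    case 0
    have "\<forall>\<^sub>F h in at_right 0. survival_bound \<eta> 1 (c * (\<Sum>i<(0::nat). 1 / (real j + real i + 1))) (real j * ?d) h"
      using ev0
    proof eventually_elim
      case (elim h)
      show ?case unfolding survival_bound_def
      proof (intro ballI impI allI)
        fix E G :: "(real ^ 'd) set" and n :: nat and y :: "real ^ 'd"
        assume "real n * h \<le> c * (\<Sum>i<(0::nat). 1 / (real j + real i + 1))"
        then have "n = 0" using elim by (simp add: mult_le_0_iff)
        then show "1 \<le> chain_prob h E G n True y" by simp
      qed
    qed
    then show ?case by (intro exI[of _ 1]) simp
  next
    case (Suc J)
    obtain g where g: "0 < g" and IH: "\<forall>\<^sub>F h in at_right 0. survival_bound \<eta> g (c * (\<Sum>i<J. 1 / (real (Suc j) + real i + 1))) (real (Suc j) * ?d) h"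
      using Suc.IH[of "Suc j"] by (elim exE conjE)
    define K where "K = real j * ?d"
    have K: "0 \<le> K" by (simp add: K_def)
    define hj where "hj = c / (real j + 1)"
    have hj: "0 < hj" using c by (simp add: hj_def)
    have bK: "b * (1 + K) * hj \<le> 1 / 4"
    proof -
      have "1 + K \<le> (1 + ?d) * (real j + 1)" by (simp add: K_def algebra_simps)
      then have "b * (1 + K) * hj \<le> b * ((1 + ?d) * (real j + 1)) * hj"
        using b hj by (intro mult_right_mono mult_left_mono) auto
      also have "\<dots> = (b * (1 + ?d)) * ((real j + 1) * hj)" by (simp only: mult.assoc)
      also have "(real j + 1) * hj = c" by (simp add: hj_def)
      also have "(b * (1 + ?d)) * c = 1 / 4"
      proof -
        have "b * (1 + ?d) \<noteq> 0" using b by (simp add: add_eq_0_iff)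
        then show ?thesis by (simp add: c_def mult.assoc)
      qed
      finally show ?thesis .
    qed
    define \<delta> where "\<delta> = min (D / (1 + K)) (1 / (4 * (b * (1 + K))))"
    have "0 < \<delta>" using b K by (simp add: \<delta>_def)
    then have "\<forall>\<^sub>F h in at_right 0. h < \<delta>" by (rule order_tendstoD(2)[OF tendsto_ident_at])
    with ev IH ev0 have "\<forall>\<^sub>F h in at_right 0. survival_bound \<eta> (g / 2) (c * (\<Sum>i<Suc J. 1 / (real j + real i + 1))) (real j * ?d) h"
    proof eventually_elim
      case (elim h)
      show ?case unfolding survival_bound_def
      proof (intro ballI allI impI)
        fix E G :: "(real ^ 'd) set" and n :: nat and y :: "real ^ 'd"
        assume EG: "E \<in> sets borel" "G \<in> sets borel" and E: "- E \<subseteq> large_increments \<eta>"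
          and n: "real n * h \<le> c * (\<Sum>i<Suc J. 1 / (real j + real i + 1))"
          and y: "y \<in> orthant_ball (real j * ?d)"
        have yK: "mass y \<le> K" and yo: "y \<in> nonneg_orthant" using y by (auto simp: orthant_ball_def K_def)
        have h: "0 < h" "h * (1 + K) \<le> D" "b * (1 + K) * h \<le> 1 / 4"
        proof -
          show "0 < h" by fact
          have d: "h < D / (1 + K)" "h < 1 / (4 * (b * (1 + K)))" using elim(4) by (auto simp: \<delta>_def)
          have "0 < 1 + K" "0 < 4 * (b * (1 + K))" using K b by auto
          then have "h * (1 + K) < D" "h * (4 * (b * (1 + K))) < 1"
            using d by (simp_all only: pos_less_divide_eq)
          then show "h * (1 + K) \<le> D" "b * (1 + K) * h \<le> 1 / 4" by (simp_all add: mult.commute)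
        qed
        define q where "q = nat \<lceil>hj / h\<rceil>"
        have q: "hj \<le> real q * h" "real q * h \<le> hj + h"
        proof -
          have "0 < hj / h" using hj h by simp
          then have "real q = of_int \<lceil>hj / h\<rceil>" by (simp add: q_def)
          then have "hj / h \<le> real q" "real q \<le> hj / h + 1" using ceiling_correct[of "hj / h"] by linarith+
          then show "hj \<le> real q * h" "real q * h \<le> hj + h" using h(1) by (auto simp: field_simps)
        qed
        define n1 where "n1 = min n q"
        define m where "m = n - n1"
        have nm: "n = n1 + m" by (simp add: m_def n1_def)
        have "real n1 * h \<le> real q * h" using h(1) by (intro mult_right_mono) (auto simp: n1_def)
        then have "b * (1 + K) * (real n1 * h) \<le> b * (1 + K) * (hj + h)"
          using q b K by (intro mult_left_mono) auto
        then have n1b: "b * (1 + K) * (real n1 * h) \<le> 1 / 2" using bK h(3) by (simp add: distrib_left)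
        have S: "(\<Sum>i<Suc J. 1 / (real j + real i + 1)) = 1 / (real j + 1) + (\<Sum>i<J. 1 / (real (Suc j) + real i + 1))"
          by (subst sum.lessThan_Suc_shift) (simp add: add.commute add.left_commute)
        have S0: "0 \<le> c * (\<Sum>i<J. 1 / (real (Suc j) + real i + 1))"
          using c by (intro mult_nonneg_nonneg sum_nonneg) auto
        have mh: "real m * h \<le> c * (\<Sum>i<J. 1 / (real (Suc j) + real i + 1))"
        proof (cases "n \<le> q")
          case True
          then show ?thesis using S0 by (simp add: m_def n1_def)
        next
          case False
          then have "real m * h = real n * h - real q * h" by (simp add: m_def n1_def of_nat_diff left_diff_distrib)
          also have "\<dots> \<le> c * (1 / (real j + 1) + (\<Sum>i<J. 1 / (real (Suc j) + real i + 1))) - hj"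
            using n q unfolding S by linarith
          finally show ?thesis by (simp add: hj_def distrib_left)
        qed
        have base: "\<forall>y'\<in>orthant_box y 1. g \<le> chain_prob h E G m True y'"
        proof
          fix y' assume y': "y' \<in> orthant_box y 1"
          then have "mass y' \<le> K + ?d" by (rule mass_orthant_box[OF _ _ yK]) simp
          then have "y' \<in> orthant_ball (real (Suc j) * ?d)"
            using y' by (simp add: orthant_ball_def orthant_box_def K_def algebra_simps)
          then show "g \<le> chain_prob h E G m True y'" using elim(2) EG E mh unfolding survival_bound_def by blast
        qed
        have "g * (1 - box_weight 1 * quad (y - y) - b * (1 + K) * (real n1 * h)) \<le> chain_prob h E G (n1 + m) True y"
          using elim(1) K yK h(2) EG E less_imp_le[OF g] base yo unfolding survival_step_def by blast
        moreover have "g * (1 / 2) \<le> g * (1 - b * (1 + K) * (real n1 * h))"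
          using n1b g by (intro mult_left_mono) auto
        ultimately show "g / 2 \<le> chain_prob h E G n True y" unfolding nm by simp
      qed
    qed
    then show ?case using g by (intro exI[of _ "g / 2"]) auto
  qed
  then show ?thesis using c by blast
qed

lemma survive:
  assumes "0 < \<eta>"
  shows "\<exists>\<gamma>>0. \<forall>\<^sub>F h in at_right 0. survival_bound \<eta> \<gamma> L K h"
proof -
  obtain c where c: "0 < c" and lev: "\<forall>J j. \<exists>\<gamma>>0. \<forall>\<^sub>F h in at_right 0. survival_bound \<eta> \<gamma> (c * (\<Sum>i<J. 1 / (real j + real i + 1))) (real j * real CARD('d)) h"
    using survive_levels[OF assms] by (elim exE conjE)
  obtain j where "K \<le> real j" using real_arch_simple by blast
  moreover have "real j * 1 \<le> real j * real CARD('d)"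
    using zero_less_card_finite[where 'a = 'd] by (intro mult_left_mono) linarith+
  ultimately have j: "orthant_ball K \<subseteq> (orthant_ball (real j * real CARD('d)) :: (real ^ 'd) set)"
    by (auto simp: orthant_ball_def)
  obtain J where "L / c \<le> (\<Sum>i<J. 1 / (real j + real i + 1))" using harmonic_tail_unbounded by blast
  then have J: "L \<le> c * (\<Sum>i<J. 1 / (real j + real i + 1))" using c by (simp add: field_simps)
  obtain g where g: "0 < g" and ev: "\<forall>\<^sub>F h in at_right 0. survival_bound \<eta> g (c * (\<Sum>i<J. 1 / (real j + real i + 1))) (real j * real CARD('d)) h"
    using spec[OF spec[OF lev, of J], of j] by (elim exE conjE)
  from ev have "\<forall>\<^sub>F h in at_right 0. survival_bound \<eta> g L K h"
  proof eventually_elim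
    case (elim h)
    show ?case unfolding survival_bound_def
    proof (intro ballI impI allI)
      fix E G :: "(real ^ 'd) set" and n :: nat and y :: "real ^ 'd"
      assume EG: "E \<in> sets borel" "G \<in> sets borel" "- E \<subseteq> large_increments \<eta>"
        and n: "real n * h \<le> L" and y: "y \<in> orthant_ball K"
      have "real n * h \<le> c * (\<Sum>i<J. 1 / (real j + real i + 1))" using J n by linarith
      then show "g \<le> chain_prob h E G n True y" by (intro elim[unfolded survival_bound_def, rule_format] EG subsetD[OF j y])
    qed
  qed
  then show ?thesis using g by blast
qed

definition hit_step :: "real \<Rightarrow> real \<Rightarrow> real \<Rightarrow> real \<Rightarrow> real \<Rightarrow> bool" where
  "hit_step \<eta> r b D h \<longleftrightarrow> (\<forall>K\<ge>0. \<forall>y0. mass y0 \<le> K \<longrightarrow> h * (1 + K) \<le> D \<longrightarrow>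
    (\<forall>E\<in>sets borel. \<forall>G\<in>sets borel. - E \<union> G \<subseteq> large_increments \<eta> \<longrightarrow>
      (\<forall>\<gamma>\<ge>0. \<forall>\<kappa>\<ge>0. \<forall>n j.
        (\<forall>y\<in>orthant_box y0 r. \<kappa> * h \<le> step_prob h y (E \<inter> G)) \<longrightarrow>
        (\<forall>m\<le>n + j. \<forall>y\<in>orthant_box y0 r. \<forall>y'\<in>nonneg_orthant. y' - y \<in> E \<longrightarrow> \<gamma> \<le> chain_prob h E G m True y') \<longrightarrow>
        (\<forall>y\<in>nonneg_orthant.
           \<gamma> * \<kappa> * (real n * h) * (1 - box_weight r * quad (y - y0) - b * (1 + K) * (real n * h))
           \<le> chain_prob h E G (n + j) False y))))"

text \<open>The same induction with an additional gain: as long as the path has stayed in the box, each step has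
  probability at least \<open>\<kappa> * h\<close> of entering \<open>G\<close>, after which the path survives with probability at least
  \<open>\<gamma>\<close>.  The gains add up, while the losses are of second order in \<open>n * h\<close>.\<close>

lemma hit_local:
  assumes "0 < \<eta>" "0 < r" "r \<le> 1"
  shows "\<exists>b>0. \<exists>D>0. \<forall>\<^sub>F h in at_right 0. hit_step \<eta> r b D h"
proof -
  define a where "a = box_weight r"
  have a0: "0 \<le> a" by (simp add: a_def box_weight_def)
  obtain C D where C: "0 < C" "0 < D" and ev: "\<forall>\<^sub>F h in at_right 0. one_step_bounds \<eta> C D h"
    using local_step_constants[OF assms(1)] by blast
  define b where "b = (a + 1) * C"
  have b: "0 < b" using a0 C by (simp add: b_def)
  have "\<forall>\<^sub>F h in at_right 0. (0::real) < h" by (simp add: eventually_at_right_less)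
  with ev have "\<forall>\<^sub>F h in at_right 0. hit_step \<eta> r b D h"
  proof eventually_elim
    case (elim h)
    show ?case unfolding hit_step_def a_def[symmetric]
    proof (intro allI impI ballI)
      fix K \<gamma> \<kappa> :: real and y0 y :: "real ^ 'd" and E G :: "(real ^ 'd) set" and j n :: nat
      assume K: "0 \<le> K" and y0: "mass y0 \<le> K" and hK: "h * (1 + K) \<le> D"
        and EG[measurable]: "E \<in> sets borel" "G \<in> sets borel" and E: "- E \<union> G \<subseteq> large_increments \<eta>"
        and g: "0 \<le> \<gamma>" and k: "0 \<le> \<kappa>" and y: "y \<in> nonneg_orthant"
        and hit: "\<forall>y\<in>orthant_box y0 r. \<kappa> * h \<le> step_prob h y (E \<inter> G)"
        and base: "\<forall>m\<le>n + j. \<forall>y\<in>orthant_box y0 r. \<forall>y'\<in>nonneg_orthant. y' - y \<in> E \<longrightarrow> \<gamma> \<le> chain_prob h E G m True y'"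
      have h0: "0 \<le> h" using elim by simp
      note nonneg = chain_prob_nonneg[OF h0 EG]
      have err: "0 \<le> b * (1 + K) * (real n * h)" for n using b K h0 by simp
      have pre: "0 \<le> \<gamma> * \<kappa> * (real n * h)" for n using g k h0 by simp
      have aq: "0 \<le> a * quad z" for z :: "real ^ 'd" using a0 quad_nonneg[of z] by simp
      show "\<gamma> * \<kappa> * (real n * h) * (1 - a * quad (y - y0) - b * (1 + K) * (real n * h)) \<le> chain_prob h E G (n + j) False y"
        using y base
      proof (induction n arbitrary: y)
        case 0
        then show ?case using nonneg by simp
      next
        case (Suc n)
        show ?case
        proof (cases "y \<in> orthant_box y0 r")
          case True
          then have True1: "y \<in> orthant_box y0 1" using assms(3) by (auto simp: orthant_box_def intro: order_trans)
          have dr: "(\<integral>y'. quad (y' - y0) \<partial>Q h y) \<le> quad (y - y0) + C * (1 + K) * h"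
            "step_prob h y (large_increments \<eta>) \<le> C * (1 + K) * h"
            using elim(1) K y0 hK True1 unfolding one_step_bounds_def by blast+
          let ?k = "\<gamma> * \<kappa> * (real n * h)"
          have lower: "\<gamma> * indicator (E \<inter> G) (y' - y) + ?k * (1 - a * quad (y' - y0) - b * (1 + K) * (real n * h))
                - ?k * indicator (- E \<union> G) (y' - y)
              \<le> indicator E (y' - y) * chain_prob h E G (n + j) (False \<or> y' - y \<in> G) y'"
            if y': "y' \<in> nonneg_orthant" for y'
          proof -
            have le: "?k * (1 - a * quad (y' - y0) - b * (1 + K) * (real n * h)) \<le> ?k * 1"
              using pre[of n] err[of n] aq[of "y' - y0"] by (intro mult_left_mono) linarith+
            consider "y' - y \<in> E" "y' - y \<in> G" | "y' - y \<in> E" "y' - y \<notin> G" | "y' - y \<notin> E" by blast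
            then show ?thesis
            proof cases
              case 1
              then have "\<gamma> \<le> chain_prob h E G (n + j) True y'" using Suc.prems(2) True y' by auto
              then show ?thesis using 1 le by simp
            next
              case 2
              have "?k * (1 - a * quad (y' - y0) - b * (1 + K) * (real n * h)) \<le> chain_prob h E G (n + j) False y'"
                using Suc.IH[OF y'] Suc.prems(2) by auto
              then show ?thesis using 2 by simp
            next
              case 3
              then show ?thesis using le by simp
            qed
          qed
          let ?X = "1 - a * quad (y - y0) - b * (1 + K) * (real (Suc n) * h)"
          have "1 - a * quad (y - y0) - b * (1 + K) * (real n * h) - (a * (C * (1 + K) * h) + C * (1 + K) * h) = ?X"
            by (simp add: b_def algebra_simps)
          moreover have "\<gamma> * step_prob h y (E \<inter> G) +
            ?k * (1 - a * quad (y - y0) - b * (1 + K) * (real n * h) - (a * (C * (1 + K) * h) + C * (1 + K) * h))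
            \<le> (\<integral>y'. indicator E (y' - y) * chain_prob h E G (n + j) (False \<or> y' - y \<in> G) y' \<partial>Q h y)"
            by (rule integral_lower_step[OF h0 Suc.prems(1) _ _ E a0 pre g err
                  integrable_chain_step[OF h0 EG Suc.prems(1)] lower dr]) auto
          ultimately have "\<gamma> * step_prob h y (E \<inter> G) + ?k * ?X
            \<le> (\<integral>y'. indicator E (y' - y) * chain_prob h E G (n + j) (False \<or> y' - y \<in> G) y' \<partial>Q h y)"
            by (simp only:)
          moreover have "\<gamma> * (\<kappa> * h) \<le> \<gamma> * step_prob h y (E \<inter> G)"
            using hit True g by (intro mult_left_mono) auto
          moreover have "\<gamma> * (\<kappa> * h) * ?X \<le> \<gamma> * (\<kappa> * h) * 1"
            using g k h0 err[of "Suc n"] aq[of "y - y0"] by (intro mult_left_mono) (linarith, simp)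
          moreover have "\<gamma> * \<kappa> * (real (Suc n) * h) * ?X = \<gamma> * (\<kappa> * h) * ?X + ?k * ?X"
          proof -
            have "\<gamma> * \<kappa> * (real (Suc n) * h) = \<gamma> * (\<kappa> * h) + ?k" by (simp add: algebra_simps)
            then show ?thesis by (simp only: distrib_right)
          qed
          moreover have "chain_prob h E G (Suc n + j) False y =
              (\<integral>y'. indicator E (y' - y) * chain_prob h E G (n + j) (False \<or> y' - y \<in> G) y' \<partial>Q h y)"
            by (simp only: chain_prob.simps add_Suc)
          ultimately show ?thesis by linarith
        next
          case False
          have "1 - a * quad (y - y0) - b * (1 + K) * (real (Suc n) * h) \<le> 0"
            using outside_box[OF assms(2) Suc.prems(1) False, folded a_def] err[of "Suc n"] by linarith
          then have "\<gamma> * \<kappa> * (real (Suc n) * h) * (1 - a * quad (y - y0) - b * (1 + K) * (real (Suc n) * h)) \<le> 0"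
            using pre[of "Suc n"] by (intro mult_nonneg_nonpos)
          also have "\<dots> \<le> chain_prob h E G (Suc n + j) False y" by (rule nonneg)
          finally show ?thesis .
        qed
      qed
    qed
  qed
  then show ?thesis using b C by blast
qed

end

section \<open>The Markov property along a grid\<close>

locale cbi_path = cbi_kernel c \<beta> B \<nu> \<mu> v Q
  for c \<beta> :: "real ^ 'd" and B :: "real ^ 'd ^ 'd"
    and \<nu> :: "(real ^ 'd) measure" and \<mu> :: "'d \<Rightarrow> (real ^ 'd) measure"
    and v :: "real \<Rightarrow> real ^ 'd \<Rightarrow> real ^ 'd"
    and Q :: "real \<Rightarrow> real ^ 'd \<Rightarrow> (real ^ 'd) measure" +
  fixes M :: "'w measure" and X :: "real \<Rightarrow> 'w \<Rightarrow> real ^ 'd" and x :: "real ^ 'd"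
  assumes process: "markov_process_from M orthant_space Q X x"
    and cadlag_paths: "\<And>\<omega>. \<omega> \<in> space M \<Longrightarrow> cadlag (\<lambda>t. X t \<omega>)"
    and start_nonneg: "x \<in> nonneg_orthant"

sublocale cbi_path \<subseteq> prob_space M
  using process by (simp add: markov_process_from_def)

context cbi_path
begin

abbreviation "history \<equiv> past M orthant_space X"

lemma X_measurable: "0 \<le> t \<Longrightarrow> X t \<in> M \<rightarrow>\<^sub>M orthant_space"
  using process by (simp add: markov_process_from_def)

lemma X_nonneg: "0 \<le> t \<Longrightarrow> \<omega> \<in> space M \<Longrightarrow> X t \<omega> \<in> nonneg_orthant"
  using measurable_space[OF X_measurable, of t \<omega>] by simp

lemma X_borel: "0 \<le> t \<Longrightarrow> X t \<in> borel_measurable M"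
  using measurable_compose[OF X_measurable measurable_orthant_ident] by simp

lemma past_generator: "(\<Union>u\<in>{0..s}. {X u -` A \<inter> space M |A. A \<in> sets orthant_space}) \<subseteq> Pow (space M)"
  by auto

lemma space_history [simp]: "space (history s) = space M"
  unfolding past_def by (rule space_measure_of[OF past_generator])

lemma sets_history: "sets (history s) =
    sigma_sets (space M) (\<Union>u\<in>{0..s}. {X u -` A \<inter> space M |A. A \<in> sets orthant_space})"
  unfolding past_def by (rule sets_measure_of[OF past_generator])

lemma subalgebra_history: "subalgebra M (history s)"
  unfolding subalgebra_def
proof
  show "sets (history s) \<subseteq> sets M" unfolding sets_history
    using X_measurable by (intro sets.sigma_sets_subset) (auto intro: measurable_sets)
qed simp

lemma history_sets: "G \<in> sets (history s) \<Longrightarrow> G \<in> sets M"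
  using subalgebra_history[of s] by (auto simp: subalgebra_def)

lemma history_mono: "s \<le> s' \<Longrightarrow> G \<in> sets (history s) \<Longrightarrow> G \<in> sets (history s')"
  unfolding sets_history by (rule subsetD[OF sigma_sets_mono'[OF UN_mono]]) auto

lemma X_history_measurable:
  assumes "0 \<le> u" "u \<le> s"
  shows "X u \<in> history s \<rightarrow>\<^sub>M orthant_space"
proof (rule measurableI)
  fix \<omega> assume "\<omega> \<in> space (history s)"
  then show "X u \<omega> \<in> space orthant_space" using X_nonneg[OF assms(1)] by simp
next
  fix A assume "A \<in> sets (orthant_space :: (real ^ 'd) measure)"
  then show "X u -` A \<inter> space (history s) \<in> sets (history s)"
    unfolding sets_history space_history using assms by (intro sigma_sets.Basic UN_I[of u]) auto
qed

lemma increment_history: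
  assumes "0 \<le> u" "u \<le> u'" "u' \<le> s" "G \<in> sets (history s)" "A \<in> sets borel"
  shows "{\<omega> \<in> G. X u' \<omega> - X u \<omega> \<in> A} \<in> sets (history s)"
proof -
  have "(\<lambda>\<omega>. X u' \<omega> - X u \<omega>) \<in> borel_measurable (history s)"
    using assms
    by (intro borel_measurable_diff measurable_compose[OF X_history_measurable measurable_orthant_ident]) auto
  from measurable_sets[OF this assms(5)]
  have "G \<inter> ((\<lambda>\<omega>. X u' \<omega> - X u \<omega>) -` A \<inter> space (history s)) \<in> sets (history s)"
    using assms(4) by (rule sets.Int[rotated])
  moreover have "G \<inter> ((\<lambda>\<omega>. X u' \<omega> - X u \<omega>) -` A \<inter> space (history s)) = {\<omega> \<in> G. X u' \<omega> - X u \<omega> \<in> A}"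
    using sets.sets_into_space[OF assms(4)] by auto
  ultimately show ?thesis by simp
qed

lemma markov_rectangle:
  assumes "0 \<le> s" "0 \<le> t" and G: "G \<in> sets (history s)" and A: "A \<in> sets orthant_space"
  shows "emeasure M (G \<inter> (X (s + t) -` A \<inter> space M)) = (\<integral>\<^sup>+ \<omega>. indicator G \<omega> * emeasure (Q t (X s \<omega>)) A \<partial>M)"
proof -
  interpret finite_measure_subalgebra M "history s"
    by unfold_locales (rule subalgebra_history)
  let ?f = "\<lambda>\<omega>. indicat_real A (X (s + t) \<omega>)"
  have G': "G \<in> sets M" using G by (rule history_sets)
  have fm: "?f \<in> borel_measurable M"
    using A assms by (intro measurable_compose[OF X_measurable borel_measurable_indicator]) auto
  then have fi: "integrable M ?f" by (rule integrable_const_bound[of _ 1, rotated]) (auto simp: indicator_def)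
  have mA: "(\<lambda>y. measure (Q t y) A) \<in> borel_measurable orthant_space"
    by (rule measurable_compose[OF Q_measurable[OF assms(2)] measurable_measure_prob_algebra[OF A]])
  have qm: "(\<lambda>\<omega>. measure (Q t (X s \<omega>)) A) \<in> borel_measurable M"
    using measurable_compose[OF X_measurable[OF assms(1)] mA] .
  have q1: "measure (Q t (X s \<omega>)) A \<le> 1" if "\<omega> \<in> space M" for \<omega>
    using prob_space.prob_le_1[OF prob_space_Q[OF assms(2) X_nonneg[OF assms(1) that]]] .
  have qi: "integrable M (\<lambda>\<omega>. indicator G \<omega> * measure (Q t (X s \<omega>)) A)"
    using q1 G' qm by (intro integrable_const_bound[of _ 1]) (auto simp: indicator_def)
  have ae: "AE \<omega> in M. real_cond_exp M (history s) ?f \<omega> = measure (Q t (X s \<omega>)) A"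
    using process A assms unfolding markov_process_from_def by blast
  have "measure M (G \<inter> (X (s + t) -` A \<inter> space M)) = (\<integral>\<omega>. indicat_real (G \<inter> (X (s + t) -` A \<inter> space M)) \<omega> \<partial>M)"
    using G' A assms measurable_sets[OF X_measurable A, of "s + t"] by simp
  also have "\<dots> = (\<integral>\<omega>\<in>G. ?f \<omega> \<partial>M)"
    unfolding set_lebesgue_integral_def
    by (intro Bochner_Integration.integral_cong) (auto simp: indicator_def)
  also have "\<dots> = (\<integral>\<omega>\<in>G. real_cond_exp M (history s) ?f \<omega> \<partial>M)"
    by (rule real_cond_exp_intA[OF fi G])
  also have "\<dots> = (\<integral>\<omega>. indicator G \<omega> * measure (Q t (X s \<omega>)) A \<partial>M)"
    unfolding set_lebesgue_integral_def using ae G' qm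
    by (intro integral_cong_AE) (auto intro!: borel_measurable_times)
  finally have "emeasure M (G \<inter> (X (s + t) -` A \<inter> space M)) =
      ennreal (\<integral>\<omega>. indicator G \<omega> * measure (Q t (X s \<omega>)) A \<partial>M)"
    by (simp add: emeasure_eq_measure)
  also have "\<dots> = (\<integral>\<^sup>+ \<omega>. ennreal (indicator G \<omega> * measure (Q t (X s \<omega>)) A) \<partial>M)"
    by (rule nn_integral_eq_integral[symmetric, OF qi]) auto
  also have "\<dots> = (\<integral>\<^sup>+ \<omega>. indicator G \<omega> * emeasure (Q t (X s \<omega>)) A \<partial>M)"
  proof (rule nn_integral_cong)
    fix \<omega> assume w: "\<omega> \<in> space M"
    interpret q: prob_space "Q t (X s \<omega>)" by (rule prob_space_Q[OF assms(2) X_nonneg[OF assms(1) w]])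
    show "ennreal (indicator G \<omega> * measure (Q t (X s \<omega>)) A) = indicator G \<omega> * emeasure (Q t (X s \<omega>)) A"
      by (auto simp: indicator_def q.emeasure_eq_measure)
  qed
  finally show ?thesis .
qed

text \<open>The conditional law of a single later state determines that of a pair of consecutive states,
  since measures on a product are determined by rectangles.\<close>

lemma markov_pair:
  assumes s: "0 \<le> s" "0 \<le> t" and G: "G \<in> sets (history s)"
    and f: "f \<in> borel_measurable (orthant_space \<Otimes>\<^sub>M orthant_space)"
  shows "(\<integral>\<^sup>+ \<omega>. indicator G \<omega> * f (X s \<omega>, X (s + t) \<omega>) \<partial>M) =
    (\<integral>\<^sup>+ \<omega>. indicator G \<omega> * (\<integral>\<^sup>+ y'. f (X s \<omega>, y') \<partial>Q t (X s \<omega>)) \<partial>M)"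
proof -
  let ?S = "orthant_space :: (real ^ 'd) measure"
  let ?P = "?S \<Otimes>\<^sub>M ?S"
  define K where "K y = Q t y \<bind> (\<lambda>y'. return ?P (y, y'))" for y
  define N where "N = density M (indicator G)"
  have G': "G \<in> sets M" using G by (rule history_sets)
  have QS: "Q t \<in> ?S \<rightarrow>\<^sub>M subprob_algebra ?S"
    by (rule measurable_prob_algebraD[OF Q_measurable[OF s(2)]])
  have K: "K \<in> ?S \<rightarrow>\<^sub>M subprob_algebra ?P"
    unfolding K_def[abs_def] using QS by measurable
  have Kint: "(\<integral>\<^sup>+ p. g p \<partial>K y) = (\<integral>\<^sup>+ y'. g (y, y') \<partial>Q t y)"
    if g: "g \<in> borel_measurable ?P" and y: "y \<in> nonneg_orthant" for g y
  proof -
    have r: "(\<lambda>y'. return ?P (y, y')) \<in> Q t y \<rightarrow>\<^sub>M subprob_algebra ?P"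
      using y sets_Q[OF s(2) y]
      by (intro measurable_compose[OF _ return_measurable]) (simp cong: measurable_cong_sets)
    have "(\<integral>\<^sup>+ p. g p \<partial>K y) = (\<integral>\<^sup>+ y'. \<integral>\<^sup>+ p. g p \<partial>return ?P (y, y') \<partial>Q t y)"
      unfolding K_def by (rule nn_integral_bind[OF g r])
    also have "\<dots> = (\<integral>\<^sup>+ y'. g (y, y') \<partial>Q t y)"
      using y space_Q[OF s(2) y] by (intro nn_integral_cong nn_integral_return g) (auto simp: space_pair_measure)
    finally show ?thesis .
  qed
  have XN: "X s \<in> N \<rightarrow>\<^sub>M ?S" "X (s + t) \<in> N \<rightarrow>\<^sub>M ?S"
    unfolding N_def using X_measurable s by auto
  have pN: "(\<lambda>\<omega>. (X s \<omega>, X (s + t) \<omega>)) \<in> N \<rightarrow>\<^sub>M ?P" using XN by measurable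
  define N1 where "N1 = distr N ?P (\<lambda>\<omega>. (X s \<omega>, X (s + t) \<omega>))"
  define N2 where "N2 = N \<bind> (\<lambda>\<omega>. K (X s \<omega>))"
  have KX: "(\<lambda>\<omega>. K (X s \<omega>)) \<in> N \<rightarrow>\<^sub>M subprob_algebra ?P"
    by (rule measurable_compose[OF XN(1) K])
  have spN: "space N \<noteq> {}" unfolding N_def using not_empty by simp
  have "N1 = N2"
  proof (rule measure_eqI_generator_eq[OF Int_stable_pair_measure_generator[of ?S ?S],
        where \<Omega> = "nonneg_orthant \<times> nonneg_orthant" and A = "\<lambda>_. nonneg_orthant \<times> nonneg_orthant"])
    show "{a \<times> b |a b. a \<in> sets ?S \<and> b \<in> sets ?S} \<subseteq> Pow (nonneg_orthant \<times> nonneg_orthant)"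
      using sets.sets_into_space[where M = ?S] by auto
    show "sets N1 = sigma_sets (nonneg_orthant \<times> nonneg_orthant) {a \<times> b |a b. a \<in> sets ?S \<and> b \<in> sets ?S}"
      unfolding N1_def using sets_pair_measure[of ?S ?S] by simp
    show "sets N2 = sigma_sets (nonneg_orthant \<times> nonneg_orthant) {a \<times> b |a b. a \<in> sets ?S \<and> b \<in> sets ?S}"
    proof -
      have "sets N2 = sets ?P" unfolding N2_def
        using sets_kernel[OF KX] spN by (intro sets_bind) auto
      then show ?thesis using sets_pair_measure[of ?S ?S] by simp
    qed
    show "range (\<lambda>_ :: nat. nonneg_orthant \<times> nonneg_orthant) \<subseteq> {a \<times> b |a b. a \<in> sets ?S \<and> b \<in> sets ?S}"
      using sets.top[of ?S] by auto
    show "emeasure N1 (nonneg_orthant \<times> nonneg_orthant) \<noteq> \<infinity>" for i :: nat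
    proof -
      have "emeasure N1 (nonneg_orthant \<times> nonneg_orthant) \<le> emeasure N1 (space N1)"
        by (simp add: N1_def space_pair_measure)
      also have "\<dots> \<le> emeasure N (space N)" unfolding N1_def by (simp add: emeasure_distr pN emeasure_mono)
      also have "\<dots> = emeasure M G" using G' sets.sets_into_space[OF G']
        by (simp add: N_def emeasure_density)
      finally show ?thesis using emeasure_finite[of G] by (auto simp: top_unique)
    qed
    fix R assume "R \<in> {a \<times> b |a b. a \<in> sets ?S \<and> b \<in> sets ?S}"
    then obtain A1 A2 where R: "R = A1 \<times> A2" and A: "A1 \<in> sets ?S" "A2 \<in> sets ?S" by auto
    have RP: "R \<in> sets ?P" unfolding R using A by simp
    let ?G = "G \<inter> (X s -` A1 \<inter> space M)"
    have G1: "?G \<in> sets (history s)"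
      using measurable_sets[OF X_history_measurable[OF s(1) order_refl] A(1)] G by auto
    have "emeasure N1 R = emeasure N ((\<lambda>\<omega>. (X s \<omega>, X (s + t) \<omega>)) -` R \<inter> space N)"
      unfolding N1_def by (rule emeasure_distr[OF pN RP])
    also have "\<dots> = (\<integral>\<^sup>+ \<omega>. indicator G \<omega> * indicator ((\<lambda>\<omega>. (X s \<omega>, X (s + t) \<omega>)) -` R \<inter> space M) \<omega> \<partial>M)"
    proof -
      have "(\<lambda>\<omega>. (X s \<omega>, X (s + t) \<omega>)) -` R \<inter> space M \<in> sets M"
        using measurable_sets[OF pN RP] by (simp add: N_def)
      then show ?thesis unfolding N_def space_density using G' by (intro emeasure_density) auto
    qed
    also have "\<dots> = (\<integral>\<^sup>+ \<omega>. indicator (?G \<inter> (X (s + t) -` A2 \<inter> space M)) \<omega> \<partial>M)"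
      by (intro nn_integral_cong) (auto simp: R indicator_def)
    also have "\<dots> = emeasure M (?G \<inter> (X (s + t) -` A2 \<inter> space M))"
      using history_sets[OF G1] measurable_sets[OF X_measurable A(2), of "s + t"] s by simp
    also have "\<dots> = (\<integral>\<^sup>+ \<omega>. indicator ?G \<omega> * emeasure (Q t (X s \<omega>)) A2 \<partial>M)"
      by (rule markov_rectangle[OF s G1 A(2)])
    also have "\<dots> = (\<integral>\<^sup>+ \<omega>. indicator G \<omega> * (\<integral>\<^sup>+ p. indicator R p \<partial>K (X s \<omega>)) \<partial>M)"
    proof (rule nn_integral_cong)
      fix \<omega> assume w: "\<omega> \<in> space M"
      have y: "X s \<omega> \<in> nonneg_orthant" by (rule X_nonneg[OF s(1) w])
      have "(\<integral>\<^sup>+ p. indicator R p \<partial>K (X s \<omega>)) = (\<integral>\<^sup>+ y'. indicator R (X s \<omega>, y') \<partial>Q t (X s \<omega>))"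
        using RP by (intro Kint y) simp
      also have "\<dots> = (\<integral>\<^sup>+ y'. indicator A1 (X s \<omega>) * indicator A2 y' \<partial>Q t (X s \<omega>))"
        by (intro nn_integral_cong) (auto simp: R indicator_def)
      also have "\<dots> = indicator A1 (X s \<omega>) * emeasure (Q t (X s \<omega>)) A2"
        using A sets_Q[OF s(2) y] by (simp add: nn_integral_cmult)
      finally show "indicator ?G \<omega> * emeasure (Q t (X s \<omega>)) A2 = indicator G \<omega> * (\<integral>\<^sup>+ p. indicator R p \<partial>K (X s \<omega>))"
        using w by (auto simp: indicator_def)
    qed
    also have "\<dots> = (\<integral>\<^sup>+ \<omega>. indicator G \<omega> * emeasure (K (X s \<omega>)) R \<partial>M)"
    proof (rule nn_integral_cong)
      fix \<omega> assume "\<omega> \<in> space M"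
      then have "sets (K (X s \<omega>)) = sets ?P"
        using sets_kernel[OF K] X_nonneg[OF s(1)] by simp
      then show "indicator G \<omega> * (\<integral>\<^sup>+ p. indicator R p \<partial>K (X s \<omega>)) = indicator G \<omega> * emeasure (K (X s \<omega>)) R"
        using RP by simp
    qed
    also have "\<dots> = (\<integral>\<^sup>+ \<omega>. emeasure (K (X s \<omega>)) R \<partial>N)"
      unfolding N_def using G' KX RP
      by (intro nn_integral_density[symmetric] measurable_emeasure_kernel[OF _ RP]) (auto simp: N_def)
    also have "\<dots> = emeasure N2 R" unfolding N2_def by (rule emeasure_bind[symmetric, OF spN KX RP])
    finally show "emeasure N1 R = emeasure N2 R" .
  qed auto
  have "(\<integral>\<^sup>+ \<omega>. indicator G \<omega> * f (X s \<omega>, X (s + t) \<omega>) \<partial>M) = (\<integral>\<^sup>+ \<omega>. f (X s \<omega>, X (s + t) \<omega>) \<partial>N)"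
    unfolding N_def using measurable_compose[OF pN f] G'
    by (intro nn_integral_density[symmetric]) (auto simp: N_def)
  also have "\<dots> = (\<integral>\<^sup>+ p. f p \<partial>N1)" unfolding N1_def
    using pN f by (intro nn_integral_distr[symmetric]) auto
  also have "\<dots> = (\<integral>\<^sup>+ \<omega>. \<integral>\<^sup>+ p. f p \<partial>K (X s \<omega>) \<partial>N)"
    unfolding \<open>N1 = N2\<close> N2_def by (rule nn_integral_bind[OF f KX])
  also have "\<dots> = (\<integral>\<^sup>+ \<omega>. indicator G \<omega> * (\<integral>\<^sup>+ p. f p \<partial>K (X s \<omega>)) \<partial>M)"
    unfolding N_def using G' measurable_compose[OF KX nn_integral_measurable_subprob_algebra[OF f]]
    by (intro nn_integral_density) (auto simp: N_def)
  also have "\<dots> = (\<integral>\<^sup>+ \<omega>. indicator G \<omega> * (\<integral>\<^sup>+ y'. f (X s \<omega>, y') \<partial>Q t (X s \<omega>)) \<partial>M)"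
    by (intro nn_integral_cong) (simp add: Kint[OF f X_nonneg[OF s(1)]])
  finally show ?thesis .
qed

definition grid_increment :: "real \<Rightarrow> real \<Rightarrow> nat \<Rightarrow> 'w \<Rightarrow> real ^ 'd" where
  "grid_increment h s k \<omega> = X (s + real (Suc k) * h) \<omega> - X (s + real k * h) \<omega>"

definition grid_pattern :: "real \<Rightarrow> (real ^ 'd) set \<Rightarrow> (real ^ 'd) set \<Rightarrow> nat \<Rightarrow> bool \<Rightarrow> real \<Rightarrow> 'w \<Rightarrow> bool" where
  "grid_pattern h E G n b s \<omega> \<longleftrightarrow>
     (\<forall>k<n. grid_increment h s k \<omega> \<in> E) \<and> (b \<or> (\<exists>k<n. grid_increment h s k \<omega> \<in> G))"

lemma grid_increment_Suc: "grid_increment h s (Suc k) \<omega> = grid_increment h (s + h) k \<omega>"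
proof -
  have "s + real (Suc (Suc k)) * h = s + h + real (Suc k) * h" "s + real (Suc k) * h = s + h + real k * h"
    by (simp_all add: algebra_simps)
  then show ?thesis unfolding grid_increment_def by (simp only:)
qed

lemma grid_pattern_Suc:
  "grid_pattern h E G (Suc n) b s \<omega> \<longleftrightarrow>
    grid_increment h s 0 \<omega> \<in> E \<and> grid_pattern h E G n (b \<or> grid_increment h s 0 \<omega> \<in> G) (s + h) \<omega>"
  unfolding grid_pattern_def grid_increment_Suc[symmetric] All_less_Suc2 Ex_less_Suc2 by blast

lemma grid_increment_borel:
  assumes "0 \<le> h" "0 \<le> s"
  shows "grid_increment h s k \<in> borel_measurable M"
  unfolding grid_increment_def[abs_def] using assms by (intro borel_measurable_diff X_borel) auto

lemma grid_pattern_sets: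
  assumes "0 \<le> h" "0 \<le> s" and [measurable]: "E \<in> sets borel" "G \<in> sets borel" "A \<in> sets M"
  shows "{\<omega> \<in> A. grid_pattern h E G n b s \<omega>} \<in> sets M"
proof -
  note [measurable] = grid_increment_borel[OF assms(1,2)]
  have "{\<omega> \<in> space M. grid_pattern h E G n b s \<omega>} \<in> sets M" unfolding grid_pattern_def by measurable
  then have "A \<inter> {\<omega> \<in> space M. grid_pattern h E G n b s \<omega>} \<in> sets M" by measurable
  moreover have "A \<inter> {\<omega> \<in> space M. grid_pattern h E G n b s \<omega>} = {\<omega> \<in> A. grid_pattern h E G n b s \<omega>}"
    using sets.sets_into_space[OF assms(5)] by auto
  ultimately show ?thesis by simp
qed

text \<open>Conditioning on the first increment splits the event according to the flag; the two parts are events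
  of the past at the next grid point, so the induction hypothesis applies there.\<close>

lemma grid_pattern_prob:
  assumes "0 \<le> h" and [measurable]: "E \<in> sets borel" "G \<in> sets borel"
    and "0 \<le> s" "A \<in> sets (history s)"
  shows "emeasure M {\<omega> \<in> A. grid_pattern h E G n b s \<omega>} =
    (\<integral>\<^sup>+ \<omega>. indicator A \<omega> * ennreal (chain_prob h E G n b (X s \<omega>)) \<partial>M)"
  using assms(4,5)
proof (induction n arbitrary: b s A)
  case 0
  have "A \<in> sets M" using 0 by (intro history_sets)
  then show ?case by (simp add: grid_pattern_def)
next
  case (Suc n)
  note sA = Suc.prems
  have sh: "0 \<le> s + h" "s \<le> s + h" using sA assms(1) by auto
  let ?i = "grid_increment h s 0"
  have i: "?i \<omega> = X (s + h) \<omega> - X s \<omega>" for \<omega> by (simp add: grid_increment_def)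
  define A1 where "A1 = {\<omega> \<in> A. X (s + h) \<omega> - X s \<omega> \<in> E \<inter> G}"
  define A2 where "A2 = {\<omega> \<in> A. X (s + h) \<omega> - X s \<omega> \<in> E - G}"
  note inc = increment_history[OF sA(1) sh(2) order_refl history_mono[OF sh(2) sA(2)]]
  have A1: "A1 \<in> sets (history (s + h))"
    unfolding A1_def by (rule inc[OF sets.Int[OF assms(2,3)]])
  have A2: "A2 \<in> sets (history (s + h))"
    unfolding A2_def by (rule inc[OF sets.Diff[OF assms(2,3)]])
  have Am: "A \<in> sets M" using sA by (intro history_sets)
  have p: "chain_prob h E G n b \<in> borel_measurable orthant_space" for b
    using chain_prob_props[OF assms(1-3), of n b] by blast
  let ?f = "\<lambda>(y, y'). ennreal (indicator E (y' - y) * chain_prob h E G n (b \<or> y' - y \<in> G) y')"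
  have fm: "?f \<in> borel_measurable (orthant_space \<Otimes>\<^sub>M orthant_space)"
    using measurable_compose[OF chain_step_measurable[OF assms(2,3) p] measurable_ennreal]
    by (simp add: case_prod_beta')
  have "{\<omega> \<in> A. grid_pattern h E G (Suc n) b s \<omega>} =
      {\<omega> \<in> A1. grid_pattern h E G n True (s + h) \<omega>} \<union> {\<omega> \<in> A2. grid_pattern h E G n b (s + h) \<omega>}"
  proof (rule set_eqI)
    fix \<omega>
    show "\<omega> \<in> {\<omega> \<in> A. grid_pattern h E G (Suc n) b s \<omega>} \<longleftrightarrow>
        \<omega> \<in> {\<omega> \<in> A1. grid_pattern h E G n True (s + h) \<omega>} \<union> {\<omega> \<in> A2. grid_pattern h E G n b (s + h) \<omega>}"
      unfolding grid_pattern_Suc i A1_def A2_def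
      by (cases "X (s + h) \<omega> - X s \<omega> \<in> G") auto
  qed
  also have "emeasure M \<dots> = emeasure M {\<omega> \<in> A1. grid_pattern h E G n True (s + h) \<omega>}
      + emeasure M {\<omega> \<in> A2. grid_pattern h E G n b (s + h) \<omega>}"
    using history_sets[OF A1] history_sets[OF A2] sh(1) assms(1)
    by (intro plus_emeasure[symmetric] grid_pattern_sets assms) (auto simp: A1_def A2_def)
  also have "\<dots> = (\<integral>\<^sup>+ \<omega>. indicator A1 \<omega> * ennreal (chain_prob h E G n True (X (s + h) \<omega>)) \<partial>M)
      + (\<integral>\<^sup>+ \<omega>. indicator A2 \<omega> * ennreal (chain_prob h E G n b (X (s + h) \<omega>)) \<partial>M)"
    using Suc.IH[OF sh(1) A1] Suc.IH[OF sh(1) A2] by simp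
  also have "\<dots> = (\<integral>\<^sup>+ \<omega>. indicator A1 \<omega> * ennreal (chain_prob h E G n True (X (s + h) \<omega>))
      + indicator A2 \<omega> * ennreal (chain_prob h E G n b (X (s + h) \<omega>)) \<partial>M)"
  proof (rule nn_integral_add[symmetric])
    have "(\<lambda>\<omega>. ennreal (chain_prob h E G n b (X (s + h) \<omega>))) \<in> borel_measurable M" for b
      using measurable_compose[OF measurable_compose[OF X_measurable[OF sh(1)] p] measurable_ennreal] .
    then show "(\<lambda>\<omega>. indicator A1 \<omega> * ennreal (chain_prob h E G n True (X (s + h) \<omega>))) \<in> borel_measurable M"
      "(\<lambda>\<omega>. indicator A2 \<omega> * ennreal (chain_prob h E G n b (X (s + h) \<omega>))) \<in> borel_measurable M"
      using history_sets[OF A1] history_sets[OF A2] by auto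
  qed
  also have "\<dots> = (\<integral>\<^sup>+ \<omega>. indicator A \<omega> * ?f (X s \<omega>, X (s + h) \<omega>) \<partial>M)"
    by (intro nn_integral_cong) (auto simp: A1_def A2_def indicator_def)
  also have "\<dots> = (\<integral>\<^sup>+ \<omega>. indicator A \<omega> * (\<integral>\<^sup>+ y'. ?f (X s \<omega>, y') \<partial>Q h (X s \<omega>)) \<partial>M)"
    by (rule markov_pair[OF sA(1) assms(1) sA(2) fm])
  also have "\<dots> = (\<integral>\<^sup>+ \<omega>. indicator A \<omega> * ennreal (chain_prob h E G (Suc n) b (X s \<omega>)) \<partial>M)"
  proof (rule nn_integral_cong)
    fix \<omega> assume w: "\<omega> \<in> space M"
    have "(\<integral>\<^sup>+ y'. ?f (X s \<omega>, y') \<partial>Q h (X s \<omega>)) = ennreal (chain_prob h E G (Suc n) b (X s \<omega>))"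
      unfolding chain_prob.simps prod.case
      using chain_prob_nonneg[OF assms(1-3)]
      by (intro nn_integral_eq_integral integrable_chain_step assms X_nonneg sA(1) w) auto
    then show "indicator A \<omega> * (\<integral>\<^sup>+ y'. ?f (X s \<omega>, y') \<partial>Q h (X s \<omega>)) =
        indicator A \<omega> * ennreal (chain_prob h E G (Suc n) b (X s \<omega>))" by simp
  qed
  finally show ?case .
qed

end

section \<open>Rates of increments of prescribed size\<close>

definition ramp :: "real \<Rightarrow> real \<Rightarrow> real \<Rightarrow> real" where
  "ramp a b s = max 0 (min 1 ((s - a) / (b - a)))"

lemma ramp_bounds: "0 \<le> ramp a b s" "ramp a b s \<le> 1"
  by (auto simp: ramp_def)

lemma ramp_eq_0: "a < b \<Longrightarrow> s \<le> a \<Longrightarrow> ramp a b s = 0"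
  by (auto simp: ramp_def divide_nonpos_pos)

lemma ramp_eq_1: "a < b \<Longrightarrow> b \<le> s \<Longrightarrow> ramp a b s = 1"
  by (auto simp: ramp_def)

lemma continuous_on_ramp [continuous_intros]:
  "continuous_on A f \<Longrightarrow> continuous_on A (\<lambda>u. ramp a b (f u))"
  unfolding ramp_def divide_inverse by (intro continuous_intros)

text \<open>In the exponential chart this selects the increments that are large in coordinate \<open>i\<close> (where the
  chart is below \<open>q\<close>) and not too large in any coordinate (where the chart is above \<open>hi\<close>).\<close>

definition cutoff :: "'d \<Rightarrow> real \<Rightarrow> real \<Rightarrow> ('d \<Rightarrow> real) \<Rightarrow> ('d \<Rightarrow> real) \<Rightarrow> real ^ 'd \<Rightarrow> real" where
  "cutoff i p q lo hi u = ramp (- p) (- q) (- (u $ i)) * (\<Prod>j\<in>UNIV. ramp (lo j) (hi j) (u $ j))"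

lemma continuous_on_cutoff: "continuous_on A (cutoff i p q lo hi)"
  unfolding cutoff_def by (intro continuous_intros)

lemma cutoff_bounds: "0 \<le> cutoff i p q lo hi u" "cutoff i p q lo hi u \<le> 1"
proof -
  have "0 \<le> (\<Prod>j\<in>UNIV. ramp (lo j) (hi j) (u $ j))" "(\<Prod>j\<in>UNIV. ramp (lo j) (hi j) (u $ j)) \<le> 1"
    by (auto intro!: prod_nonneg prod_le_1 ramp_bounds)
  then show "0 \<le> cutoff i p q lo hi u" "cutoff i p q lo hi u \<le> 1"
    unfolding cutoff_def by (auto intro!: mult_nonneg_nonneg mult_le_one ramp_bounds)
qed

lemma cutoff_eq_1:
  assumes "q < p" "\<And>j. lo j < hi j" "u $ i \<le> q" "\<And>j. hi j \<le> u $ j"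
  shows "cutoff i p q lo hi u = 1"
  using assms by (simp add: cutoff_def ramp_eq_1)

lemma cutoff_eq_0:
  assumes "q < p" "\<And>j. lo j < hi j" "p \<le> u $ i \<or> u $ j \<le> lo j"
  shows "cutoff i p q lo hi u = 0"
proof (cases "p \<le> u $ i")
  case True
  then show ?thesis using assms by (simp add: cutoff_def ramp_eq_0)
next
  case False
  then have "ramp (lo j) (hi j) (u $ j) = 0" using assms by (intro ramp_eq_0) auto
  then have "(\<Prod>j\<in>UNIV. ramp (lo j) (hi j) (u $ j)) = 0" by (intro prod_zero) auto
  then show ?thesis by (simp add: cutoff_def)
qed

lemma exp_chart_nth: "exp_chart z $ i = exp (- (z $ i))"
  by (simp add: exp_chart_def)

lemma rectangle_sets_punctured:
  "cbox 0 w - {0} \<in> sets (restrict_space borel (punctured_orthant :: (real ^ 'd) set))"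
proof -
  have "cbox 0 w - {0} \<subseteq> (punctured_orthant :: (real ^ 'd) set)"
    by (auto simp: punctured_orthant_def nonneg_orthant_def mem_box_cart)
  then show ?thesis by (subst sets_restrict_space_iff) auto
qed

context cbi_kernel
begin

text \<open>Almost every jump exceeds \<open>w\<close> in some coordinate and is therefore cut off once the tolerance is small;
  dominated convergence with majorant \<open>quad\<close> concludes.\<close>

lemma integral_cutoff_tendsto_0:
  assumes N: "N = \<nu> \<or> (\<exists>j. N = \<mu> j)" and null: "emeasure N (cbox 0 w - {0}) = 0" and "0 < \<epsilon>"
  shows "(\<lambda>m. \<integral>z. quad z * cutoff i 1 (exp (- \<epsilon>)) (\<lambda>j. exp (- (w $ j)) - 2 / real (Suc m))
      (\<lambda>j. exp (- (w $ j)) - 1 / real (Suc m)) (exp_chart z) \<partial>N) \<longlonglongrightarrow> 0"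
proof -
  let ?lo = "\<lambda>m j. exp (- (w $ j)) - 2 / real (Suc m)"
  let ?hi = "\<lambda>m j. exp (- (w $ j)) - 1 / real (Suc m)"
  let ?g = "\<lambda>m. cutoff i 1 (exp (- \<epsilon>)) (?lo m) (?hi m)"
  have lh: "?lo m j < ?hi m j" for m j by (simp add: divide_strict_right_mono)
  have e: "exp (- \<epsilon>) < 1" using assms by simp
  have sp: "space N = punctured_orthant" and sN: "sets N = sets (restrict_space borel punctured_orthant)"
    using N sets_\<nu> sets_\<mu> by auto
  have meas: "f \<in> borel_measurable N" if "f \<in> borel_measurable borel" for f :: "real ^ 'd \<Rightarrow> real"
    using borel_measurable_levy[OF that] N by auto
  have int: "integrable N quad"
    using N integrable_levy[of "\<lambda>_. 1"] by auto
  have "cbox 0 w - {0} \<in> null_sets N"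
    using null rectangle_sets_punctured[of w] sN by (intro null_setsI) auto
  then have ae: "AE z in N. z \<notin> cbox 0 w - {0}" by (rule AE_not_in)
  have "(\<lambda>m. \<integral>z. quad z * ?g m (exp_chart z) \<partial>N) \<longlonglongrightarrow> (\<integral>z. 0 \<partial>N)"
  proof (rule integral_dominated_convergence[where w = quad])
    show "(\<lambda>z. 0) \<in> borel_measurable N" by simp
    show "(\<lambda>z. quad z * ?g m (exp_chart z)) \<in> borel_measurable N" for m
    proof (rule meas)
      have [measurable]: "?g m \<in> borel_measurable borel"
        by (rule borel_measurable_continuous_onI[OF continuous_on_cutoff])
      show "(\<lambda>z. quad z * ?g m (exp_chart z)) \<in> borel_measurable borel" by measurable
    qed
    show "integrable N quad" by (rule int)
    show "AE z in N. norm (quad z * ?g m (exp_chart z)) \<le> quad z" for m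
    proof (rule AE_I2)
      fix z :: "real ^ 'd"
      have "quad z * ?g m (exp_chart z) \<le> quad z * 1"
        by (intro mult_left_mono cutoff_bounds quad_nonneg)
      moreover have "0 \<le> quad z * ?g m (exp_chart z)"
        by (intro mult_nonneg_nonneg cutoff_bounds quad_nonneg)
      ultimately show "norm (quad z * ?g m (exp_chart z)) \<le> quad z" by simp
    qed
    show "AE z in N. (\<lambda>m. quad z * ?g m (exp_chart z)) \<longlonglongrightarrow> 0"
      using ae AE_space[of N]
    proof eventually_elim
      case (elim z)
        have "z \<in> punctured_orthant" using elim(2) sp by simp
        then obtain j where j: "w $ j < z $ j"
          using elim(1) by (auto simp: mem_box_cart punctured_orthant_def nonneg_orthant_def not_le)
        then have "0 < exp (- (w $ j)) - exp (- (z $ j))" by simp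
        then obtain m0 where m0: "2 / real (Suc m0) < exp (- (w $ j)) - exp (- (z $ j))"
          using reals_Archimedean[of "(exp (- (w $ j)) - exp (- (z $ j))) / 2"]
          by (auto simp: inverse_eq_divide)
        have "?g m (exp_chart z) = 0" if "m0 \<le> m" for m
        proof (rule cutoff_eq_0[OF e lh])
          have "2 / real (Suc m) \<le> 2 / real (Suc m0)" using that by (intro divide_left_mono) auto
          then show "1 \<le> exp_chart z $ i \<or> exp_chart z $ j \<le> ?lo m j" using m0 by (simp add: exp_chart_nth)
        qed
        then have "\<forall>\<^sub>F m in sequentially. quad z * ?g m (exp_chart z) = 0"
          unfolding eventually_sequentially by auto
        then show ?case by (rule tendsto_eventually)
    qed
  qed
  then show ?thesis by simp
qed

lemma measure_increment_le:
  assumes h: "0 < h" and y: "y \<in> nonneg_orthant" and A: "A \<in> sets borel"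
    and g: "continuous_on UNIV g" and "0 < k"
    and le: "\<And>y'. y' \<in> nonneg_orthant \<Longrightarrow> y' - y \<in> A \<Longrightarrow> k \<le> quad (y' - y) * g (exp_chart (y' - y))"
    and nonneg: "\<And>u. 0 \<le> g u"
  shows "k * step_prob h y A \<le> h * increment_form h y g"
proof -
  have h0: "0 \<le> h" using h by simp
  have "k * step_prob h y A = (\<integral>y'. k * indicator A (y' - y) \<partial>Q h y)"
    using integral_increment_indicator[OF h0 y A] by simp
  also have "\<dots> \<le> (\<integral>y'. quad (y' - y) * g (exp_chart (y' - y)) \<partial>Q h y)"
  proof (rule integral_mono)
    show "integrable (Q h y) (\<lambda>y'. k * indicator A (y' - y))"
      using A by (intro integrable_Q[OF h0 y, where C = k]; measurable; use \<open>0 < k\<close> in \<open>auto simp: indicator_def\<close>)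
    show "integrable (Q h y) (\<lambda>y'. quad (y' - y) * g (exp_chart (y' - y)))"
      by (rule integrable_increment[OF h0 y g])
    fix y' assume "y' \<in> space (Q h y)"
    then have "y' \<in> nonneg_orthant" using space_Q[OF h0 y] by simp
    then show "k * indicator A (y' - y) \<le> quad (y' - y) * g (exp_chart (y' - y))"
      using le[of y'] mult_nonneg_nonneg[OF quad_nonneg nonneg, of "y' - y" "exp_chart (y' - y)"]
      by (auto simp: indicator_def)
  qed
  finally show ?thesis using h by (simp add: increment_form_def)
qed

text \<open>The tolerance is imposed in the chart, where the cutoff functions are defined; as \<open>m\<close> grows, only the
  increments below \<open>w\<close> remain.\<close>

definition forbidden :: "real ^ 'd \<Rightarrow> 'd \<Rightarrow> real \<Rightarrow> nat \<Rightarrow> (real ^ 'd) set" where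
  "forbidden w i \<epsilon> m = {z. \<epsilon> \<le> z $ i \<and> (\<forall>j. exp (- (w $ j)) - 1 / real (Suc m) \<le> exp (- (z $ j)))}"

lemma forbidden_borel [measurable]: "forbidden w i \<epsilon> m \<in> sets borel"
proof -
  have "forbidden w i \<epsilon> m = {z \<in> space borel. \<epsilon> \<le> z $ i \<and> (\<forall>j. exp (- (w $ j)) - 1 / real (Suc m) \<le> exp (- (z $ j)))}"
    by (simp add: forbidden_def)
  also have "\<dots> \<in> sets borel" by measurable
  finally show ?thesis .
qed

text \<open>The increment of a short step behaves like the jump intensity away from zero.  The cutoff vanishes at
  the point \<open>1\<close> of the chart, so that the diffusion does not contribute.\<close>

lemma forbidden_rate:
  assumes null: "emeasure \<nu> (cbox 0 w - {0}) = 0" "\<And>j. emeasure (\<mu> j) (cbox 0 w - {0}) = 0"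
    and "0 < \<epsilon>" "0 \<le> K" "0 < e"
  shows "\<exists>m. \<forall>\<^sub>F h in at_right 0. \<forall>y\<in>orthant_ball K.
    step_prob h y (forbidden w i \<epsilon> m) \<le> e * h"
proof -
  let ?lo = "\<lambda>m j. exp (- (w $ j)) - 2 / real (Suc m)"
  let ?hi = "\<lambda>m j. exp (- (w $ j)) - 1 / real (Suc m)"
  define g where "g m = cutoff i 1 (exp (- \<epsilon>)) (?lo m) (?hi m)" for m
  have lh: "?lo m j < ?hi m j" for m j by (simp add: divide_strict_right_mono)
  have e1: "exp (- \<epsilon>) < 1" using assms by simp
  have gc: "continuous_on UNIV (g m)" for m unfolding g_def by (rule continuous_on_cutoff)
  define k where "k = (1 - exp (- \<epsilon>))\<^sup>2"
  have k: "0 < k" using e1 by (simp add: k_def)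
  define T where "T m = (\<integral>z. quad z * g m (exp_chart z) \<partial>\<nu>) + (\<Sum>j\<in>UNIV. K * (\<integral>z. quad z * g m (exp_chart z) \<partial>\<mu> j))" for m
  have "T \<longlonglongrightarrow> 0 + (\<Sum>j\<in>(UNIV :: 'd set). K * 0)"
    unfolding T_def g_def using null \<open>0 < \<epsilon>\<close>
    by (intro tendsto_add tendsto_sum tendsto_mult tendsto_const integral_cutoff_tendsto_0) auto
  then have "T \<longlonglongrightarrow> 0" by simp
  moreover have "0 < e * k / 2" using k assms by simp
  ultimately have "\<forall>\<^sub>F m in sequentially. T m < e * k / 2" by (rule order_tendstoD(2))
  then obtain m where m: "T m < e * k / 2" unfolding eventually_sequentially by auto
  have L: "levy_form y (g m) \<le> T m" if "y \<in> orthant_ball K" for y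
  proof -
    have "g m 1 = 0" unfolding g_def by (rule cutoff_eq_0[OF e1 lh]) simp
    moreover have "y $ j * (\<integral>z. quad z * g m (exp_chart z) \<partial>\<mu> j) \<le> K * (\<integral>z. quad z * g m (exp_chart z) \<partial>\<mu> j)" for j
    proof (rule mult_right_mono)
      show "y $ j \<le> K" using that component_le_mass[of y j] by (auto simp: orthant_ball_def)
      show "0 \<le> (\<integral>z. quad z * g m (exp_chart z) \<partial>\<mu> j)"
        unfolding g_def by (intro Bochner_Integration.integral_nonneg mult_nonneg_nonneg quad_nonneg cutoff_bounds)
    qed
    ultimately show ?thesis unfolding levy_form_def T_def by (simp add: sum_mono)
  qed
  have "\<forall>\<^sub>F h in at_right 0. \<forall>y\<in>orthant_ball K. dist (increment_form h y (g m)) (levy_form y (g m)) < e * k / 2"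
    using k assms by (intro uniform_limitD[OF increment_form_limit[OF _ gc]]) auto
  moreover have "\<forall>\<^sub>F h in at_right 0. (0::real) < h" by (simp add: eventually_at_right_less)
  ultimately have "\<forall>\<^sub>F h in at_right 0. \<forall>y\<in>orthant_ball K.
    step_prob h y (forbidden w i \<epsilon> m) \<le> e * h"
  proof eventually_elim
    case (elim h)
    show ?case
    proof
      fix y :: "real ^ 'd" assume yK: "y \<in> orthant_ball K"
      then have y: "y \<in> nonneg_orthant" by (simp add: orthant_ball_def)
      have "\<bar>increment_form h y (g m) - levy_form y (g m)\<bar> < e * k / 2"
        using elim(1) yK unfolding dist_real_def by blast
      then have I: "increment_form h y (g m) \<le> e * k" using L[OF yK] m by linarith
      have "k * step_prob h y (forbidden w i \<epsilon> m) \<le> h * increment_form h y (g m)"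
      proof (rule measure_increment_le[OF elim(2) y forbidden_borel gc k])
        fix y' :: "real ^ 'd" assume f: "y' - y \<in> forbidden w i \<epsilon> m"
        have "g m (exp_chart (y' - y)) = 1" unfolding g_def
          using f by (intro cutoff_eq_1 e1 lh) (auto simp: forbidden_def exp_chart_nth)
        moreover have "k \<le> quad (y' - y)" unfolding k_def
          using f assms by (intro quad_ge[of \<epsilon> "y' - y" i]) (auto simp: forbidden_def)
        ultimately show "k \<le> quad (y' - y) * g m (exp_chart (y' - y))" by simp
      qed (auto simp: g_def cutoff_bounds)
      also have "\<dots> \<le> h * (e * k)" using I elim(2) by (intro mult_left_mono) auto
      finally have "k * step_prob h y (forbidden w i \<epsilon> m) \<le> k * (e * h)"
        by (simp add: mult.commute mult.left_commute)
      then show "step_prob h y (forbidden w i \<epsilon> m) \<le> e * h"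
        using k by simp
    qed
  qed
  then show ?thesis by blast
qed

definition target :: "real ^ 'd \<Rightarrow> 'd \<Rightarrow> real \<Rightarrow> (real ^ 'd) set" where
  "target w i \<delta> = {z \<in> punctured_orthant. (\<forall>j. z $ j \<le> w $ j) \<and> \<delta> \<le> z $ i}"

definition target_rate :: "real ^ 'd \<Rightarrow> 'd \<Rightarrow> real \<Rightarrow> real ^ 'd \<Rightarrow> real" where
  "target_rate w i \<delta> y = measure \<nu> (target w i \<delta>) + (\<Sum>j\<in>UNIV. y $ j * measure (\<mu> j) (target w i \<delta>))"

lemma target_sets: "target w i \<delta> \<in> sets \<nu>" "target w i \<delta> \<in> sets (\<mu> j)"
proof -
  have "{z \<in> space borel. (\<forall>j. z $ j \<le> w $ j) \<and> \<delta> \<le> z $ i} \<inter> punctured_orthant \<in> sets borel" by measurable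
  then have "target w i \<delta> \<in> sets (restrict_space borel punctured_orthant)"
    by (subst sets_restrict_space_iff) (auto simp: target_def Int_def conj_ac)
  then show "target w i \<delta> \<in> sets \<nu>" "target w i \<delta> \<in> sets (\<mu> j)" by (simp_all add: sets_\<nu> sets_\<mu>)
qed

lemma target_finite:
  assumes "0 < \<delta>"
  shows "emeasure \<nu> (target w i \<delta>) < \<infinity>" "emeasure (\<mu> j) (target w i \<delta>) < \<infinity>"
proof -
  define k where "k = (1 - exp (- \<delta>))\<^sup>2"
  have k: "0 < k" using assms by (simp add: k_def)
  have *: "emeasure N (target w i \<delta>) < \<infinity>" if int: "integrable N quad" and T: "target w i \<delta> \<in> sets N" for N
  proof -
    have "ennreal k * emeasure N (target w i \<delta>) = (\<integral>\<^sup>+ z. ennreal k * indicator (target w i \<delta>) z \<partial>N)"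
      using T by (simp add: nn_integral_cmult)
    also have "\<dots> \<le> (\<integral>\<^sup>+ z. ennreal (quad z) \<partial>N)"
    proof (rule nn_integral_mono)
      fix z :: "real ^ 'd"
      have "k \<le> quad z" if "z \<in> target w i \<delta>"
        unfolding k_def using that assms by (intro quad_ge[of \<delta> z i]) (auto simp: target_def)
      then show "ennreal k * indicator (target w i \<delta>) z \<le> ennreal (quad z)"
        by (auto simp: indicator_def intro!: ennreal_leI)
    qed
    also have "\<dots> = ennreal (\<integral>z. quad z \<partial>N)"
      by (rule nn_integral_eq_integral[OF int]) (simp add: quad_nonneg)
    also have "\<dots> < \<infinity>" by simp
    finally have "ennreal k * emeasure N (target w i \<delta>) < \<infinity>" .
    then show ?thesis using k by (auto simp: ennreal_mult_less_top)
  qed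
  show "emeasure \<nu> (target w i \<delta>) < \<infinity>" "emeasure (\<mu> j) (target w i \<delta>) < \<infinity>"
    using integrable_levy[of "\<lambda>_. 1"] *[OF _ target_sets(1)] *[OF _ target_sets(2)] by simp_all
qed

definition below :: "real ^ 'd \<Rightarrow> (real ^ 'd) set" where
  "below w = {z. \<forall>j. z $ j \<le> w $ j}"

definition above :: "'d \<Rightarrow> real \<Rightarrow> (real ^ 'd) set" where
  "above i a = {z. a \<le> z $ i}"

lemma below_borel [measurable]: "below w \<in> sets borel" and above_borel [measurable]: "above i a \<in> sets borel"
proof -
  have "{z \<in> space borel. \<forall>j. z $ j \<le> w $ j} \<in> sets borel" "{z \<in> space borel. a \<le> z $ i} \<in> sets borel"
    by measurable
  then show "below w \<in> sets borel" "above i a \<in> sets borel" by (simp_all add: below_def above_def)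
qed

text \<open>The constant depends on the target but not on \<open>w'\<close>: the cutoff equals 1 on the target, however close
  \<open>w'\<close> is to \<open>w\<close>, and only the admissible step length shrinks.\<close>

lemma target_hit_rate:
  assumes "0 < \<delta>" "0 \<le> K" "0 < q"
  shows "\<exists>\<kappa>>0. \<forall>w'. (\<forall>j. w $ j < w' $ j) \<longrightarrow> (\<forall>\<^sub>F h in at_right 0. \<forall>y\<in>orthant_ball K.
    q \<le> target_rate w i \<delta> y \<longrightarrow> \<kappa> * h \<le> step_prob h y (below w' \<inter> above i (\<delta> / 2)))"
proof -
  define k where "k = (1 - exp (- \<delta>))\<^sup>2"
  have k: "0 < k" using assms by (simp add: k_def)
  define CK where "CK = real CARD('d) * (1 + exp K)\<^sup>2"
  have CK: "0 < CK"
  proof -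
    have "0 < 1 + exp K" by (intro add_pos_pos) auto
    then show ?thesis unfolding CK_def by (intro mult_pos_pos zero_less_power) auto
  qed
  define \<kappa> where "\<kappa> = k * q / (2 * CK)"
  have \<kappa>: "0 < \<kappa>" using k CK assms by (simp add: \<kappa>_def)
  have "\<forall>\<^sub>F h in at_right 0. \<forall>y\<in>orthant_ball K. q \<le> target_rate w i \<delta> y \<longrightarrow>
    \<kappa> * h \<le> step_prob h y (below w' \<inter> above i (\<delta> / 2))"
    if w': "\<And>j. w $ j < w' $ j" for w'
  proof -
    define g where "g = cutoff i (exp (- (\<delta> / 2))) (exp (- \<delta>)) (\<lambda>j. exp (- (w' $ j))) (\<lambda>j. exp (- (w $ j)))"
    have pq: "exp (- \<delta>) < exp (- (\<delta> / 2))" using assms by simp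
    have lh: "exp (- (w' $ j)) < exp (- (w $ j))" for j using w' by simp
    have gc: "continuous_on UNIV g" unfolding g_def by (rule continuous_on_cutoff)
    have g01: "0 \<le> g u" "g u \<le> 1" for u unfolding g_def by (rule cutoff_bounds)+
    have g_target: "k * indicator (target w i \<delta>) z \<le> quad z * g (exp_chart z)" for z
    proof (cases "z \<in> target w i \<delta>")
      case True
      have "g (exp_chart z) = 1" unfolding g_def
        using True by (intro cutoff_eq_1 pq lh) (auto simp: target_def exp_chart_nth)
      moreover have "k \<le> quad z" unfolding k_def
        using True assms by (intro quad_ge[of \<delta> z i]) (auto simp: target_def)
      ultimately show ?thesis using True by simp
    next
      case False
      then show ?thesis using mult_nonneg_nonneg[OF quad_nonneg g01(1), of z "exp_chart z"] by simp
    qed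
    have kN: "k * measure N (target w i \<delta>) \<le> (\<integral>z. quad z * g (exp_chart z) \<partial>N)"
      if "integrable N (\<lambda>z. quad z * g (exp_chart z))" "target w i \<delta> \<in> sets N" "emeasure N (target w i \<delta>) < \<infinity>" for N
    proof -
      have "k * measure N (target w i \<delta>) = (\<integral>z. k * indicator (target w i \<delta>) z \<partial>N)"
        using that sets.sets_into_space[OF that(2)] by (simp add: Int_absorb2)
      also have "\<dots> \<le> (\<integral>z. quad z * g (exp_chart z) \<partial>N)"
        using that g_target by (intro integral_mono integrable_mult_right integrable_real_indicator) auto
      finally show ?thesis .
    qed
    have L: "k * target_rate w i \<delta> y \<le> levy_form y g" if y: "y \<in> nonneg_orthant" for y
    proof -
      have g1: "g 1 = 0" unfolding g_def using assms by (intro cutoff_eq_0 pq lh) auto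
      have 1: "k * measure \<nu> (target w i \<delta>) \<le> (\<integral>z. quad z * g (exp_chart z) \<partial>\<nu>)"
        by (intro kN integrable_levy[OF gc] target_sets target_finite assms)
      have "k * measure (\<mu> j) (target w i \<delta>) \<le> (\<integral>z. quad z * g (exp_chart z) \<partial>\<mu> j)" for j
        by (intro kN integrable_levy[OF gc] target_sets target_finite assms)
      then have "y $ j * (k * measure (\<mu> j) (target w i \<delta>)) \<le> y $ j * (\<integral>z. quad z * g (exp_chart z) \<partial>\<mu> j)" for j
        using nonneg_orthantD[OF y] by (intro mult_left_mono) auto
      then have "(\<Sum>j\<in>UNIV. y $ j * (k * measure (\<mu> j) (target w i \<delta>))) \<le> (\<Sum>j\<in>UNIV. y $ j * (\<integral>z. quad z * g (exp_chart z) \<partial>\<mu> j))"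
        by (rule sum_mono)
      moreover have "k * target_rate w i \<delta> y = k * measure \<nu> (target w i \<delta>) + (\<Sum>j\<in>UNIV. y $ j * (k * measure (\<mu> j) (target w i \<delta>)))"
        by (simp add: target_rate_def distrib_left sum_distrib_left mult.left_commute)
      ultimately show ?thesis using 1 g1 unfolding levy_form_def by simp
    qed
    have "\<forall>\<^sub>F h in at_right 0. \<forall>y\<in>orthant_ball K. dist (increment_form h y g) (levy_form y g) < k * q / 2"
      using k assms by (intro uniform_limitD[OF increment_form_limit[OF _ gc]]) auto
    moreover have "\<forall>\<^sub>F h in at_right 0. (0::real) < h" by (simp add: eventually_at_right_less)
    ultimately show ?thesis
    proof eventually_elim
      case (elim h)
      show ?case
      proof (intro ballI impI)
        fix y :: "real ^ 'd" assume yK: "y \<in> orthant_ball K" and qy: "q \<le> target_rate w i \<delta> y"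
        then have y: "y \<in> nonneg_orthant" by (simp add: orthant_ball_def)
        have h0: "0 \<le> h" using elim by simp
        let ?A = "below w' \<inter> above i (\<delta> / 2)"
        have A: "?A \<in> sets borel" by measurable
        have "\<bar>increment_form h y g - levy_form y g\<bar> < k * q / 2"
          using elim(1) yK unfolding dist_real_def by blast
        moreover have "k * q \<le> k * target_rate w i \<delta> y" using qy k by (intro mult_left_mono) auto
        ultimately have "k * q / 2 \<le> increment_form h y g" using L[OF y] by linarith
        then have "h * (k * q / 2) \<le> h * increment_form h y g" using h0 by (intro mult_left_mono)
        also have "\<dots> = (\<integral>y'. quad (y' - y) * g (exp_chart (y' - y)) \<partial>Q h y)"
          using elim(2) by (simp add: increment_form_def)
        also have "\<dots> \<le> (\<integral>y'. CK * indicator ?A (y' - y) \<partial>Q h y)"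
        proof (rule integral_mono)
          show "integrable (Q h y) (\<lambda>y'. quad (y' - y) * g (exp_chart (y' - y)))"
            by (rule integrable_increment[OF h0 y gc])
          show "integrable (Q h y) (\<lambda>y'. CK * indicator ?A (y' - y))"
            using CK A by (intro integrable_Q[OF h0 y, where C = CK]; measurable; auto simp: indicator_def)
          fix y' assume "y' \<in> space (Q h y)"
          then have y': "y' \<in> nonneg_orthant" using space_Q[OF h0 y] by simp
          show "quad (y' - y) * g (exp_chart (y' - y)) \<le> CK * indicator ?A (y' - y)"
          proof (cases "y' - y \<in> ?A")
            case True
            have "quad (y' - y) \<le> CK" unfolding CK_def
              by (rule quad_le_of_chart_box[OF exp_chart_in_chart_box[OF yK y']])
            then have "quad (y' - y) * g (exp_chart (y' - y)) \<le> CK * 1"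
              using g01 quad_nonneg CK by (intro mult_mono) auto
            then show ?thesis using True by simp
          next
            case False
            then obtain j where "(y' - y) $ i < \<delta> / 2 \<or> w' $ j < (y' - y) $ j"
              by (auto simp: below_def above_def not_le)
            then have "g (exp_chart (y' - y)) = 0" unfolding g_def
              by (intro cutoff_eq_0[OF pq lh, where j = j]) (auto simp: exp_chart_nth)
            then show ?thesis using False by simp
          qed
        qed
        also have "\<dots> = CK * step_prob h y ?A"
          using integral_increment_indicator[OF h0 y A] by simp
        finally show "\<kappa> * h \<le> step_prob h y ?A"
          using CK by (simp add: \<kappa>_def field_simps)
      qed
    qed
  qed
  then show ?thesis using \<kappa> by blast
qed

text \<open>If \<open>x $ i\<close> is positive, this is continuity at time zero.  If it vanishes, the immigration drift makes
  the Laplace transform at \<open>axis i l\<close> decrease at least at the rate \<open>l * \<beta> $ i\<close>, and \<open>l\<close> is arbitrary.\<close>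

lemma positive_coordinate_probability:
  assumes x: "x \<in> nonneg_orthant" and i: "0 < x $ i \<or> 0 < \<beta> $ i"
  shows "\<forall>\<^sub>F s in at_right 0. b * s < measure (Q s x) {y \<in> nonneg_orthant. 0 < y $ i}"
proof -
  have m: "1 - exp (- (l * x $ i)) * laplace_increment s (axis i l) x \<le> measure (Q s x) {y \<in> nonneg_orthant. 0 < y $ i}"
    if l: "0 \<le> l" and s: "0 < s" for l s
  proof -
    have s0: "0 \<le> s" using s by simp
    interpret prob_space "Q s x" by (rule prob_space_Q[OF s0 x])
    have S: "{y \<in> nonneg_orthant. 0 < y $ i} \<in> sets (Q s x)"
    proof -
      have "{y \<in> space borel. 0 < y $ i} \<inter> nonneg_orthant \<in> sets borel" by measurable
      then have "{y \<in> space borel. 0 < y $ i} \<inter> nonneg_orthant \<in> sets orthant_space"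
        unfolding orthant_space_def by (subst sets_restrict_space_iff) auto
      then show ?thesis using sets_Q[OF s0 x] by (simp add: Int_def conj_commute)
    qed
    have int: "integrable (Q s x) (\<lambda>y. exp (- (l * (y $ i - 0 $ i))))"
      by (rule integrable_exp_shift[OF s0 x l])
    have "1 - exp (- (l * x $ i)) * laplace_increment s (axis i l) x = (\<integral>y. 1 - exp (- (l * (y $ i - 0 $ i))) \<partial>Q s x)"
      using int integral_exp_shift[where a = l and i = i and ?y0.0 = 0 and h = s and y = x] by (simp add: prob_space)
    also have "\<dots> \<le> (\<integral>y. indicat_real {y \<in> nonneg_orthant. 0 < y $ i} y \<partial>Q s x)"
    proof (rule integral_mono)
      show "integrable (Q s x) (\<lambda>y. 1 - exp (- (l * (y $ i - 0 $ i))))" using int by simp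
      show "integrable (Q s x) (indicat_real {y \<in> nonneg_orthant. 0 < y $ i})"
        using S by (intro integrable_real_indicator) (auto simp: emeasure_eq_measure)
      fix y assume "y \<in> space (Q s x)"
      then have y: "y \<in> nonneg_orthant" using space_Q[OF s0 x] by simp
      show "1 - exp (- (l * (y $ i - 0 $ i))) \<le> indicator {y \<in> nonneg_orthant. 0 < y $ i} y"
        using y nonneg_orthantD[OF y, of i] by (cases "y $ i = 0") (auto simp: indicator_def)
    qed
    also have "\<dots> = measure (Q s x) {y \<in> nonneg_orthant. 0 < y $ i}"
      using S sets.sets_into_space[OF S] by (simp add: Int_absorb2)
    finally show ?thesis .
  qed
  have ev0: "\<forall>\<^sub>F s in at_right 0. (0::real) < s" by (simp add: eventually_at_right_less)
  have xK: "x \<in> orthant_ball (mass x)" and K: "0 \<le> mass x" using x mass_nonneg[OF x] by (auto simp: orthant_ball_def)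
  have lim: "((\<lambda>s. (laplace_increment s (axis i l) x - 1) / s) \<longlongrightarrow>
      (\<Sum>j\<in>UNIV. x $ j * \<phi> (axis i l) $ j) - \<psi> (axis i l)) (at_right 0)" if "0 \<le> l" for l
    using tendsto_uniform_limitI[OF laplace_increment_limit[OF axis_nonneg_orthant[OF that] K] xK] .
  show ?thesis
  proof (cases "0 < x $ i")
    case True
    have s0: "((\<lambda>s. s) \<longlongrightarrow> (0::real)) (at_right 0)" by (rule tendsto_ident_at)
    have "((\<lambda>s. (laplace_increment s (axis i 1) x - 1) / s * s) \<longlongrightarrow> 0) (at_right 0)"
      using tendsto_mult[OF lim[of 1] s0] by simp
    then have "((\<lambda>s. 1 - exp (- (1 * x $ i)) * (1 + (laplace_increment s (axis i 1) x - 1) / s * s) - b * s) \<longlongrightarrow>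
        1 - exp (- (1 * x $ i)) * (1 + 0) - b * 0) (at_right 0)"
      using s0 by (intro tendsto_intros)
    then have "\<forall>\<^sub>F s in at_right 0. 0 < 1 - exp (- (1 * x $ i)) * (1 + (laplace_increment s (axis i 1) x - 1) / s * s) - b * s"
      by (rule order_tendstoD(1)) (use True in simp)
    with ev0 show ?thesis
    proof eventually_elim
      case (elim s)
      then show ?case using m[of 1 s] by simp
    qed
  next
    case False
    then have xi: "x $ i = 0" and \<beta>i: "0 < \<beta> $ i" using i nonneg_orthantD[OF x, of i] by auto
    define l where "l = (\<bar>b\<bar> + 1) / \<beta> $ i"
    have l: "0 \<le> l" "l * \<beta> $ i = \<bar>b\<bar> + 1" using \<beta>i by (auto simp: l_def)
    have "x $ j * \<phi> (axis i l) $ j \<le> 0" for j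
      using branching_axis_nonpos[OF l(1), of j i] nonneg_orthantD[OF x, of j] xi
      by (cases "j = i") (auto intro: mult_nonneg_nonpos)
    then have "(\<Sum>j\<in>UNIV. x $ j * \<phi> (axis i l) $ j) \<le> 0" by (rule sum_nonpos)
    moreover have "\<bar>b\<bar> + 1 \<le> \<psi> (axis i l)" using immigration_axis_ge[OF l(1), of i] l(2) by simp
    ultimately have "(\<Sum>j\<in>UNIV. x $ j * \<phi> (axis i l) $ j) - \<psi> (axis i l) < - b" by linarith
    with lim[OF l(1)] have "\<forall>\<^sub>F s in at_right 0. (laplace_increment s (axis i l) x - 1) / s < - b"
      by (rule order_tendstoD(2))
    with ev0 show ?thesis
    proof eventually_elim
      case (elim s)
      then have "laplace_increment s (axis i l) x - 1 < - b * s" by (simp only: pos_divide_less_eq)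
      then show ?case using m[OF l(1) elim(1)] xi by simp
    qed
  qed
qed

end

section \<open>Reaching, hitting and surviving\<close>

context cbi_kernel
begin

lemma target_rate_lower:
  assumes "0 < \<delta>" "0 < q"
  shows "\<exists>r>0. r \<le> 1 \<and> (\<forall>y0. q \<le> target_rate w i \<delta> y0 \<longrightarrow> (\<forall>y\<in>orthant_box y0 r. q / 2 \<le> target_rate w i \<delta> y))"
proof -
  define S where "S = (\<Sum>j\<in>UNIV. measure (\<mu> j) (target w i \<delta>))"
  have S: "0 \<le> S" unfolding S_def by (intro sum_nonneg) simp
  define r where "r = min 1 (q / (2 * (1 + S)))"
  have r: "0 < r" "r \<le> 1" using assms S by (auto simp: r_def)
  have rS: "r * S \<le> q / 2"
  proof -
    have "r * S \<le> r * (1 + S)" using r by (intro mult_left_mono) auto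
    also have "\<dots> \<le> (q / (2 * (1 + S))) * (1 + S)" using S by (intro mult_right_mono) (auto simp: r_def)
    also have "\<dots> = q / 2"
    proof -
      have "(q / (2 * k)) * k = q / 2" if "0 < k" for k :: real using that by simp
      from this[of "1 + S"] show ?thesis using S by simp
    qed
    finally show ?thesis .
  qed
  have "q / 2 \<le> target_rate w i \<delta> y" if q: "q \<le> target_rate w i \<delta> y0" and y: "y \<in> orthant_box y0 r" for y0 y
  proof -
    have "y0 $ j * measure (\<mu> j) (target w i \<delta>) \<le> (y $ j + r) * measure (\<mu> j) (target w i \<delta>)" for j
    proof (rule mult_right_mono)
      have "\<bar>y $ j - y0 $ j\<bar> \<le> r" using y by (simp add: orthant_box_def)
      then show "y0 $ j \<le> y $ j + r" by linarith
    qed simp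
    then have "(\<Sum>j\<in>UNIV. y0 $ j * measure (\<mu> j) (target w i \<delta>)) \<le> (\<Sum>j\<in>UNIV. (y $ j + r) * measure (\<mu> j) (target w i \<delta>))"
      by (rule sum_mono)
    also have "\<dots> = (\<Sum>j\<in>UNIV. y $ j * measure (\<mu> j) (target w i \<delta>)) + r * S"
      by (simp add: distrib_right sum.distrib S_def sum_distrib_left)
    finally show ?thesis using q rS unfolding target_rate_def by linarith
  qed
  then show ?thesis using r by blast
qed

lemma orthant_event_sets:
  assumes "{y. P y} \<in> sets borel"
  shows "{y \<in> nonneg_orthant. P y} \<in> sets orthant_space"
proof -
  have "{y \<in> nonneg_orthant. P y} = nonneg_orthant \<inter> {y. P y}" by blast
  also have "\<dots> \<in> sets orthant_space"
    unfolding orthant_space_def sets_restrict_space using assms by (rule imageI)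
  finally show ?thesis .
qed

lemma target_rate_set:
  shows "{y \<in> nonneg_orthant. a \<le> target_rate w i \<delta> y \<and> mass y \<le> K} \<in> sets orthant_space"
    and "{y \<in> nonneg_orthant. 0 < target_rate w i \<delta> y} \<in> sets orthant_space"
    and "{y \<in> nonneg_orthant. 0 < y $ (j :: 'd)} \<in> sets orthant_space"
proof -
  have R: "target_rate w i \<delta> \<in> borel_measurable borel"
    unfolding target_rate_def[abs_def]
    by (intro borel_measurable_add borel_measurable_sum borel_measurable_times measurable_component) auto
  have S: "mass \<in> borel_measurable (borel :: (real ^ 'd) measure)"
    unfolding mass_def[abs_def] by (intro borel_measurable_sum measurable_component)
  have "{y \<in> space borel. a \<le> target_rate w i \<delta> y} \<inter> {y \<in> space borel. mass y \<le> K} \<in> sets borel"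
    by (intro sets.Int borel_measurable_le R S borel_measurable_const)
  then have "{y. a \<le> target_rate w i \<delta> y \<and> mass y \<le> K} \<in> sets borel" by (simp add: Int_def)
  then show "{y \<in> nonneg_orthant. a \<le> target_rate w i \<delta> y \<and> mass y \<le> K} \<in> sets orthant_space"
    by (rule orthant_event_sets)
  have "{y \<in> space borel. 0 < target_rate w i \<delta> y} \<in> sets borel"
    by (intro borel_measurable_less R borel_measurable_const)
  then show "{y \<in> nonneg_orthant. 0 < target_rate w i \<delta> y} \<in> sets orthant_space"
    by (intro orthant_event_sets) simp
  have "{y \<in> space (borel :: (real ^ 'd) measure). 0 < y $ j} \<in> sets borel"
    by (intro borel_measurable_less measurable_component borel_measurable_const)
  then show "{y \<in> nonneg_orthant. 0 < y $ j} \<in> sets orthant_space"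
    by (intro orthant_event_sets) simp
qed

text \<open>If \<open>\<nu>\<close> charges the target, every state has a positive rate; otherwise some \<open>\<mu> j\<close> charges it, and the
  states with positive coordinate \<open>j\<close> do.\<close>

lemma reach_positive_rate:
  assumes x: "x \<in> nonneg_orthant" and "x \<in> pos_orthant \<or> \<beta> \<in> pos_orthant"
    and pos: "0 < measure \<nu> (target w i \<delta>) \<or> (\<exists>j. 0 < measure (\<mu> j) (target w i \<delta>))"
  shows "\<forall>\<^sub>F s in at_right 0. b * s < measure (Q s x) {y \<in> nonneg_orthant. 0 < target_rate w i \<delta> y}"
proof (cases "0 < measure \<nu> (target w i \<delta>)")
  case True
  have "\<forall>\<^sub>F s in at_right 0. (0::real) < s" by (simp add: eventually_at_right_less)
  moreover have "((\<lambda>s. b * s) \<longlongrightarrow> b * 0) (at_right (0::real))" by (intro tendsto_intros)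
  then have "\<forall>\<^sub>F s in at_right 0. b * s < 1" by (rule order_tendstoD(2)) simp
  ultimately show ?thesis
  proof eventually_elim
    case (elim s)
    interpret prob_space "Q s x" using prob_space_Q[of s x] elim x by simp
    have "0 < target_rate w i \<delta> y" if "y \<in> nonneg_orthant" for y
      using True nonneg_orthantD[OF that] unfolding target_rate_def
      by (intro add_pos_nonneg sum_nonneg mult_nonneg_nonneg) auto
    then have "{y \<in> nonneg_orthant. 0 < target_rate w i \<delta> y} = space (Q s x)"
      using space_Q[of s x] elim x by auto
    then show ?case using elim(2) prob_space by simp
  qed
next
  case False
  then obtain j where j: "0 < measure (\<mu> j) (target w i \<delta>)" using pos by auto
  have "0 < x $ j \<or> 0 < \<beta> $ j" using assms(2) by (auto simp: pos_orthant_def)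
  from positive_coordinate_probability[OF x this, of b]
  have "\<forall>\<^sub>F s in at_right 0. b * s < measure (Q s x) {y \<in> nonneg_orthant. 0 < y $ j}" .
  moreover have "\<forall>\<^sub>F s in at_right 0. (0::real) < s" by (simp add: eventually_at_right_less)
  ultimately show ?thesis
  proof eventually_elim
    case (elim s)
    have s: "0 \<le> s" using elim by simp
    interpret prob_space "Q s x" by (rule prob_space_Q[OF s x])
    have "{y \<in> nonneg_orthant. 0 < y $ j} \<subseteq> {y \<in> nonneg_orthant. 0 < target_rate w i \<delta> y}"
    proof safe
      fix y :: "real ^ 'd" assume y: "y \<in> nonneg_orthant" "0 < y $ j"
      have "0 < y $ j * measure (\<mu> j) (target w i \<delta>)" using y j by simp
      also have "\<dots> \<le> (\<Sum>j\<in>UNIV. y $ j * measure (\<mu> j) (target w i \<delta>))"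
        using nonneg_orthantD[OF y(1)] by (intro member_le_sum) auto
      finally show "0 < target_rate w i \<delta> y" unfolding target_rate_def by (simp add: add_nonneg_pos)
    qed
    then have "measure (Q s x) {y \<in> nonneg_orthant. 0 < y $ j} \<le> measure (Q s x) {y \<in> nonneg_orthant. 0 < target_rate w i \<delta> y}"
      using target_rate_set(2) sets_Q[OF s x] by (intro finite_measure_mono) auto
    then show ?case using elim(1) by simp
  qed
qed

lemma reach_uniform_rate:
  assumes x: "x \<in> nonneg_orthant" and s: "0 \<le> s"
    and pos: "a < measure (Q s x) {y \<in> nonneg_orthant. 0 < target_rate w i \<delta> y}"
  shows "\<exists>q>0. \<exists>K\<ge>0. a < measure (Q s x) {y \<in> nonneg_orthant. q \<le> target_rate w i \<delta> y \<and> mass y \<le> K}"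
proof -
  interpret prob_space "Q s x" by (rule prob_space_Q[OF s x])
  define U where "U n = {y \<in> nonneg_orthant. 1 / real (Suc n) \<le> target_rate w i \<delta> y \<and> mass y \<le> real n}" for n
  have "(\<lambda>n. measure (Q s x) (U n)) \<longlonglongrightarrow> measure (Q s x) (\<Union>n. U n)"
  proof (rule finite_Lim_measure_incseq)
    show "range U \<subseteq> sets (Q s x)" unfolding U_def using target_rate_set(1) sets_Q[OF s x] by auto
    show "incseq U"
    proof (rule incseq_SucI, rule subsetI)
      fix n y assume y: "y \<in> U n"
      have "1 / real (Suc (Suc n)) \<le> 1 / real (Suc n)" by (intro divide_left_mono) auto
      then show "y \<in> U (Suc n)" using y unfolding U_def by force
    qed
  qed
  moreover have "(\<Union>n. U n) = {y \<in> nonneg_orthant. 0 < target_rate w i \<delta> y}"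
  proof (intro set_eqI iffI)
    fix y assume "y \<in> (\<Union>n. U n)"
    then obtain n where "y \<in> nonneg_orthant" "1 / real (Suc n) \<le> target_rate w i \<delta> y" by (auto simp: U_def)
    moreover have "0 < 1 / real (Suc n)" by simp
    ultimately have "0 < target_rate w i \<delta> y" by linarith
    then show "y \<in> {y \<in> nonneg_orthant. 0 < target_rate w i \<delta> y}" using \<open>y \<in> nonneg_orthant\<close> by simp
  next
    fix y assume y: "y \<in> {y \<in> nonneg_orthant. 0 < target_rate w i \<delta> y}"
    then obtain n1 where n1: "inverse (real (Suc n1)) < target_rate w i \<delta> y" using reals_Archimedean by blast
    obtain n2 where n2: "mass y \<le> real n2" using real_arch_simple by blast
    have "1 / real (Suc (max n1 n2)) \<le> 1 / real (Suc n1)" by (intro divide_left_mono) auto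
    then have "y \<in> U (max n1 n2)" using y n1 n2 unfolding U_def by (auto simp: inverse_eq_divide simp del: of_nat_Suc)
    then show "y \<in> (\<Union>n. U n)" by blast
  qed
  ultimately have "(\<lambda>n. measure (Q s x) (U n)) \<longlonglongrightarrow> measure (Q s x) {y \<in> nonneg_orthant. 0 < target_rate w i \<delta> y}" by simp
  then have "\<forall>\<^sub>F n in sequentially. a < measure (Q s x) (U n)" using pos by (rule order_tendstoD(1))
  then obtain n where "a < measure (Q s x) (U n)" unfolding eventually_sequentially by auto
  then show ?thesis unfolding U_def by (intro exI[of _ "1 / real (Suc n)"] exI[of _ "real n"] conjI) auto
qed

definition hit_bound ::
  "real ^ 'd \<Rightarrow> 'd \<Rightarrow> real \<Rightarrow> real \<Rightarrow> real \<Rightarrow> real \<Rightarrow> real \<Rightarrow> real ^ 'd \<Rightarrow> real \<Rightarrow> bool" where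
  "hit_bound w i \<delta> q K T p w' h \<longleftrightarrow> (\<forall>n. T \<le> real n * h \<and> real n * h \<le> T + 1 \<longrightarrow> (\<forall>y\<in>orthant_ball K. q \<le> target_rate w i \<delta> y \<longrightarrow>
      p \<le> chain_prob h (below w') (above i (\<delta> / 2)) n False y))"

text \<open>Here \<open>hit_local\<close> on a short initial interval is combined with \<open>survive\<close> on the rest.  All constants
  are fixed before \<open>w'\<close>: increments below \<open>w'\<close> are bounded in terms of \<open>w\<close>, and increments violating
  the constraint are large in terms of \<open>w\<close>.\<close>

lemma hit_and_survive:
  assumes w: "w \<in> pos_orthant" and "0 < \<delta>" "0 < q" "0 \<le> K" "0 < T"
  shows "\<exists>p>0. \<forall>w'. (\<forall>j. w $ j < w' $ j \<and> w' $ j \<le> w $ j + 1) \<longrightarrow> (\<forall>\<^sub>F h in at_right 0.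
    hit_bound w i \<delta> q K T p w' h)"
proof -
  define \<eta> where "\<eta> = min (Min (range (($) w))) (\<delta> / 2)"
  have \<eta>: "0 < \<eta>" using w assms by (simp add: \<eta>_def pos_orthant_def)
  have \<eta>w: "\<eta> \<le> w $ j" for j unfolding \<eta>_def by (simp add: min.coboundedI1)
  obtain r where r: "0 < r" "r \<le> 1"
    and rate: "\<And>y0 y. q \<le> target_rate w i \<delta> y0 \<Longrightarrow> y \<in> orthant_box y0 r \<Longrightarrow> q / 2 \<le> target_rate w i \<delta> y"
    using target_rate_lower[OF \<open>0 < \<delta>\<close> \<open>0 < q\<close>, of w i] by (elim exE conjE) blast
  define K2 where "K2 = K + real CARD('d)"
  \<comment> \<open>\<open>K2\<close> bounds the mass in the box around a state, \<open>K3\<close> the mass after one more increment below \<open>w'\<close>.\<close>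
  define K3 where "K3 = K2 + mass w + real CARD('d)"
  have K2: "0 \<le> K2" using assms by (simp add: K2_def)
  obtain \<kappa> where \<kappa>: "0 < \<kappa>" and hit: "\<And>w'. (\<forall>j. w $ j < w' $ j) \<Longrightarrow> (\<forall>\<^sub>F h in at_right 0. \<forall>y\<in>orthant_ball K2.
    q / 2 \<le> target_rate w i \<delta> y \<longrightarrow> \<kappa> * h \<le> step_prob h y (below w' \<inter> above i (\<delta> / 2)))"
    using target_hit_rate[OF \<open>0 < \<delta>\<close> K2, of "q / 2" w i] \<open>0 < q\<close> by (auto simp: half_gt_zero_iff)
  obtain \<gamma> where \<gamma>: "0 < \<gamma>" and surv: "\<forall>\<^sub>F h in at_right 0. survival_bound \<eta> \<gamma> (T + 1) K3 h"
    using survive[OF \<eta>, of "T + 1" K3] by (elim exE conjE)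
  obtain b D where b: "0 < b" "0 < D" and loc: "\<forall>\<^sub>F h in at_right 0. hit_step \<eta> r b D h"
    using hit_local[OF \<eta> r] by (elim exE conjE)
  \<comment> \<open>Within time \<open>hs\<close> the second-order loss in \<open>hit_local\<close> is at most one half.\<close>
  define hs where "hs = min T (1 / (2 * (b * (1 + K))))"
  have bK: "0 < b * (1 + K)" using b assms by simp
  have hs: "0 < hs" "hs \<le> T" using bK assms by (auto simp: hs_def)
  have bhs: "b * (1 + K) * hs \<le> 1 / 2"
  proof -
    have "b * (1 + K) * hs \<le> b * (1 + K) * (1 / (2 * (b * (1 + K))))"
      using bK by (intro mult_left_mono) (auto simp: hs_def)
    also have "\<dots> = 1 / 2"
    proof -
      have "k * (1 / (2 * k)) = 1 / 2" if "0 < k" for k :: real using that by simp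
      then show ?thesis using bK .
    qed
    finally show ?thesis .
  qed
  define p where "p = \<gamma> * \<kappa> * (hs / 2) * (1 / 2)"
  have p: "0 < p" using \<gamma> \<kappa> hs by (simp add: p_def)
  have "\<forall>\<^sub>F h in at_right 0.
    hit_bound w i \<delta> q K T p w' h"
    if w': "\<And>j. w $ j < w' $ j \<and> w' $ j \<le> w $ j + 1" for w'
  proof -
    have E: "- below w' \<union> above i (\<delta> / 2) \<subseteq> large_increments \<eta>"
    proof
      fix z assume "z \<in> - below w' \<union> above i (\<delta> / 2)"
      then consider j where "w' $ j < z $ j" | "\<delta> / 2 \<le> z $ i" by (auto simp: below_def above_def not_le)
      then show "z \<in> large_increments \<eta>"
      proof cases
        case (1 j)
        then have "\<eta> \<le> z $ j" using w'[of j] \<eta>w[of j] by linarith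
        then show ?thesis by (auto simp: large_increments_def)
      next
        case 2
        then have "\<eta> \<le> z $ i" by (simp add: \<eta>_def)
        then show ?thesis by (auto simp: large_increments_def)
      qed
    qed
    have wlt: "\<forall>j. w $ j < w' $ j" using w' by blast
    define d where "d = min (hs / 2) (D / (1 + K))"
    have "0 < d" using hs b assms by (simp add: d_def)
    then have "\<forall>\<^sub>F h in at_right 0. h < d" by (rule order_tendstoD(2)[OF tendsto_ident_at])
    moreover have "\<forall>\<^sub>F h in at_right 0. (0::real) < h" by (simp add: eventually_at_right_less)
    ultimately show ?thesis using hit[OF wlt] surv loc
    proof eventually_elim
      case (elim h)
      have h: "h \<le> hs / 2" "h * (1 + K) \<le> D"
      proof -
        have "h < D / (1 + K)" using elim(1) by (simp add: d_def)
        moreover have "0 < 1 + K" using assms by simp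
        ultimately have "h * (1 + K) < D" by (simp only: pos_less_divide_eq)
        then show "h * (1 + K) \<le> D" by simp
      qed (use elim(1) in \<open>simp add: d_def\<close>)
      show ?case unfolding hit_bound_def
      proof (intro allI impI ballI)
        fix n :: nat and y0 :: "real ^ 'd"
        assume n: "T \<le> real n * h \<and> real n * h \<le> T + 1" and y0: "y0 \<in> orthant_ball K" and qy: "q \<le> target_rate w i \<delta> y0"
        define n1 where "n1 = nat \<lfloor>hs / h\<rfloor>"
        have n1: "real n1 * h \<le> hs" "hs / 2 \<le> real n1 * h"
        proof -
          have "0 \<le> hs / h" using hs elim(2) by simp
          then have "real n1 = of_int \<lfloor>hs / h\<rfloor>" by (simp add: n1_def)
          then have "real n1 \<le> hs / h" "hs / h - 1 \<le> real n1" by linarith+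
          then have "real n1 * h \<le> hs" "hs - h \<le> real n1 * h" using elim(2) by (auto simp: field_simps)
          then show "real n1 * h \<le> hs" "hs / 2 \<le> real n1 * h" using h(1) by linarith+
        qed
        have "real n1 * h \<le> real n * h" using n1(1) hs(2) n by linarith
        then have "n1 \<le> n" using elim(2) by simp
        then obtain j where nj: "n = n1 + j" using le_Suc_ex by blast
        have yK: "mass y0 \<le> K" and yo: "y0 \<in> nonneg_orthant" using y0 by (auto simp: orthant_ball_def)
        have box: "y \<in> orthant_ball K2" if "y \<in> orthant_box y0 r" for y
          using mass_orthant_box[OF that r(2) yK] that by (simp add: orthant_ball_def orthant_box_def K2_def)
        have H1: "\<forall>y\<in>orthant_box y0 r. \<kappa> * h \<le> step_prob h y (below w' \<inter> above i (\<delta> / 2))"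
          using elim(3) box rate[OF qy] by blast
        have H2: "\<forall>m\<le>n1 + j. \<forall>y\<in>orthant_box y0 r. \<forall>y'\<in>nonneg_orthant. y' - y \<in> below w' \<longrightarrow>
            \<gamma> \<le> chain_prob h (below w') (above i (\<delta> / 2)) m True y'"
        proof (intro allI impI ballI)
          fix m :: nat and y y' :: "real ^ 'd"
          assume m: "m \<le> n1 + j" and y: "y \<in> orthant_box y0 r" and y': "y' \<in> nonneg_orthant" and z: "y' - y \<in> below w'"
          have "mass y' \<le> (\<Sum>j\<in>UNIV. y $ j + (w $ j + 1))" unfolding mass_def
          proof (rule sum_mono)
            fix j
            have "y' $ j - y $ j \<le> w' $ j" using z by (simp add: below_def)
            then show "y' $ j \<le> y $ j + (w $ j + 1)" using w'[of j] by linarith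
          qed
          also have "\<dots> = mass y + mass w + real CARD('d)" by (simp add: sum.distrib mass_def)
          finally have yK3: "y' \<in> orthant_ball K3" using box[OF y] y' by (simp add: orthant_ball_def K3_def)
          have "real m * h \<le> real n * h" using m nj elim(2) by (intro mult_right_mono) auto
          then have "real m * h \<le> T + 1" using n by linarith
          then show "\<gamma> \<le> chain_prob h (below w') (above i (\<delta> / 2)) m True y'"
            using elim(4) below_borel above_borel E yK3 unfolding survival_bound_def by blast
        qed
        have "\<gamma> * \<kappa> * (real n1 * h) * (1 - box_weight r * quad (y0 - y0) - b * (1 + K) * (real n1 * h))
           \<le> chain_prob h (below w') (above i (\<delta> / 2)) (n1 + j) False y0"
          using elim(5)[unfolded hit_step_def, rule_format, OF assms(4) yK h(2) below_borel above_borel E less_imp_le[OF \<gamma>] less_imp_le[OF \<kappa>]]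
            H1 H2 yo by blast
        moreover have "p \<le> \<gamma> * \<kappa> * (real n1 * h) * (1 - b * (1 + K) * (real n1 * h))"
          unfolding p_def
        proof (rule mult_mono)
          show "\<gamma> * \<kappa> * (hs / 2) \<le> \<gamma> * \<kappa> * (real n1 * h)" using n1 \<gamma> \<kappa> by (intro mult_left_mono) auto
          have "b * (1 + K) * (real n1 * h) \<le> b * (1 + K) * hs" using n1 bK by (intro mult_left_mono) auto
          then show "1 / 2 \<le> 1 - b * (1 + K) * (real n1 * h)" using bhs by linarith
          show "0 \<le> \<gamma> * \<kappa> * (real n1 * h)" using \<gamma> \<kappa> elim(2) by simp
        qed simp
        ultimately show "p \<le> chain_prob h (below w') (above i (\<delta> / 2)) n False y0" unfolding nj by simp
      qed
    qed
  qed
  then show ?thesis using p by blast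
qed

end

context cbi_path
begin

lemma start_AE: "AE \<omega> in M. X 0 \<omega> = x"
  using process by (simp add: markov_process_from_def)

lemma space_in_history: "space M \<in> sets (history s)"
  using sets.top[of "history s"] by simp

lemma grid_pattern_start:
  assumes "0 \<le> h" "E \<in> sets borel" "G \<in> sets borel"
  shows "prob {\<omega> \<in> space M. grid_pattern h E G n b 0 \<omega>} = chain_prob h E G n b x"
proof -
  have "emeasure M {\<omega> \<in> space M. grid_pattern h E G n b 0 \<omega>} =
      (\<integral>\<^sup>+ \<omega>. indicator (space M) \<omega> * ennreal (chain_prob h E G n b (X 0 \<omega>)) \<partial>M)"
    by (rule grid_pattern_prob[OF assms order_refl space_in_history])
  also have "\<dots> = (\<integral>\<^sup>+ \<omega>. ennreal (chain_prob h E G n b x) \<partial>M)"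
    using start_AE by (intro nn_integral_cong_AE) (auto simp: indicator_def)
  also have "\<dots> = ennreal (chain_prob h E G n b x)" by (simp add: emeasure_space_1)
  finally show ?thesis using chain_prob_nonneg[OF assms] by (simp add: measure_def)
qed

lemma X_law:
  assumes "0 \<le> s" "U \<in> sets orthant_space"
  shows "prob {\<omega> \<in> space M. X s \<omega> \<in> U} = measure (Q s x) U"
proof -
  interpret q: prob_space "Q s x" by (rule prob_space_Q[OF assms(1) start_nonneg])
  have "emeasure M (space M \<inter> (X (0 + s) -` U \<inter> space M)) =
      (\<integral>\<^sup>+ \<omega>. indicator (space M) \<omega> * emeasure (Q s (X 0 \<omega>)) U \<partial>M)"
    by (rule markov_rectangle[OF order_refl assms(1) space_in_history assms(2)])
  also have "\<dots> = (\<integral>\<^sup>+ \<omega>. emeasure (Q s x) U \<partial>M)"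
    using start_AE by (intro nn_integral_cong_AE) (auto simp: indicator_def)
  also have "\<dots> = emeasure (Q s x) U" by (simp add: emeasure_space_1)
  also have "space M \<inter> (X (0 + s) -` U \<inter> space M) = {\<omega> \<in> space M. X s \<omega> \<in> U}" by auto
  finally show ?thesis by (simp add: measure_def)
qed

end

section \<open>Positive probability of admissible suprema\<close>

context cbi_kernel
begin

lemma rectangle_eq_Union_target:
  "cbox 0 w - {0} = (\<Union>i. \<Union>n. target w i (1 / real (Suc n)))"
proof (intro set_eqI iffI)
  fix z assume z: "z \<in> cbox 0 w - {0}"
  then have z0: "0 \<le> z $ j" "z $ j \<le> w $ j" for j by (auto simp: mem_box_cart)
  obtain i where "z $ i \<noteq> 0" using z by (auto simp: vec_eq_iff)
  then have "0 < z $ i" using z0(1)[of i] by linarith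
  then obtain n where "inverse (real (Suc n)) < z $ i" using reals_Archimedean by blast
  then have "z \<in> target w i (1 / real (Suc n))"
    using z z0 by (auto simp: target_def punctured_orthant_def nonneg_orthant_def inverse_eq_divide)
  then show "z \<in> (\<Union>i. \<Union>n. target w i (1 / real (Suc n)))" by blast
next
  fix z assume "z \<in> (\<Union>i. \<Union>n. target w i (1 / real (Suc n)))"
  then show "z \<in> cbox 0 w - {0}"
    by (auto simp: target_def punctured_orthant_def nonneg_orthant_def mem_box_cart)
qed

text \<open>The rectangle is a countable union of targets, so one of them is charged.\<close>

lemma target_of_positive_rectangle:
  assumes "emeasure \<nu> (cbox 0 w - {0}) + (\<Sum>j\<in>UNIV. emeasure (\<mu> j) (cbox 0 w - {0})) \<noteq> 0"
  shows "\<exists>i. \<exists>\<delta>>0. 0 < measure \<nu> (target w i \<delta>) \<or> (\<exists>j. 0 < measure (\<mu> j) (target w i \<delta>))"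
proof (rule ccontr)
  assume *: "\<not> ?thesis"
  have zero: "emeasure N (cbox 0 w - {0}) = 0"
    if N: "\<And>i \<delta>. target w i \<delta> \<in> sets N" "\<And>i \<delta>. 0 < \<delta> \<Longrightarrow> emeasure N (target w i \<delta>) < \<infinity>"
      and m: "\<And>i \<delta>. 0 < \<delta> \<Longrightarrow> \<not> 0 < measure N (target w i \<delta>)" for N
  proof -
    have "target w i (1 / real (Suc n)) \<in> null_sets N" for i n
    proof (rule null_setsI)
      have p: "0 < 1 / real (Suc n)" by simp
      have "measure N (target w i (1 / real (Suc n))) = 0"
        using m[OF p, of i] zero_less_measure_iff by blast
      then show "emeasure N (target w i (1 / real (Suc n))) = 0"
        using N(2)[OF p, of i] by (simp add: emeasure_eq_ennreal_measure less_top)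
    qed (rule N(1))
    then have "(\<Union>i. \<Union>n. target w i (1 / real (Suc n))) \<in> null_sets N"
      by (intro null_sets_UN'[OF countable_finite[OF finite]] null_sets_UN)
    then show ?thesis unfolding rectangle_eq_Union_target by (rule null_setsD1)
  qed
  have "emeasure \<nu> (cbox 0 w - {0}) = 0" "emeasure (\<mu> j) (cbox 0 w - {0}) = 0" for j
    using * by (intro zero target_sets target_finite; blast)+
  then show False using assms by simp
qed

end

context cbi_path
begin

lemma grid_pattern_append:
  assumes "s = real m * h"
  shows "grid_pattern h E G (m + n) b 0 \<omega> \<longleftrightarrow>
    (\<forall>k<m. grid_increment h 0 k \<omega> \<in> E) \<and>
    grid_pattern h E G n (b \<or> (\<exists>k<m. grid_increment h 0 k \<omega> \<in> G)) s \<omega>"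
proof -
  have inc: "grid_increment h s k \<omega> = grid_increment h 0 (m + k) \<omega>" for k
  proof -
    have "s + real (Suc k) * h = 0 + real (Suc (m + k)) * h" "s + real k * h = 0 + real (m + k) * h"
      by (simp_all add: assms algebra_simps)
    then show ?thesis unfolding grid_increment_def by (simp only:)
  qed
  have *: "(\<forall>k<m + n. R k) \<longleftrightarrow> (\<forall>k<m. R k) \<and> (\<forall>k<n. R (m + k))" for R :: "nat \<Rightarrow> bool"
  proof safe
    fix k assume "\<forall>k<m. R k" "\<forall>k<n. R (m + k)" "k < m + n"
    then show "R k" by (cases "k < m") (auto dest: spec[of _ "k - m"])
  qed auto
  show ?thesis
    unfolding grid_pattern_def inc using *[of "\<lambda>k. grid_increment h 0 k \<omega> \<in> E"]
      *[of "\<lambda>k. grid_increment h 0 k \<omega> \<notin> G"] by blast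
qed

lemma grid_pattern_history:
  assumes "0 \<le> h" "E \<in> sets borel"
  shows "{\<omega> \<in> space M. grid_pattern h E G n True 0 \<omega>} \<in> sets (history (real n * h))"
proof -
  have "{\<omega> \<in> space (history (real n * h)). \<forall>k\<in>{..<n}. grid_increment h 0 k \<omega> \<in> E} \<in> sets (history (real n * h))"
  proof (rule sets.sets_Collect_finite_All)
    fix k assume k: "k \<in> {..<n}"
    have le: "0 \<le> real k * h" "real k * h \<le> real (Suc k) * h" "real (Suc k) * h \<le> real n * h"
      using k assms(1) by (simp, intro mult_right_mono, simp, simp, intro mult_right_mono, simp, simp)
    have eq: "grid_increment h 0 k \<omega> = X (real (Suc k) * h) \<omega> - X (real k * h) \<omega>" for \<omega>
      by (simp only: grid_increment_def add_0)
    show "{\<omega> \<in> space (history (real n * h)). grid_increment h 0 k \<omega> \<in> E} \<in> sets (history (real n * h))"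
      unfolding space_history eq by (rule increment_history[OF le space_in_history assms(2)])
  qed simp
  moreover have "{\<omega> \<in> space M. grid_pattern h E G n True 0 \<omega>} =
      {\<omega> \<in> space (history (real n * h)). \<forall>k\<in>{..<n}. grid_increment h 0 k \<omega> \<in> E}"
    by (simp add: grid_pattern_def Ball_def)
  ultimately show ?thesis by (simp only:)
qed

lemma filterlim_grid_step:
  assumes "0 < t" "0 < L"
  shows "filterlim (\<lambda>N. t / real (L * N)) (at_right 0) sequentially"
proof -
  have "(\<lambda>N. (t / real L) * (1 / real N)) \<longlonglongrightarrow> (t / real L) * 0"
    by (intro tendsto_mult tendsto_const lim_1_over_n)
  then have "(\<lambda>N. t / real (L * N)) \<longlonglongrightarrow> 0" by simp
  moreover have "\<forall>\<^sub>F N in sequentially. t / real (L * N) \<in> {0<..} \<and> t / real (L * N) \<noteq> 0"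
    using eventually_gt_at_top[of 0] by eventually_elim (use assms in simp)
  ultimately show ?thesis by (simp add: filterlim_at)
qed

text \<open>The Markov property at time \<open>t / L\<close> joins \<open>reach_positive_rate\<close> with \<open>hit_and_survive\<close>.  The bound
  is the same for all \<open>w'\<close>, which may therefore decrease to \<open>w\<close> afterwards.\<close>

lemma grid_pattern_lower_bound:
  assumes w: "w \<in> pos_orthant" and \<delta>: "0 < \<delta>" and t: "0 < t"
    and int: "x \<in> pos_orthant \<or> \<beta> \<in> pos_orthant"
    and pos: "0 < measure \<nu> (target w i \<delta>) \<or> (\<exists>j. 0 < measure (\<mu> j) (target w i \<delta>))"
  shows "\<exists>p>0. \<exists>L>0. \<forall>w'. (\<forall>j. w $ j < w' $ j \<and> w' $ j \<le> w $ j + 1) \<longrightarrow> (\<forall>\<^sub>F N in sequentially.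
    p \<le> prob {\<omega> \<in> space M. grid_pattern (t / real (L * N)) (below w') (above i (\<delta> / 2)) (L * N) False 0 \<omega>})"
proof -
  define \<eta> where "\<eta> = Min (range (($) w))"
  have \<eta>: "0 < \<eta>" using w by (simp add: \<eta>_def pos_orthant_def)
  have \<eta>w: "\<eta> \<le> w $ j" for j unfolding \<eta>_def by simp
  obtain b D where b: "0 < b" "0 < D" and loc: "\<forall>\<^sub>F h in at_right 0. survival_step \<eta> b D h"
    using survive_local[OF \<eta>] by (elim exE conjE)
  define K where "K = mass x"
  have K: "0 \<le> K" unfolding K_def by (rule mass_nonneg[OF start_nonneg])
  define b' where "b' = b * (1 + K)"
  have "\<forall>\<^sub>F L in sequentially. b' * (t / real (1 * L)) < measure (Q (t / real (1 * L)) x) {y \<in> nonneg_orthant. 0 < target_rate w i \<delta> y}"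
    using filterlim_iff[THEN iffD1, OF filterlim_grid_step[OF t zero_less_one]]
      reach_positive_rate[OF start_nonneg int pos, of b'] by blast
  then have "\<forall>\<^sub>F L in sequentially. 2 \<le> L \<and> b' * (t / real L) < measure (Q (t / real L) x) {y \<in> nonneg_orthant. 0 < target_rate w i \<delta> y}"
    using eventually_ge_at_top[of 2] by eventually_elim simp
  then obtain L where L: "2 \<le> L" and reach: "b' * (t / real L) < measure (Q (t / real L) x) {y \<in> nonneg_orthant. 0 < target_rate w i \<delta> y}"
    unfolding eventually_sequentially by blast
  define s where "s = t / real L"
  have s: "0 < s" using t L by (simp add: s_def)
  obtain q K1 where q: "0 < q" and K1: "0 \<le> K1"
    and U: "b' * s < measure (Q s x) {y \<in> nonneg_orthant. q \<le> target_rate w i \<delta> y \<and> mass y \<le> K1}"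
    using reach_uniform_rate[OF start_nonneg less_imp_le[OF s] reach[folded s_def]] by blast
  define U' where "U' = {y \<in> nonneg_orthant. q \<le> target_rate w i \<delta> y \<and> mass y \<le> K1}"
  have U'S: "U' \<in> sets orthant_space" unfolding U'_def by (rule target_rate_set(1))
  \<comment> \<open>A large increment up to time \<open>s\<close> has probability at most \<open>b' * s\<close>, so \<open>\<epsilon>\<close> is left over.\<close>
  define \<epsilon> where "\<epsilon> = measure (Q s x) U' - b' * s"
  have \<epsilon>: "0 < \<epsilon>" using U by (simp add: \<epsilon>_def U'_def)
  define T where "T = real (L - 1) * s"
  have T: "0 < T" using s L by (simp add: T_def)
  obtain p1 where p1: "0 < p1" and hit: "\<And>w'. (\<forall>j. w $ j < w' $ j \<and> w' $ j \<le> w $ j + 1) \<Longrightarrow> (\<forall>\<^sub>F h in at_right 0.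
    hit_bound w i \<delta> q K1 T p1 w' h)"
    using hit_and_survive[OF w \<delta> q K1 T, of i] by (elim exE conjE) blast
  define p where "p = p1 * \<epsilon>"
  have p: "0 < p" using p1 \<epsilon> by (simp add: p_def)
  have main: "\<forall>\<^sub>F N in sequentially.
    p \<le> prob {\<omega> \<in> space M. grid_pattern (t / real (L * N)) (below w') (above i (\<delta> / 2)) (L * N) False 0 \<omega>}"
    if w': "\<forall>j. w $ j < w' $ j \<and> w' $ j \<le> w $ j + 1" for w'
  proof -
    let ?E = "below w'" and ?G = "above i (\<delta> / 2)"
    have E: "- ?E \<subseteq> large_increments \<eta>"
    proof
      fix z assume "z \<in> - below w'"
      then obtain j where "w' $ j < z $ j" by (auto simp: below_def not_le)
      then have "\<eta> \<le> z $ j" using w'[rule_format, of j] \<eta>w[of j] by linarith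
      then show "z \<in> large_increments \<eta>" by (auto simp: large_increments_def)
    qed
    have "0 < D / (1 + K)" using b K by simp
    then have "\<forall>\<^sub>F h in at_right 0. h < D / (1 + K)" by (rule order_tendstoD(2)[OF tendsto_ident_at])
    then have "\<forall>\<^sub>F h in at_right 0. h < D / (1 + K) \<and>
      (\<forall>n. 1 - b' * (real n * h) \<le> chain_prob h ?E ?G n True x) \<and>
      hit_bound w i \<delta> q K1 T p1 w' h"
      using loc hit[OF w']
    proof eventually_elim
      case (elim h)
      have "0 < 1 + K" using K by simp
      then have hK: "h * (1 + K) < D" using elim(1) by (simp only: pos_less_divide_eq)
      have "1 - b' * (real n * h) \<le> chain_prob h ?E ?G n True x" for n
      proof -
        have "1 * (1 - box_weight 1 * quad (x - x) - b * (1 + K) * (real n * h)) \<le> chain_prob h ?E ?G (n + 0) True x"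
          by (rule elim(2)[unfolded survival_step_def, rule_format, OF K _ less_imp_le[OF hK] below_borel above_borel E _ _ start_nonneg])
             (simp_all add: K_def)
        then show ?thesis by (simp add: b'_def)
      qed
      then show ?case using elim by blast
    qed
    then have "\<forall>\<^sub>F N in sequentially. t / real (L * N) < D / (1 + K) \<and>
      (\<forall>n. 1 - b' * (real n * (t / real (L * N))) \<le> chain_prob (t / real (L * N)) ?E ?G n True x) \<and>
      hit_bound w i \<delta> q K1 T p1 w' (t / real (L * N))"
      using filterlim_iff[THEN iffD1, OF filterlim_grid_step[OF t, of L]] L by auto
    then show ?thesis using eventually_gt_at_top[of 0]
    proof eventually_elim
      case (elim N)
      define h where "h = t / real (L * N)"
      have h: "0 \<le> h" using t by (simp add: h_def)
      have Nh: "real N * h = s" using elim(2) by (simp add: h_def s_def)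
      have Th: "real ((L - 1) * N) * h = T"
      proof -
        have "real ((L - 1) * N) * h = real (L - 1) * (real N * h)" by simp
        then show ?thesis unfolding Nh T_def .
      qed
      note pos' = elim(1)[folded h_def]
      define A1 where "A1 = {\<omega> \<in> space M. grid_pattern h ?E ?G N True 0 \<omega>}"
      define A2 where "A2 = {\<omega> \<in> space M. X s \<omega> \<in> U'}"
      have A1: "A1 \<in> sets (history s)" unfolding A1_def Nh[symmetric]
        by (rule grid_pattern_history[OF h below_borel])
      have A2: "A2 \<in> sets (history s)"
        using measurable_sets[OF X_history_measurable[OF less_imp_le[OF s] order_refl] U'S]
        by (simp add: A2_def vimage_def Int_def conj_commute)
      have A: "A1 \<inter> A2 \<in> sets (history s)" using A1 A2 by (rule sets.Int)
      have "prob A1 = chain_prob h ?E ?G N True x"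
        unfolding A1_def by (rule grid_pattern_start[OF h below_borel above_borel])
      then have P1: "1 - b' * s \<le> prob A1" using pos'[THEN conjunct2, THEN conjunct1, rule_format, of N] unfolding Nh by simp
      have P2: "prob A2 = measure (Q s x) U'" unfolding A2_def by (rule X_law[OF less_imp_le[OF s] U'S])
      have "prob (A1 \<union> A2) + prob (A1 \<inter> A2) = prob A1 + prob A2"
        using finite_measure_Union'[OF history_sets[OF A1] history_sets[OF A2]]
          finite_measure_Diff'[OF history_sets[OF A2] history_sets[OF A1]] by (simp add: Int_commute)
      then have PA: "\<epsilon> \<le> prob (A1 \<inter> A2)" using P1 P2 prob_le_1[of "A1 \<union> A2"] unfolding \<epsilon>_def by linarith
      have chain: "p1 \<le> chain_prob h ?E ?G ((L - 1) * N) False (X s \<omega>)" if "\<omega> \<in> A1 \<inter> A2" for \<omega>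
      proof -
        have "X s \<omega> \<in> orthant_ball K1" "q \<le> target_rate w i \<delta> (X s \<omega>)"
          using that by (auto simp: A2_def U'_def orthant_ball_def)
        moreover have "T \<le> real ((L - 1) * N) * h \<and> real ((L - 1) * N) * h \<le> T + 1" unfolding Th by simp
        ultimately show ?thesis
          by (intro pos'[THEN conjunct2, THEN conjunct2, unfolded hit_bound_def, rule_format])
      qed
      have "ennreal p \<le> ennreal (p1 * prob (A1 \<inter> A2))"
        unfolding p_def using PA p1 by (intro ennreal_leI mult_left_mono) auto
      also have "\<dots> = (\<integral>\<^sup>+ \<omega>. ennreal p1 * indicator (A1 \<inter> A2) \<omega> \<partial>M)"
        using history_sets[OF A] p1 by (simp add: nn_integral_cmult emeasure_eq_measure ennreal_mult)
      also have "\<dots> \<le> (\<integral>\<^sup>+ \<omega>. indicator (A1 \<inter> A2) \<omega> * ennreal (chain_prob h ?E ?G ((L - 1) * N) False (X s \<omega>)) \<partial>M)"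
        using chain by (intro nn_integral_mono) (auto simp: indicator_def intro!: ennreal_leI)
      also have "\<dots> = emeasure M {\<omega> \<in> A1 \<inter> A2. grid_pattern h ?E ?G ((L - 1) * N) False s \<omega>}"
        by (rule grid_pattern_prob[symmetric, OF h below_borel above_borel less_imp_le[OF s] A])
      also have "\<dots> \<le> emeasure M {\<omega> \<in> space M. grid_pattern h ?E ?G (L * N) False 0 \<omega>}"
      proof (rule emeasure_mono)
        show "{\<omega> \<in> space M. grid_pattern h ?E ?G (L * N) False 0 \<omega>} \<in> sets M"
          by (rule grid_pattern_sets[OF h order_refl below_borel above_borel sets.top])
        have LN: "L * N = N + (L - 1) * N" using L by (cases L) auto
        show "{\<omega> \<in> A1 \<inter> A2. grid_pattern h ?E ?G ((L - 1) * N) False s \<omega>} \<subseteq> {\<omega> \<in> space M. grid_pattern h ?E ?G (L * N) False 0 \<omega>}"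
          unfolding LN grid_pattern_append[OF Nh[symmetric]]
          by (auto simp: A1_def grid_pattern_def)
      qed
      finally show ?case unfolding h_def[symmetric] emeasure_eq_measure
        by (simp add: ennreal_le_iff)
    qed
  qed
  then show ?thesis using p L by (intro exI[of _ p] conjI exI[of _ L] allI impI) auto
qed

abbreviation "path_sup_jump t \<omega> \<equiv> sup_jump (\<lambda>s. X s \<omega>) t"

lemma grid_max_path:
  "grid_max (\<lambda>s. X s \<omega> $ j) t N = Max ((\<lambda>k. grid_increment (t / real N) 0 k \<omega> $ j) ` {..<N})"
  by (simp add: grid_max_def grid_increment_def)

lemma path_grid_max_tendsto:
  assumes "\<omega> \<in> space M" "0 < t"
  shows "grid_max (\<lambda>s. X s \<omega> $ j) t \<longlonglongrightarrow> path_sup_jump t \<omega> $ j"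
  by (rule grid_max_tendsto_sup_jump[OF cadlag_paths[OF assms(1)] assms(2)])

lemma path_sup_jump_component_measurable:
  assumes "0 < t"
  shows "(\<lambda>\<omega>. path_sup_jump t \<omega> $ j) \<in> borel_measurable M"
proof (rule borel_measurable_LIMSEQ_real)
  show "(\<lambda>N. grid_max (\<lambda>s. X s \<omega> $ j) t N) \<longlonglongrightarrow> path_sup_jump t \<omega> $ j" if "\<omega> \<in> space M" for \<omega>
    using path_grid_max_tendsto[OF that assms] by simp
  show "(\<lambda>\<omega>. grid_max (\<lambda>s. X s \<omega> $ j) t N) \<in> borel_measurable M" for N
    unfolding grid_max_path using assms
    by (intro borel_measurable_Max measurable_compose[OF grid_increment_borel measurable_component]) auto
qed

lemma path_sup_jump_measurable:
  assumes "0 < t"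
  shows "path_sup_jump t \<in> M \<rightarrow>\<^sub>M orthant_space"
  unfolding orthant_space_def
proof (rule measurable_restrict_space2)
  show "path_sup_jump t \<in> space M \<rightarrow> nonneg_orthant"
    using sup_jump_nonneg[OF cadlag_paths assms] by auto
  show "path_sup_jump t \<in> borel_measurable M"
    unfolding borel_measurable_euclidean_space[of "path_sup_jump t"]
    using path_sup_jump_component_measurable[OF assms] by (auto simp: Basis_vec_def inner_axis)
qed

lemma prob_INT_ge:
  fixes V :: "nat \<Rightarrow> 'w set"
  assumes "range V \<subseteq> sets M" "decseq V" "\<And>n. p \<le> prob (V n)"
  shows "p \<le> prob (\<Inter>n. V n)"
  using finite_Lim_measure_decseq[OF assms(1,2)] assms(3) by (intro LIMSEQ_le_const) auto

text \<open>For fixed \<open>w'\<close> the bound on every fine grid passes to the event that the pattern occurs on infinitely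
  many grids, and hence to the supremum of the jumps; for \<open>w'\<close> decreasing to \<open>w\<close> these events decrease.\<close>

lemma sup_jump_probability_positive:
  assumes w: "w \<in> pos_orthant" and t: "0 < t"
    and int: "x \<in> pos_orthant \<or> \<beta> \<in> pos_orthant"
    and nz: "emeasure \<nu> (cbox 0 w - {0}) + (\<Sum>j\<in>UNIV. emeasure (\<mu> j) (cbox 0 w - {0})) \<noteq> 0"
  shows "0 < prob {\<omega> \<in> space M. path_sup_jump t \<omega> \<in> cbox 0 w - {0}}"
proof -
  obtain i \<delta> where \<delta>: "0 < \<delta>" and pos: "0 < measure \<nu> (target w i \<delta>) \<or> (\<exists>j. 0 < measure (\<mu> j) (target w i \<delta>))"
    using target_of_positive_rectangle[OF nz] by blast
  obtain p L where p: "0 < p" and L: "0 < L" and low: "\<forall>w'. (\<forall>j. w $ j < w' $ j \<and> w' $ j \<le> w $ j + 1) \<longrightarrow> (\<forall>\<^sub>F N in sequentially.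
    p \<le> prob {\<omega> \<in> space M. grid_pattern (t / real (L * N)) (below w') (above i (\<delta> / 2)) (L * N) False 0 \<omega>})"
    using grid_pattern_lower_bound[OF w \<delta> t int pos] by (elim exE conjE)
  note Sm = path_sup_jump_component_measurable[OF t, measurable]
  define F where "F m = {\<omega> \<in> space M. (\<forall>j. path_sup_jump t \<omega> $ j \<le> w $ j + 1 / real (Suc m)) \<and> \<delta> / 2 \<le> path_sup_jump t \<omega> $ i}" for m
  have Fs: "F m \<in> sets M" for m unfolding F_def by measurable
  have Fp: "p \<le> prob (F m)" for m
  proof -
    define w' :: "real ^ 'd" where "w' = (\<chi> j. w $ j + 1 / real (Suc m))"
    define V where "V N = {\<omega> \<in> space M. grid_pattern (t / real (L * N)) (below w') (above i (\<delta> / 2)) (L * N) False 0 \<omega>}" for N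
    have Vs: "V N \<in> sets M" for N
      unfolding V_def using t by (intro grid_pattern_sets below_borel above_borel sets.top) auto
    have "\<forall>\<^sub>F N in sequentially. p \<le> prob (V N)"
      unfolding V_def by (rule low[rule_format]) (simp add: w'_def)
    then obtain N0 where N0: "\<And>N. N0 \<le> N \<Longrightarrow> p \<le> prob (V N)" unfolding eventually_sequentially by blast
    have "p \<le> prob (\<Inter>n. \<Union>N\<in>{n..}. V N)"
    proof (rule prob_INT_ge)
      show "decseq (\<lambda>n. \<Union>N\<in>{n..}. V N)" by (intro decseq_SucI UN_mono) auto
      fix n
      have "p \<le> prob (V (max n N0))" by (rule N0) simp
      also have "\<dots> \<le> prob (\<Union>N\<in>{n..}. V N)" using Vs by (intro finite_measure_mono UN_upper) auto
      finally show "p \<le> prob (\<Union>N\<in>{n..}. V N)" .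
    qed (use Vs in auto)
    also have "\<dots> \<le> prob (F m)"
    proof (rule finite_measure_mono[OF _ Fs], rule subsetI)
      fix \<omega> assume \<omega>: "\<omega> \<in> (\<Inter>n. \<Union>N\<in>{n..}. V N)"
      then have sp: "\<omega> \<in> space M" by (auto simp: V_def)
      have freq: "\<exists>N\<ge>n. \<omega> \<in> V N" for n using \<omega> by blast
      have "filterlim (\<lambda>N. L * N) sequentially sequentially"
        using L by (intro filterlim_subseq strict_monoI) simp
      then have lim: "(\<lambda>N. grid_max (\<lambda>s. X s \<omega> $ j) t (L * N)) \<longlonglongrightarrow> path_sup_jump t \<omega> $ j" for j
        using path_grid_max_tendsto[OF sp t] by (rule filterlim_compose[rotated])
      have V: "grid_max (\<lambda>s. X s \<omega> $ j) t (L * N) \<le> w' $ j" "\<delta> / 2 \<le> grid_max (\<lambda>s. X s \<omega> $ i) t (L * N)"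
        if "\<omega> \<in> V N" for N j
      proof -
        have all: "\<forall>k<L * N. grid_increment (t / real (L * N)) 0 k \<omega> \<in> below w'"
          and "\<exists>k<L * N. grid_increment (t / real (L * N)) 0 k \<omega> \<in> above i (\<delta> / 2)"
          using that unfolding V_def grid_pattern_def by auto
        then obtain k where k: "k < L * N" "\<delta> / 2 \<le> grid_increment (t / real (L * N)) 0 k \<omega> $ i"
          by (auto simp: above_def)
        show "grid_max (\<lambda>s. X s \<omega> $ j) t (L * N) \<le> w' $ j"
          unfolding grid_max_path using k(1) all by (subst Max_le_iff) (auto simp: below_def)
        show "\<delta> / 2 \<le> grid_max (\<lambda>s. X s \<omega> $ i) t (L * N)"
          unfolding grid_max_path using k by (intro order_trans[OF k(2)] Max_ge) auto
      qed
      have "path_sup_jump t \<omega> $ j \<le> w' $ j" for j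
      proof (rule ccontr)
        assume "\<not> ?thesis"
        then have "w' $ j < path_sup_jump t \<omega> $ j" by simp
        from order_tendstoD(1)[OF lim this]
        obtain n where "\<And>N. n \<le> N \<Longrightarrow> w' $ j < grid_max (\<lambda>s. X s \<omega> $ j) t (L * N)"
          unfolding eventually_sequentially by blast
        moreover obtain N where "n \<le> N" "\<omega> \<in> V N" using freq[of n] by blast
        ultimately show False using V(1)[of N j] by (simp add: not_le[symmetric])
      qed
      moreover have "\<delta> / 2 \<le> path_sup_jump t \<omega> $ i"
      proof (rule ccontr)
        assume "\<not> ?thesis"
        then have "path_sup_jump t \<omega> $ i < \<delta> / 2" by simp
        from order_tendstoD(2)[OF lim this]
        obtain n where "\<And>N. n \<le> N \<Longrightarrow> grid_max (\<lambda>s. X s \<omega> $ i) t (L * N) < \<delta> / 2"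
          unfolding eventually_sequentially by blast
        moreover obtain N where "n \<le> N" "\<omega> \<in> V N" using freq[of n] by blast
        ultimately show False using V(2)[of N] by (simp add: not_le[symmetric])
      qed
      ultimately show "\<omega> \<in> F m" using sp by (simp add: F_def w'_def)
    qed
    finally show ?thesis .
  qed
  have "p \<le> prob (\<Inter>m. F m)"
  proof (rule prob_INT_ge)
    show "decseq F"
    proof (rule decseq_SucI, rule subsetI)
      fix m \<omega> assume \<omega>: "\<omega> \<in> F (Suc m)"
      have "path_sup_jump t \<omega> $ j \<le> w $ j + 1 / real (Suc m)" for j
        
      proof -
        have "path_sup_jump t \<omega> $ j \<le> w $ j + 1 / real (Suc (Suc m))" using \<omega> by (simp add: F_def)
        also have "\<dots> \<le> w $ j + 1 / real (Suc m)" by (intro add_left_mono divide_left_mono) auto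
        finally show ?thesis .
      qed
      then show "\<omega> \<in> F m" using \<omega> by (simp add: F_def)
    qed
  qed (use Fs Fp in auto)
  also have "\<dots> \<le> prob {\<omega> \<in> space M. path_sup_jump t \<omega> \<in> cbox 0 w - {0}}"
  proof (rule finite_measure_mono)
    have "cbox 0 w - {0} \<in> sets (orthant_space :: (real ^ 'd) measure)"
      unfolding orthant_space_def
      by (subst sets_restrict_space_iff) (auto simp: nonneg_orthant_def mem_box_cart)
    from measurable_sets[OF path_sup_jump_measurable[OF t] this]
    show "{\<omega> \<in> space M. path_sup_jump t \<omega> \<in> cbox 0 w - {0}} \<in> sets M"
      by (simp add: vimage_def Int_def conj_commute)
    show "(\<Inter>m. F m) \<subseteq> {\<omega> \<in> space M. path_sup_jump t \<omega> \<in> cbox 0 w - {0}}"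
    proof (rule subsetI)
      fix \<omega> assume \<omega>: "\<omega> \<in> (\<Inter>m. F m)"
      then have sp: "\<omega> \<in> space M" and i: "\<delta> / 2 \<le> path_sup_jump t \<omega> $ i"
        and le: "\<And>m j. path_sup_jump t \<omega> $ j \<le> w $ j + 1 / real (Suc m)" by (auto simp: F_def)
      have "path_sup_jump t \<omega> $ j \<le> w $ j" for j
      proof (rule field_le_epsilon)
        fix e :: real assume "0 < e"
        then obtain m where "inverse (real (Suc m)) < e" using reals_Archimedean by blast
        then show "path_sup_jump t \<omega> $ j \<le> w $ j + e" using le[of j m] by (simp add: inverse_eq_divide)
      qed
      moreover have "path_sup_jump t \<omega> \<in> nonneg_orthant" by (rule sup_jump_nonneg[OF cadlag_paths[OF sp] t])
      moreover have "path_sup_jump t \<omega> \<noteq> 0" using i \<delta> by auto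
      ultimately show "\<omega> \<in> {\<omega> \<in> space M. path_sup_jump t \<omega> \<in> cbox 0 w - {0}}"
        using sp by (simp add: mem_box_cart nonneg_orthant_def)
    qed
  qed
  finally show ?thesis using p by simp
qed

end

section \<open>Absence of small suprema and the conclusion\<close>

context cbi_path
begin

lemma path_bounded:
  assumes "\<omega> \<in> space M" "0 < t"
  shows "\<exists>n :: nat. \<forall>u. 0 \<le> u \<longrightarrow> u \<le> t \<longrightarrow> mass (X u \<omega>) \<le> real n"
proof -
  have "\<forall>j. \<exists>C. \<forall>u. 0 \<le> u \<longrightarrow> u \<le> t \<longrightarrow> \<bar>X u \<omega> $ j\<bar> \<le> C"
  proof
    fix j
    have "cadlag (\<lambda>u. X u \<omega> $ j)" by (rule cadlag_component[OF cadlag_paths[OF assms(1)]])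
    then show "\<exists>C. \<forall>u. 0 \<le> u \<longrightarrow> u \<le> t \<longrightarrow> \<bar>X u \<omega> $ j\<bar> \<le> C"
    proof (rule cadlag_bounded[OF _ assms(2)])
      fix C assume "\<And>u. 0 \<le> u \<Longrightarrow> u \<le> t \<Longrightarrow> \<bar>X u \<omega> $ j\<bar> \<le> C"
      then show ?thesis by (intro exI[of _ C] allI impI)
    qed
  qed
  then obtain C where C: "\<forall>j u. 0 \<le> u \<longrightarrow> u \<le> t \<longrightarrow> \<bar>X u \<omega> $ j\<bar> \<le> C j"
    unfolding choice_iff by (elim exE)
  obtain n :: nat where n: "(\<Sum>j\<in>UNIV. C j) \<le> real n" using real_arch_simple by blast
  have "mass (X u \<omega>) \<le> real n" if "0 \<le> u" "u \<le> t" for u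
  proof -
    have "mass (X u \<omega>) \<le> (\<Sum>j\<in>UNIV. C j)" unfolding mass_def
      by (rule sum_mono) (rule order_trans[OF abs_ge_self C[rule_format, OF that]])
    then show ?thesis using n by linarith
  qed
  then show ?thesis by (intro exI[of _ n] allI impI)
qed

lemma single_increment_probability:
  assumes "0 \<le> h" "0 \<le> s" and D: "D \<in> sets borel" and "0 \<le> r"
    and rate: "\<And>y. y \<in> orthant_ball K \<Longrightarrow> step_prob h y D \<le> r"
  shows "{\<omega> \<in> space M. X s \<omega> \<in> orthant_ball K \<and> X (s + h) \<omega> - X s \<omega> \<in> D} \<in> sets M \<and>
    prob {\<omega> \<in> space M. X s \<omega> \<in> orthant_ball K \<and> X (s + h) \<omega> - X s \<omega> \<in> D} \<le> r"
proof -
  define A where "A = {\<omega> \<in> space M. X s \<omega> \<in> orthant_ball K}"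
  have "mass \<in> borel_measurable (borel :: (real ^ 'd) measure)"
    unfolding mass_def[abs_def] by (intro borel_measurable_sum measurable_component)
  then have "{y :: real ^ 'd. mass y \<le> K} \<in> sets borel"
    using borel_measurable_le[of mass borel "\<lambda>_. K"] by simp
  then have "{y \<in> (nonneg_orthant :: (real ^ 'd) set). mass y \<le> K} \<in> sets orthant_space"
    by (rule orthant_event_sets)
  then have "(orthant_ball K :: (real ^ 'd) set) \<in> sets orthant_space" by (simp add: orthant_ball_def)
  from measurable_sets[OF X_history_measurable[OF assms(2) order_refl] this]
  have A: "A \<in> sets (history s)" by (simp add: A_def vimage_def Int_def conj_commute)
  have eq: "{\<omega> \<in> space M. X s \<omega> \<in> orthant_ball K \<and> X (s + h) \<omega> - X s \<omega> \<in> D} =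
      {\<omega> \<in> A. grid_pattern h D {} 1 True s \<omega>}"
    by (auto simp: A_def grid_pattern_def grid_increment_def)
  have S: "{\<omega> \<in> A. grid_pattern h D {} 1 True s \<omega>} \<in> sets M"
    by (intro grid_pattern_sets assms sets.empty_sets history_sets[OF A])
  have "emeasure M {\<omega> \<in> A. grid_pattern h D {} 1 True s \<omega>} =
      (\<integral>\<^sup>+ \<omega>. indicator A \<omega> * ennreal (chain_prob h D {} 1 True (X s \<omega>)) \<partial>M)"
    by (intro grid_pattern_prob assms A sets.empty_sets)
  also have "\<dots> \<le> (\<integral>\<^sup>+ \<omega>. ennreal r \<partial>M)"
  proof (rule nn_integral_mono)
    fix \<omega>
    show "indicator A \<omega> * ennreal (chain_prob h D {} 1 True (X s \<omega>)) \<le> ennreal r"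
    proof (cases "\<omega> \<in> A")
      case True
      then have y: "X s \<omega> \<in> orthant_ball K" by (simp add: A_def)
      then have yo: "X s \<omega> \<in> nonneg_orthant" by (simp add: orthant_ball_def)
      have "chain_prob h D {} 1 True (X s \<omega>) \<le> r"
        using rate[OF y] integral_increment_indicator[OF assms(1) yo D] by simp
      then show ?thesis using True by (simp add: ennreal_leI del: chain_prob.simps)
    qed simp
  qed
  also have "\<dots> = ennreal r" by (simp add: emeasure_space_1)
  finally have "prob {\<omega> \<in> A. grid_pattern h D {} 1 True s \<omega>} \<le> r"
    using assms(4) by (simp add: emeasure_eq_measure)
  then show ?thesis unfolding eq using S by blast
qed

text \<open>A union bound over the \<open>t / h\<close> cells of the grid, each of which contributes at most \<open>(e / t) * h\<close>.\<close>

lemma sup_jump_small_probability: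
  assumes t: "0 < t" and null: "emeasure \<nu> (cbox 0 w - {0}) = 0" "\<And>j. emeasure (\<mu> j) (cbox 0 w - {0}) = 0"
    and \<epsilon>: "0 < \<epsilon>" and K: "0 \<le> K" and e: "0 < e"
  shows "\<exists>Z\<in>sets M. prob Z \<le> e \<and>
    {\<omega> \<in> space M. (\<forall>j. path_sup_jump t \<omega> $ j \<le> w $ j) \<and> \<epsilon> < path_sup_jump t \<omega> $ i \<and>
      (\<forall>u. 0 \<le> u \<longrightarrow> u \<le> t \<longrightarrow> mass (X u \<omega>) \<le> K)} \<subseteq> Z"
proof -
  have "0 < e / t" using e t by simp
  from forbidden_rate[OF null \<epsilon> K this, of i] obtain m where m: "\<forall>\<^sub>F h in at_right 0. \<forall>y\<in>orthant_ball K.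
    step_prob h y (forbidden w i \<epsilon> m) \<le> e / t * h" by blast
  let ?D = "forbidden w i \<epsilon> m"
  have "\<forall>\<^sub>F N in sequentially. \<forall>y\<in>orthant_ball K.
    step_prob (t / real (1 * N)) y ?D \<le> e / t * (t / real (1 * N))"
    using filterlim_iff[THEN iffD1, OF filterlim_grid_step[OF t zero_less_one]] m by blast
  then have "\<forall>\<^sub>F N in sequentially. \<forall>y\<in>orthant_ball K.
    step_prob (t / real N) y ?D \<le> e / t * (t / real N)" by simp
  then obtain N0 where N0: "\<And>N y. N0 \<le> N \<Longrightarrow> y \<in> orthant_ball K \<Longrightarrow>
    step_prob (t / real N) y ?D \<le> e / t * (t / real N)"
    unfolding eventually_sequentially by blast
  define V where "V N k = {\<omega> \<in> space M. X (real k * (t / real N)) \<omega> \<in> orthant_ball K \<and>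
      X (real k * (t / real N) + t / real N) \<omega> - X (real k * (t / real N)) \<omega> \<in> ?D}" for N k
  \<comment> \<open>The shift by \<open>N0\<close> restricts attention to grids that are fine enough for the rate bound.\<close>
  define W where "W N = (\<Union>k\<in>{..<N + N0}. V (N + N0) k)" for N
  have V: "V (N + N0) k \<in> sets M \<and> prob (V (N + N0) k) \<le> e / t * (t / real (N + N0))" for N k
    unfolding V_def using t e by (intro single_increment_probability forbidden_borel N0) auto
  have Ws: "W N \<in> sets M" for N unfolding W_def using V by (intro sets.finite_UN) auto
  have Wp: "prob (W N) \<le> e" for N
  proof -
    have "prob (W N) \<le> (\<Sum>k\<in>{..<N + N0}. prob (V (N + N0) k))"
      unfolding W_def using V by (intro finite_measure_subadditive_finite) auto
    also have "\<dots> \<le> (\<Sum>k\<in>{..<N + N0}. e / t * (t / real (N + N0)))" using V by (intro sum_mono) auto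
    also have "\<dots> \<le> e"
      using t e by (cases "N + N0 = 0") auto
    finally show ?thesis .
  qed
  define Z where "Z = (\<Union>n. \<Inter>N\<in>{n..}. W N)"
  have Zs: "(\<Inter>N\<in>{n..}. W N) \<in> sets M" for n using Ws by (intro sets.countable_INT') auto
  have "(\<lambda>n. prob (\<Inter>N\<in>{n..}. W N)) \<longlonglongrightarrow> prob Z" unfolding Z_def
  proof (rule finite_Lim_measure_incseq)
    show "incseq (\<lambda>n. \<Inter>N\<in>{n..}. W N)" by (intro incseq_SucI INT_anti_mono) auto
  qed (use Zs in auto)
  moreover have "prob (\<Inter>N\<in>{n..}. W N) \<le> e" for n
  proof -
    have "prob (\<Inter>N\<in>{n..}. W N) \<le> prob (W n)" using Ws by (intro finite_measure_mono INT_lower) auto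
    then show ?thesis using Wp[of n] by linarith
  qed
  ultimately have "prob Z \<le> e" by (intro LIMSEQ_le_const2) auto
  moreover have "Z \<in> sets M" unfolding Z_def using Zs by (intro sets.countable_UN) auto
  moreover have "{\<omega> \<in> space M. (\<forall>j. path_sup_jump t \<omega> $ j \<le> w $ j) \<and> \<epsilon> < path_sup_jump t \<omega> $ i \<and>
      (\<forall>u. 0 \<le> u \<longrightarrow> u \<le> t \<longrightarrow> mass (X u \<omega>) \<le> K)} \<subseteq> Z"
  proof
    fix \<omega> assume "\<omega> \<in> {\<omega> \<in> space M. (\<forall>j. path_sup_jump t \<omega> $ j \<le> w $ j) \<and> \<epsilon> < path_sup_jump t \<omega> $ i \<and>
      (\<forall>u. 0 \<le> u \<longrightarrow> u \<le> t \<longrightarrow> mass (X u \<omega>) \<le> K)}"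
    then have sp: "\<omega> \<in> space M" and le: "\<And>j. path_sup_jump t \<omega> $ j \<le> w $ j"
      and i: "\<epsilon> < path_sup_jump t \<omega> $ i" and bd: "\<And>u. 0 \<le> u \<Longrightarrow> u \<le> t \<Longrightarrow> mass (X u \<omega>) \<le> K" by auto
    let ?g = "\<lambda>j N. grid_max (\<lambda>s. X s \<omega> $ j) t N"
    have lim: "?g j \<longlonglongrightarrow> path_sup_jump t \<omega> $ j" for j by (rule path_grid_max_tendsto[OF sp t])
    have "\<forall>\<^sub>F N in sequentially. \<epsilon> < ?g i N" by (rule order_tendstoD(1)[OF lim i])
    moreover have "\<forall>\<^sub>F N in sequentially. \<forall>j\<in>UNIV. exp (- (w $ j)) - 1 / real (Suc m) < exp (- ?g j N)"
    proof (rule eventually_ball_finite[OF finite], rule ballI)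
      fix j
      have "(\<lambda>N. exp (- ?g j N)) \<longlonglongrightarrow> exp (- (path_sup_jump t \<omega> $ j))" by (intro tendsto_intros lim)
      moreover have "exp (- (w $ j)) - 1 / real (Suc m) < exp (- (path_sup_jump t \<omega> $ j))"
      proof -
        have "exp (- (w $ j)) \<le> exp (- (path_sup_jump t \<omega> $ j))" using le[of j] by simp
        moreover have "0 < 1 / real (Suc m)" by simp
        ultimately show ?thesis by linarith
      qed
      ultimately show "\<forall>\<^sub>F N in sequentially. exp (- (w $ j)) - 1 / real (Suc m) < exp (- ?g j N)"
        by (rule order_tendstoD(1))
    qed
    ultimately have "\<forall>\<^sub>F N in sequentially. \<exists>k<N. \<omega> \<in> V N k"
      using eventually_gt_at_top[of 0]
    proof eventually_elim
      case (elim N)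
      define h where "h = t / real N"
      have h: "0 < h" "real N * h = t" using t elim(3) by (auto simp: h_def)
      have "?g i N \<in> (\<lambda>k. grid_increment h 0 k \<omega> $ i) ` {..<N}"
        unfolding grid_max_path h_def[symmetric] using elim(3) by (intro Max_in) auto
      then obtain k where k: "k < N" and gk: "?g i N = grid_increment h 0 k \<omega> $ i" by auto
      have "grid_increment h 0 k \<omega> $ j \<le> ?g j N" for j
        unfolding grid_max_path h_def[symmetric] using k by (intro Max_ge) auto
      then have "exp (- ?g j N) \<le> exp (- (grid_increment h 0 k \<omega> $ j))" for j by simp
      then have "exp (- (w $ j)) - 1 / real (Suc m) \<le> exp (- (grid_increment h 0 k \<omega> $ j))" for j
        by (rule order_trans[OF less_imp_le[OF elim(2)[rule_format, OF UNIV_I]]])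
      moreover have "\<epsilon> \<le> grid_increment h 0 k \<omega> $ i" using elim(1) gk by simp
      ultimately have "grid_increment h 0 k \<omega> \<in> ?D" unfolding forbidden_def by blast
      moreover have "grid_increment h 0 k \<omega> = X (real k * h + h) \<omega> - X (real k * h) \<omega>"
      proof -
        have "real (Suc k) * h = real k * h + h" by (simp add: algebra_simps)
        then show ?thesis by (simp only: grid_increment_def add_0)
      qed
      moreover have "X (real k * h) \<omega> \<in> orthant_ball K"
      proof -
        have "0 \<le> real k * h" using h by simp
        moreover have "real k * h \<le> real N * h" using k h by (intro mult_right_mono) auto
        ultimately show ?thesis using bd X_nonneg[OF _ sp] h(2) by (simp add: orthant_ball_def)
      qed
      ultimately show ?case using sp k unfolding V_def h_def by auto
    qed
    then obtain n where n: "\<And>N. n \<le> N \<Longrightarrow> \<exists>k<N. \<omega> \<in> V N k" unfolding eventually_sequentially by blast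
    have "\<omega> \<in> W N" if nN: "n \<le> N" for N
    proof -
      obtain k where "k < N + N0" "\<omega> \<in> V (N + N0) k" 
        using n[OF trans_le_add1[OF nN]] by blast
      then show ?thesis unfolding W_def by blast
    qed
    then show "\<omega> \<in> Z" unfolding Z_def by blast
  qed
  ultimately show ?thesis by blast
qed

lemma sup_jump_probability_zero:
  assumes t: "0 < t" and null: "emeasure \<nu> (cbox 0 w - {0}) = 0" "\<And>j. emeasure (\<mu> j) (cbox 0 w - {0}) = 0"
  shows "emeasure M {\<omega> \<in> space M. path_sup_jump t \<omega> \<in> cbox 0 w - {0}} = 0"
proof -
  define Z where "Z i n k = {\<omega> \<in> space M. (\<forall>j. path_sup_jump t \<omega> $ j \<le> w $ j) \<and>
      1 / real (Suc n) < path_sup_jump t \<omega> $ i \<and> (\<forall>u. 0 \<le> u \<longrightarrow> u \<le> t \<longrightarrow> mass (X u \<omega>) \<le> real k)}"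
    for i and n k :: nat
  have "\<exists>N\<in>null_sets M. Z i n k \<subseteq> N" for i n k
  proof -
    have "\<forall>l :: nat. \<exists>Y. Y \<in> sets M \<and> prob Y \<le> 1 / real (Suc l) \<and> Z i n k \<subseteq> Y"
    proof
      fix l :: nat
      have "0 < 1 / real (Suc n)" "0 < 1 / real (Suc l)" by simp_all
      from sup_jump_small_probability[OF t null this(1) of_nat_0_le_iff this(2), of i k]
      show "\<exists>Y. Y \<in> sets M \<and> prob Y \<le> 1 / real (Suc l) \<and> Z i n k \<subseteq> Y" unfolding Z_def by blast
    qed
    then obtain Y where Y: "\<forall>l. Y l \<in> sets M \<and> prob (Y l) \<le> 1 / real (Suc l) \<and> Z i n k \<subseteq> Y l"
      unfolding choice_iff by blast
    have I: "(\<Inter>l. Y l) \<in> sets M" using Y by (intro sets.countable_INT) auto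
    have "prob (\<Inter>l. Y l) \<le> 0"
    proof (rule field_le_epsilon)
      fix e :: real assume "0 < e"
      then obtain l where l: "inverse (real (Suc l)) < e" using reals_Archimedean by blast
      have "prob (\<Inter>l. Y l) \<le> prob (Y l)" using Y by (intro finite_measure_mono INT_lower) auto
      also have "\<dots> \<le> 1 / real (Suc l)" using Y by blast
      finally show "prob (\<Inter>l. Y l) \<le> 0 + e" using l by (simp add: inverse_eq_divide)
    qed
    then have "prob (\<Inter>l. Y l) = 0" by (intro order_antisym measure_nonneg)
    then have "(\<Inter>l. Y l) \<in> null_sets M" using I by (intro null_setsI) (simp_all add: emeasure_eq_measure)
    moreover have "Z i n k \<subseteq> (\<Inter>l. Y l)" using Y by blast
    ultimately show ?thesis by blast
  qed
  then have "\<forall>i n k. \<exists>N. N \<in> null_sets M \<and> Z i n k \<subseteq> N" by blast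
  then obtain N where N: "\<forall>i n k. N i n k \<in> null_sets M \<and> Z i n k \<subseteq> N i n k"
    unfolding choice_iff by blast
  have "{\<omega> \<in> space M. path_sup_jump t \<omega> \<in> cbox 0 w - {0}} \<subseteq> (\<Union>i. \<Union>n. \<Union>k. N i n k)"
  proof
    fix \<omega> assume "\<omega> \<in> {\<omega> \<in> space M. path_sup_jump t \<omega> \<in> cbox 0 w - {0}}"
    then have sp: "\<omega> \<in> space M" and S: "\<And>j. 0 \<le> path_sup_jump t \<omega> $ j" "\<And>j. path_sup_jump t \<omega> $ j \<le> w $ j"
      and S0: "path_sup_jump t \<omega> \<noteq> 0" by (auto simp: mem_box_cart)
    obtain i where "path_sup_jump t \<omega> $ i \<noteq> 0" using S0 by (auto simp: vec_eq_iff)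
    then have "0 < path_sup_jump t \<omega> $ i" using S(1)[of i] by linarith
    then obtain n where n: "inverse (real (Suc n)) < path_sup_jump t \<omega> $ i" using reals_Archimedean by blast
    obtain k :: nat where "\<forall>u. 0 \<le> u \<longrightarrow> u \<le> t \<longrightarrow> mass (X u \<omega>) \<le> real k"
      using path_bounded[OF sp t] by (elim exE)
    then have "\<omega> \<in> Z i n k" using sp S(2) n unfolding Z_def by (simp add: inverse_eq_divide)
    then have "\<omega> \<in> N i n k" by (rule subsetD[OF conjunct2[OF N[rule_format]]])
    then show "\<omega> \<in> (\<Union>i. \<Union>n. \<Union>k. N i n k)" by (intro UN_I UNIV_I)
  qed
  moreover have "(\<Union>i. \<Union>n. \<Union>k. N i n k) \<in> null_sets M"
    by (intro null_sets_UN'[OF countable_finite[OF finite]] null_sets_UN conjunct1[OF N[rule_format]])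
  from emeasure_mono[OF calculation null_setsD2[OF this]] null_setsD1[OF this]
  show ?thesis by simp
qed

end

theorem theorem5p6:
  fixes c \<beta> :: "real ^ 'd" and B :: "real ^ 'd ^ 'd"
    and \<nu> :: "(real ^ 'd) measure" and \<mu> :: "'d \<Rightarrow> (real ^ 'd) measure"
    and \<Omega> :: "'w measure" and P :: "real ^ 'd \<Rightarrow> 'w measure"
    and X :: "real \<Rightarrow> 'w \<Rightarrow> real ^ 'd"
  assumes "cbi_process c \<beta> B \<nu> \<mu> \<Omega> P X"
    and "(\<integral>\<^sup>+ r. ennreal (norm r) * indicator {r. 1 \<le> norm r} r \<partial>\<nu>) < \<infinity>"
  shows
    "(\<forall>A\<in>rectangles. emeasure \<nu> A + (\<Sum>i\<in>UNIV. emeasure (\<mu> i) A) = 0 \<longrightarrow>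
        (\<forall>t>0. \<forall>x\<in>nonneg_orthant. emeasure (sup_jump_law P X t x) A = 0)) \<and>
     (\<forall>t>0. \<forall>x\<in>pos_orthant. \<forall>A\<in>rectangles. emeasure (sup_jump_law P X t x) A = 0 \<longrightarrow>
        emeasure \<nu> A + (\<Sum>i\<in>UNIV. emeasure (\<mu> i) A) = 0) \<and>
     (\<beta> \<in> pos_orthant \<longrightarrow>
        (\<forall>t>0. \<forall>x\<in>nonneg_orthant. \<forall>A\<in>rectangles. emeasure (sup_jump_law P X t x) A = 0 \<longrightarrow>
           emeasure \<nu> A + (\<Sum>i\<in>UNIV. emeasure (\<mu> i) A) = 0))"
proof -
  obtain Q v where adm: "admissible c \<beta> B \<nu> \<mu>" and cad: "\<forall>\<omega>\<in>space \<Omega>. cadlag (\<lambda>t. X t \<omega>)"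
    and Q: "markov_semigroup orthant_space Q" and v: "cumulant_semigroup c B \<mu> v"
    and L: "\<forall>t\<ge>0. \<forall>x\<in>nonneg_orthant. \<forall>\<xi>\<in>nonneg_orthant.
          (\<integral>y. exp (- (\<xi> \<bullet> y)) \<partial>Q t x) =
          exp (- (x \<bullet> v t \<xi>) - integral {0..t} (\<lambda>s. immigration_mechanism \<beta> \<nu> (v s \<xi>)))"
    and PX: "\<forall>x\<in>nonneg_orthant. sets (P x) = sets \<Omega> \<and> markov_process_from (P x) orthant_space Q X x"
    using assms(1) unfolding cbi_process_def cbi_semigroup_def by blast
  have path: "cbi_path c \<beta> B \<nu> \<mu> v Q (P x) X x" if x: "x \<in> nonneg_orthant" for x
  proof
    show "cadlag (\<lambda>t. X t \<omega>)" if "\<omega> \<in> space (P x)" for \<omega>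
      using cad PX x that sets_eq_imp_space_eq[of "P x" \<Omega>] by auto
  qed (use adm assms(2) v Q L PX x in auto)
  have law: "emeasure (sup_jump_law P X t x) (cbox 0 w - {0}) =
      emeasure (P x) {\<omega> \<in> space (P x). sup_jump (\<lambda>s. X s \<omega>) t \<in> cbox 0 w - {0}}"
    if "0 < t" "x \<in> nonneg_orthant" for t x w
  proof -
    interpret cbi_path c \<beta> B \<nu> \<mu> v Q "P x" X x by (rule path[OF that(2)])
    have "cbox 0 w - {0} \<in> sets (orthant_space :: (real ^ 'd) measure)"
      unfolding orthant_space_def
      by (subst sets_restrict_space_iff) (auto simp: nonneg_orthant_def mem_box_cart)
    then show ?thesis unfolding sup_jump_law_def
      using emeasure_distr[OF path_sup_jump_measurable[OF that(1)]]
      by (simp add: vimage_def Int_def conj_commute)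
  qed
  have part1: "emeasure (sup_jump_law P X t x) A = 0"
    if A: "A \<in> rectangles" and null: "emeasure \<nu> A + (\<Sum>i\<in>UNIV. emeasure (\<mu> i) A) = 0"
      and t: "0 < t" and x: "x \<in> nonneg_orthant" for A t x
  proof -
    interpret cbi_path c \<beta> B \<nu> \<mu> v Q "P x" X x by (rule path[OF x])
    obtain w where A: "A = cbox 0 w - {0}" using A by (auto simp: rectangles_def)
    have "emeasure \<nu> (cbox 0 w - {0}) = 0" "emeasure (\<mu> j) (cbox 0 w - {0}) = 0" for j
      using null unfolding A by (auto simp: sum_eq_0_iff)
    then show ?thesis unfolding A law[OF t x] by (rule sup_jump_probability_zero[OF t])
  qed
  have part2: "emeasure \<nu> A + (\<Sum>i\<in>UNIV. emeasure (\<mu> i) A) = 0"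
    if A: "A \<in> rectangles" and zero: "emeasure (sup_jump_law P X t x) A = 0"
      and t: "0 < t" and x: "x \<in> nonneg_orthant" and int: "x \<in> pos_orthant \<or> \<beta> \<in> pos_orthant" for A t x
  proof (rule ccontr)
    interpret cbi_path c \<beta> B \<nu> \<mu> v Q "P x" X x by (rule path[OF x])
    obtain w where w: "w \<in> pos_orthant" and A: "A = cbox 0 w - {0}" using A by (auto simp: rectangles_def)
    assume "emeasure \<nu> A + (\<Sum>i\<in>UNIV. emeasure (\<mu> i) A) \<noteq> 0"
    from sup_jump_probability_positive[OF w t int this[unfolded A]]
    show False using zero unfolding A law[OF t x] by (simp add: measure_def)
  qed
  have "pos_orthant \<subseteq> (nonneg_orthant :: (real ^ 'd) set)"
    by (auto simp: pos_orthant_def nonneg_orthant_def intro: less_imp_le)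
  then show ?thesis using part1 part2 by blast
qed

end
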